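(* Suppose that $f:\Omega\to X$ is a Lipschitz continuous map from an open set $\Omega\subset\mathbb{R}^n$ onto a metric space $X$, i.e. $f(\Omega)=X$. Then $\dim X=n$ if and only if $\mathcal{H}^n(X)>0$.
   Context: $\mathcal{H}^n$ is the $n$-dimensional Hausdorff measure on $X$. $\dim X$ is the topological (small inductive) dimension of the metric space $X$, defined as follows: $\dim X$ is an integer $\geq -1$ or $\infty$; $\dim X=-1$ iff $X=\varnothing$; $\dim X\leq n$ if every point of $X$ has arbitrarily small (open) neighborhoods whose boundaries have dimension $\leq n-1$; $\dim X=n$ if $\dim X\leq n$ holds and $\dim X\leq n-1$ does not; $\dim X=\infty$ if $\dim X\leq n$ is false for all integers $n\geq-1$. *)

theory Defs
  imports "HOL-Analysis.Analysis"
begin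

text \<open>The set \<open>A\<close> is covered by countably many sets of diameter at most \<open>\<delta>\<close>. Boundedness is required
  because \<^const>\<open>diameter\<close> is a real number and carries no information for unbounded sets. The empty
  set has weight \<open>0\<close> also for \<open>n = 0\<close>, where \<open>0 ^ 0 = 1\<close>. The factor \<open>\<omega>\<^sub>n / 2 ^ n\<close>, with \<open>\<omega>\<^sub>n\<close> the
  volume of the unit ball, makes the measure agree with Lebesgue measure on Euclidean \<open>n\<close>-space.\<close>

definition hausdorff_weight :: "nat \<Rightarrow> 'a::metric_space set \<Rightarrow> ennreal" where
  "hausdorff_weight n U =
    (if U = {} then 0 else ennreal (unit_ball_vol (real n) / 2 ^ n * diameter U ^ n))"

definition hausdorff_content :: "nat \<Rightarrow> real \<Rightarrow> 'a::metric_space set \<Rightarrow> ennreal" where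
  "hausdorff_content n \<delta> A =
    (INF U \<in> {U :: nat \<Rightarrow> 'a set. A \<subseteq> (\<Union>i. U i) \<and> (\<forall>i. bounded (U i) \<and> diameter (U i) \<le> \<delta>)}.
      \<Sum>i. hausdorff_weight n (U i))"

text \<open>The content increases as \<open>\<delta>\<close> decreases, so the limit for \<open>\<delta> \<rightarrow> 0\<close> is a supremum. Intersecting
  the covering sets with \<open>A\<close> shows that the value depends only on the metric of \<open>A\<close>, not on the
  ambient space.\<close>

definition hausdorff_measure :: "nat \<Rightarrow> 'a::metric_space set \<Rightarrow> ennreal" where
  "hausdorff_measure n A = (SUP \<delta>\<in>{0<..}. hausdorff_content n \<delta> A)"

inductive ind_dim_le :: "'a topology \<Rightarrow> int \<Rightarrow> bool" where
  empty: "topspace T = {} \<Longrightarrow> ind_dim_le T (- 1)"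
| step: "n \<ge> 0 \<Longrightarrow>
    (\<And>V x. openin T V \<Longrightarrow> x \<in> V \<Longrightarrow>
      \<exists>U. openin T U \<and> x \<in> U \<and> U \<subseteq> V \<and>
          ind_dim_le (subtopology T (T frontier_of U)) (n - 1)) \<Longrightarrow>
    ind_dim_le T n"

text \<open>The infimum of the empty set is \<open>\<infinity>\<close>. The lemmas below recover the usual characterization of
  the values of the small inductive dimension.\<close>

definition small_ind_dim :: "'a topology \<Rightarrow> ereal" where
  "small_ind_dim T = (INF k \<in> {k. ind_dim_le T k}. ereal (real_of_int k))"

lemma ind_dim_le_ge: "ind_dim_le T k \<Longrightarrow> k \<ge> - 1"
  by (erule ind_dim_le.cases) auto

lemma ind_dim_le_minus_one_iff: "ind_dim_le T (- 1) \<longleftrightarrow> topspace T = {}"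
  by (auto elim: ind_dim_le.cases intro: ind_dim_le.empty)

lemma ind_dim_le_Suc: "ind_dim_le T k \<Longrightarrow> ind_dim_le T (k + 1)"
proof (induction rule: ind_dim_le.induct)
  case (empty T)
  then have "V = {}" if "openin T V" for V
    using openin_subset[OF that] by auto
  then show ?case
    by (intro ind_dim_le.step) auto
next
  case (step n T)
  show ?case
  proof (rule ind_dim_le.step)
    show "n + 1 \<ge> 0" using step.hyps by simp
    fix V x assume "openin T V" "x \<in> V"
    from step.IH[OF this] show "\<exists>U. openin T U \<and> x \<in> U \<and> U \<subseteq> V \<and>
        ind_dim_le (subtopology T (T frontier_of U)) (n + 1 - 1)"
      by auto
  qed
qed

lemma ind_dim_le_mono:
  assumes "ind_dim_le T k" "k \<le> m"
  shows "ind_dim_le T m"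
  using assms(2,1) by (induction m rule: int_ge_induct) (auto intro: ind_dim_le_Suc)

lemma small_ind_dim_le_iff: "small_ind_dim T \<le> ereal (real_of_int m) \<longleftrightarrow> ind_dim_le T m"
proof
  assume "ind_dim_le T m"
  then show "small_ind_dim T \<le> ereal (real_of_int m)"
    unfolding small_ind_dim_def by (intro INF_lower) simp
next
  assume le: "small_ind_dim T \<le> ereal (real_of_int m)"
  show "ind_dim_le T m"
  proof (rule ccontr)
    assume "\<not> ind_dim_le T m"
    then have "m + 1 \<le> k" if "ind_dim_le T k" for k
      using ind_dim_le_mono[OF that, of m] by linarith
    then have "ereal (real_of_int (m + 1)) \<le> small_ind_dim T"
      unfolding small_ind_dim_def by (intro INF_greatest) (simp del: of_int_add)
    with le have "ereal (real_of_int (m + 1)) \<le> ereal (real_of_int m)"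
      by (rule order_trans[rotated])
    then show False by simp
  qed
qed

lemma small_ind_dim_eq_iff:
  "small_ind_dim T = ereal (real_of_int m) \<longleftrightarrow> ind_dim_le T m \<and> \<not> ind_dim_le T (m - 1)"
proof
  assume "small_ind_dim T = ereal (real_of_int m)"
  then show "ind_dim_le T m \<and> \<not> ind_dim_le T (m - 1)"
    by (simp flip: small_ind_dim_le_iff)
next
  assume *: "ind_dim_le T m \<and> \<not> ind_dim_le T (m - 1)"
  then have "m \<le> k" if "ind_dim_le T k" for k
    using ind_dim_le_mono[OF that, of "m - 1"] by linarith
  then have "ereal (real_of_int m) \<le> small_ind_dim T"
    unfolding small_ind_dim_def by (intro INF_greatest) simp
  with * show "small_ind_dim T = ereal (real_of_int m)"
    using small_ind_dim_le_iff[of T m] by (auto intro: antisym)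
qed

lemma small_ind_dim_eq_infinity_iff: "small_ind_dim T = \<infinity> \<longleftrightarrow> (\<forall>m. \<not> ind_dim_le T m)"
proof
  assume "small_ind_dim T = \<infinity>"
  then show "\<forall>m. \<not> ind_dim_le T m"
    by (simp flip: small_ind_dim_le_iff)
next
  assume "\<forall>m. \<not> ind_dim_le T m"
  then show "small_ind_dim T = \<infinity>"
    by (simp add: small_ind_dim_def top_ereal_def)
qed

end

theory Submission imports Defs begin

text \<open>
  Write \<open>n\<close> for the dimension of the domain. In terms of the relation \<^const>\<open>ind_dim_le\<close> two facts
  have to be shown: \<open>X\<close> has dimension at most \<open>n\<close>, and \<open>X\<close> has dimension at most \<open>n - 1\<close> if and only if
  it is null for the \<open>n\<close>-dimensional Hausdorff measure.

  \<^bold>\<open>Null sets have small dimension.\<close> If \<open>X\<close> is null for the \<open>(m + 1)\<close>-dimensional measure, then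
  for every centre almost every metric sphere is null for the \<open>m\<close>-dimensional measure
  (\<open>sphere_slices_null\<close>, an inequality of Eilenberg type), so induction on \<open>m\<close> bounds the dimension by
  \<open>m\<close> (\<open>hausdorff_null_imp_ind_dim_le\<close>, a theorem of Szpilrajn). As a Lipschitz image of an open subset
  of \<open>n\<close>-space is null in dimension \<open>n + 1\<close>, this gives dimension at most \<open>n\<close>, and it gives one
  direction of the equivalence.

  \<^bold>\<open>Small dimension forces measure zero.\<close> Assume that \<open>X\<close> has dimension at most \<open>n - 1\<close>. On a compact
  subset of \<open>X\<close> every system of \<open>n\<close> continuous functions that have no common zero on a closed subset
  extends without common zero (\<open>ind_dim_le_imp_nonvanishing_extension\<close>). With Brouwer's fixed point
  theorem it follows that a map \<open>G\<close> from the image of a ball to \<open>n\<close>-space cannot make \<open>G \<circ> f\<close>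
  point outward everywhere on the boundary sphere (\<open>not_ind_dim_le_if_outward\<close>).

  The analysis consists in producing such a \<open>G\<close> wherever \<open>f\<close> is not degenerate. Metric
  differentiability almost everywhere is replaced by statements about most points at a fixed small scale
  \<open>r\<close>, which come from two elementary monotonicity arguments. First, the integral of
  \<open>d (f x, f (x + h)) / |h|\<close> over \<open>x\<close>, suitably cut off, increases when \<open>h\<close> is halved, because of the
  triangle inequality. Hence it
  converges, and finitely many distance functions \<open>d (p\<^sub>i, \<cdot>)\<close> compute the distance up to a small
  fraction of \<open>r\<close>, at all small scales \<open>r\<close> and for most points (\<open>sup_increment_attained_by_finite\<close>).
  Second, for each of the real functions \<open>u = d (p\<^sub>i, f \<cdot>)\<close> the parallelogram law makes the
  squared \<open>L\<^sup>2\<close> norms of its second differences, scaled, telescope (\<open>second_increment_eventually_small\<close>), so that \<open>u\<close> is nearly affine on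
  most balls of radius comparable to \<open>r\<close> (\<open>almost_affine\<close>).

  At a good point there are thus finitely many gradients \<open>a\<^sub>i\<close>. If no direction is almost annihilated by all
  of them, then \<open>G = (\<Sum>i. d (p\<^sub>i, \<cdot>) a\<^sub>i)\<close>, suitably normalized, points outward, which is impossible. So
  some direction \<open>w\<close> is almost annihilated, \<open>f\<close> hardly moves along \<open>w\<close>, and the image of a ball of radius
  \<open>2 r\<close> is close to the image of an \<open>(n - 1)\<close>-dimensional slice: it is covered by \<open>O (N\<^bsup>n - 1\<^esup>)\<close> balls of
  radius \<open>O (r / N)\<close> (\<open>thin_cover_at_good_point\<close>). These contribute \<open>O (r\<^sup>n / N)\<close> to the Hausdorff
  sum, a bad ball contributes \<open>O (r\<^sup>n)\<close>, and bad balls are few. Summation shows that the image is null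
  (\<open>lipschitz_image_cball_null\<close>).
\<close>


section \<open>Null sets of the Hausdorff measure and the upper bound on dimension\<close>

lemma hausdorff_content_zero_iff:
  "hausdorff_content n \<delta> A = 0 \<longleftrightarrow> (\<forall>e>0. \<exists>U::nat \<Rightarrow> 'a::metric_space set. A \<subseteq> (\<Union>i. U i) \<and>
      (\<forall>i. bounded (U i) \<and> diameter (U i) \<le> \<delta>) \<and> (\<Sum>i. hausdorff_weight n (U i)) < ennreal e)"
  (is "?L \<longleftrightarrow> ?R")
proof
  assume ?L
  show ?R
  proof (intro allI impI)
    fix e :: real assume "e > 0"
    then have "hausdorff_content n \<delta> A < ennreal e" using \<open>?L\<close> by simp
    then show "\<exists>U::nat \<Rightarrow> 'a set. A \<subseteq> (\<Union>i. U i) \<and>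
      (\<forall>i. bounded (U i) \<and> diameter (U i) \<le> \<delta>) \<and> (\<Sum>i. hausdorff_weight n (U i)) < ennreal e"
      unfolding hausdorff_content_def INF_less_iff by auto
  qed
next
  assume ?R
  have "hausdorff_content n \<delta> A \<le> ennreal e" if "e > 0" for e
  proof -
    from \<open>?R\<close> that have "hausdorff_content n \<delta> A < ennreal e"
      unfolding hausdorff_content_def INF_less_iff by auto
    then show ?thesis by simp
  qed
  then have "hausdorff_content n \<delta> A \<le> 0 + ennreal e" if "e > 0" for e
    using that by simp
  then have "hausdorff_content n \<delta> A \<le> 0"
    by (rule ennreal_le_epsilon)
  then show ?L by simp
qed

lemma hausdorff_measure_zero_iff:
  "hausdorff_measure n A = 0 \<longleftrightarrow> (\<forall>\<delta>>0. hausdorff_content n \<delta> A = 0)"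
  by (auto simp: hausdorff_measure_def SUP_eq_iff simp flip: bot_ennreal)

lemma hausdorff_measure_null_subset:
  assumes "hausdorff_measure n B = 0" "A \<subseteq> B"
  shows "hausdorff_measure n A = 0"
  using assms unfolding hausdorff_measure_zero_iff hausdorff_content_zero_iff
  by (meson order_trans)

lemma hausdorff_measure_null_UN:
  fixes A :: "nat \<Rightarrow> 'a::metric_space set"
  assumes "\<And>k. hausdorff_measure n (A k) = 0"
  shows "hausdorff_measure n (\<Union>k. A k) = 0"
  unfolding hausdorff_measure_zero_iff hausdorff_content_zero_iff
proof (intro allI impI)
  fix \<delta> e :: real assume \<delta>: "\<delta> > 0" and e: "e > 0"
  have "\<exists>U::nat \<Rightarrow> 'a set. A k \<subseteq> (\<Union>i. U i) \<and> (\<forall>i. bounded (U i) \<and> diameter (U i) \<le> \<delta>) \<and>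
      (\<Sum>i. hausdorff_weight n (U i)) < ennreal (e / 2 * (1/2) ^ Suc k)" for k
  proof -
    have "e / 2 * (1/2) ^ Suc k > 0" using e by simp
    then show ?thesis
      using assms[of k] \<delta> unfolding hausdorff_measure_zero_iff hausdorff_content_zero_iff by blast
  qed
  then obtain U :: "nat \<Rightarrow> nat \<Rightarrow> 'a set" where U: "\<And>k. A k \<subseteq> (\<Union>i. U k i)"
    "\<And>k i. bounded (U k i)" "\<And>k i. diameter (U k i) \<le> \<delta>"
    "\<And>k. (\<Sum>i. hausdorff_weight n (U k i)) < ennreal (e / 2 * (1/2) ^ Suc k)"
    by metis
  define V where "V j = case_prod U (prod_decode j)" for j
  have "(\<Union>k. A k) \<subseteq> (\<Union>j. V j)"
  proof
    fix x assume "x \<in> (\<Union>k. A k)"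
    then obtain k i where "x \<in> U k i" using U(1) by blast
    then have "x \<in> V (prod_encode (k, i))" by (simp add: V_def)
    then show "x \<in> (\<Union>j. V j)" by blast
  qed
  moreover have "\<forall>j. bounded (V j) \<and> diameter (V j) \<le> \<delta>"
    using U(2,3) by (simp add: V_def split: prod.split)
  moreover have "(\<Sum>j. hausdorff_weight n (V j)) < ennreal e"
  proof -
    have "(\<Sum>j. hausdorff_weight n (V j)) = (\<Sum>k. \<Sum>i. hausdorff_weight n (U k i))"
      using suminf_ennreal_2dimen[of "\<lambda>k. \<Sum>i. hausdorff_weight n (U k i)" "\<lambda>p. hausdorff_weight n (case_prod U p)"]
      by (simp add: V_def comp_def)
    also have "\<dots> \<le> (\<Sum>k. ennreal (e / 2 * (1/2) ^ Suc k))"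
      using U(4) by (intro suminf_le summableI) (auto intro: less_imp_le)
    also have "\<dots> = ennreal (e / 2)"
    proof -
      have "(\<lambda>k. e / 2 * (1/2) ^ Suc k) sums (e / 2 * 1)"
        by (intro sums_mult power_half_series)
      then show ?thesis using e by (intro suminf_ennreal_eq) auto
    qed
    also have "\<dots> < ennreal e" using e by (intro ennreal_lessI) auto
    finally show ?thesis .
  qed
  ultimately show "\<exists>U::nat \<Rightarrow> 'a set. (\<Union>k. A k) \<subseteq> (\<Union>i. U i) \<and> (\<forall>i. bounded (U i) \<and> diameter (U i) \<le> \<delta>) \<and>
      (\<Sum>i. hausdorff_weight n (U i)) < ennreal e"
    by blast
qed

text \<open>A finite cover is padded with empty sets, whose weight is \<open>0\<close>, and the normalizing constant is
  absorbed into \<open>e\<close>.\<close>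

lemma hausdorff_measure_null_if_finite_covers:
  fixes A :: "'a::metric_space set"
  assumes n: "n > 0"
    and cov: "\<And>\<delta> e. \<delta> > 0 \<Longrightarrow> e > 0 \<Longrightarrow> \<exists>F. finite F \<and> A \<subseteq> \<Union>F \<and>
      (\<forall>V\<in>F. bounded V \<and> diameter V \<le> \<delta>) \<and> (\<Sum>V\<in>F. diameter V ^ n) \<le> e"
  shows "hausdorff_measure n A = 0"
  unfolding hausdorff_measure_zero_iff hausdorff_content_zero_iff
proof (intro allI impI)
  fix \<delta> e :: real assume \<delta>: "\<delta> > 0" and e: "e > 0"
  define c where "c = unit_ball_vol (real n) / 2 ^ n"
  have c: "c > 0" by (simp add: c_def unit_ball_vol_pos)
  then have "e / (2 * c) > 0" using e by simp
  then obtain F where F: "finite F" "A \<subseteq> \<Union>F" "\<And>V. V \<in> F \<Longrightarrow> bounded V \<and> diameter V \<le> \<delta>"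
    "(\<Sum>V\<in>F. diameter V ^ n) \<le> e / (2 * c)"
    using cov[OF \<delta>, of "e / (2 * c)"] by blast
  obtain h where h: "bij_betw h {0..<card F} F"
    using ex_bij_betw_nat_finite[OF F(1)] by blast
  define U where "U i = (if i < card F then h i else {})" for i
  have hF: "h i \<in> F" if "i < card F" for i
    using h that by (auto simp: bij_betw_def)
  have "\<Union>F \<subseteq> (\<Union>i. U i)"
  proof
    fix x assume "x \<in> \<Union>F"
    then obtain V where "V \<in> F" "x \<in> V" by blast
    then have "V \<in> h ` {0..<card F}" using bij_betw_imp_surj_on[OF h] by simp
    then obtain i where "i < card F" "V = h i" by auto
    then have "x \<in> U i" using \<open>x \<in> V\<close> by (simp add: U_def)
    then show "x \<in> (\<Union>i. U i)" by blast
  qed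
  then have "A \<subseteq> (\<Union>i. U i)" by (rule order_trans[OF F(2)])
  moreover have "\<forall>i. bounded (U i) \<and> diameter (U i) \<le> \<delta>"
  proof
    fix i
    show "bounded (U i) \<and> diameter (U i) \<le> \<delta>"
      using F(3)[OF hF[of i]] \<delta> by (cases "i < card F") (simp_all add: U_def)
  qed
  moreover have "(\<Sum>i. hausdorff_weight n (U i)) < ennreal e"
  proof -
    have "(\<Sum>i. hausdorff_weight n (U i)) = (\<Sum>i\<in>{0..<card F}. hausdorff_weight n (U i))"
      by (rule suminf_finite) (auto simp: U_def hausdorff_weight_def)
    also have "\<dots> = (\<Sum>i\<in>{0..<card F}. hausdorff_weight n (h i))"
      by (intro sum.cong) (auto simp: U_def)
    also have "\<dots> = (\<Sum>V\<in>F. hausdorff_weight n V)"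
      by (rule sum.reindex_bij_betw[OF h])
    also have "\<dots> \<le> (\<Sum>V\<in>F. ennreal (c * diameter V ^ n))"
      by (intro sum_mono) (simp add: hausdorff_weight_def c_def)
    also have "\<dots> = ennreal (c * (\<Sum>V\<in>F. diameter V ^ n))"
    proof -
      have "0 \<le> c * diameter V ^ n" if "V \<in> F" for V
        using c diameter_ge_0[of V] F(3)[OF that] by simp
      then show ?thesis
        unfolding sum_distrib_left by (rule sum_ennreal)
    qed
    also have "\<dots> \<le> ennreal (e / 2)"
    proof (rule ennreal_leI)
      have "c * (\<Sum>V\<in>F. diameter V ^ n) \<le> c * (e / (2 * c))"
        using F(4) c by (intro mult_left_mono) simp_all
      also have "\<dots> = e / 2" using c by simp
      finally show "c * (\<Sum>V\<in>F. diameter V ^ n) \<le> e / 2" .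
    qed
    also have "\<dots> < ennreal e" using e by (intro ennreal_lessI) auto
    finally show ?thesis .
  qed
  ultimately show "\<exists>U::nat \<Rightarrow> 'a set. A \<subseteq> (\<Union>i. U i) \<and> (\<forall>i. bounded (U i) \<and> diameter (U i) \<le> \<delta>) \<and>
      (\<Sum>i. hausdorff_weight n (U i)) < ennreal e"
    by blast
qed

text \<open>A covering set \<open>U\<close> meets the sphere of radius \<open>r\<close> around \<open>p\<close> only if \<open>r\<close> lies in an interval of
  length \<open>diameter U\<close>. Integrating over \<open>r\<close> the sum of \<open>diameter U ^ m\<close> over the sets that meet the sphere
  therefore gives at most the sum of \<open>diameter U ^ Suc m\<close>. For covers whose sums are \<open>O ((1/2)\<^sup>l)\<close>
  the integrals are summable in \<open>l\<close>, so for almost every \<open>r\<close> the sums over the sphere tend to \<open>0\<close>.\<close>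

lemma sphere_slices_null:
  fixes X :: "'a::metric_space set"
  assumes X: "hausdorff_measure (Suc m) X = 0" and p: "p \<in> X"
  shows "AE r in lborel. hausdorff_measure m {x \<in> X. dist p x = r} = 0"
proof -
  define c1 where "c1 = unit_ball_vol (real (Suc m)) / 2 ^ Suc m"
  define c0 where "c0 = unit_ball_vol (real m) / 2 ^ m"
  have c: "c1 > 0" "c0 > 0" by (simp_all add: c1_def c0_def unit_ball_vol_pos)
  have "\<exists>U::nat \<Rightarrow> 'a set. X \<subseteq> (\<Union>i. U i) \<and> (\<forall>i. bounded (U i) \<and> diameter (U i) \<le> 1 / real (Suc l)) \<and>
      (\<Sum>i. hausdorff_weight (Suc m) (U i)) < ennreal (c1 * (1/2) ^ Suc l)" for l
  proof -
    have "c1 * (1/2) ^ Suc l > 0" "1 / real (Suc l) > 0" using c by simp_all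
    then show ?thesis
      using X unfolding hausdorff_measure_zero_iff hausdorff_content_zero_iff by blast
  qed
  then obtain U :: "nat \<Rightarrow> nat \<Rightarrow> 'a set" where U: "\<And>l. X \<subseteq> (\<Union>i. U l i)"
    "\<And>l i. bounded (U l i)" "\<And>l i. diameter (U l i) \<le> 1 / real (Suc l)"
    "\<And>l. (\<Sum>i. hausdorff_weight (Suc m) (U l i)) < ennreal (c1 * (1/2) ^ Suc l)"
    by metis
  \<comment> \<open>\<open>I l i\<close> contains all radii whose sphere meets \<open>U l i\<close>.\<close>
  define a where "a l i = Inf (dist p ` U l i)" for l i
  define I where "I l i = (if U l i = {} then {} else {a l i .. a l i + diameter (U l i)})" for l i
  have I: "dist p x \<in> I l i" if "x \<in> U l i" for l i x
  proof -
    have bb: "bdd_below (dist p ` U l i)" by (intro bdd_belowI2[of _ 0]) simp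
    have "a l i \<le> dist p x" unfolding a_def using that by (intro cINF_lower bb)
    moreover have "dist p x - diameter (U l i) \<le> a l i"
      unfolding a_def
    proof (rule cINF_greatest)
      show "U l i \<noteq> {}" using that by blast
      fix y assume "y \<in> U l i"
      then have "dist x y \<le> diameter (U l i)" using that U(2) by (intro diameter_bounded_bound) auto
      then show "dist p x - diameter (U l i) \<le> dist p y"
        using dist_triangle[of p x y] by (simp add: dist_commute)
    qed
    ultimately show ?thesis using that by (auto simp: I_def)
  qed
  have dnn: "diameter (U l i) \<ge> 0" for l i using U(2) by (rule diameter_ge_0)
  define G where "G l r = (\<Sum>i. ennreal (diameter (U l i) ^ m) * indicator (I l i) r)" for l and r :: real
  have Im[measurable]: "I l i \<in> sets borel" for l i by (simp add: I_def)
  have [measurable]: "G l \<in> borel_measurable lborel" for l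
    unfolding G_def by measurable
  have intG: "(\<integral>\<^sup>+ r. G l r \<partial>lborel) \<le> ennreal ((1/2) ^ Suc l)" for l
  proof -
    have "(\<integral>\<^sup>+ r. G l r \<partial>lborel) = (\<Sum>i. \<integral>\<^sup>+ r. ennreal (diameter (U l i) ^ m) * indicator (I l i) r \<partial>lborel)"
      unfolding G_def by (intro nn_integral_suminf) measurable
    also have "\<dots> = (\<Sum>i. ennreal (1 / c1) * hausdorff_weight (Suc m) (U l i))"
    proof (intro suminf_cong)
      fix i
      show "(\<integral>\<^sup>+ r. ennreal (diameter (U l i) ^ m) * indicator (I l i) r \<partial>lborel) = ennreal (1 / c1) * hausdorff_weight (Suc m) (U l i)"
      proof (cases "U l i = {}")
        case True
        then show ?thesis by (simp add: I_def hausdorff_weight_def)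
      next
        case False
        have "(\<integral>\<^sup>+ r. ennreal (diameter (U l i) ^ m) * indicator (I l i) r \<partial>lborel)
            = ennreal (diameter (U l i) ^ m) * emeasure lborel (I l i)"
          using Im by (subst nn_integral_cmult_indicator) simp_all
        also have "\<dots> = ennreal (diameter (U l i) ^ Suc m)"
          using False dnn[of l i] by (simp add: I_def mult.commute flip: ennreal_mult)
        also have "\<dots> = ennreal (1 / c1) * ennreal (c1 * diameter (U l i) ^ Suc m)"
          using c dnn[of l i] by (subst ennreal_mult[symmetric]) auto
        finally show ?thesis using False by (simp add: hausdorff_weight_def c1_def)
      qed
    qed
    also have "\<dots> = ennreal (1 / c1) * (\<Sum>i. hausdorff_weight (Suc m) (U l i))"
      by (rule ennreal_suminf_cmult)
    also have "\<dots> \<le> ennreal (1 / c1) * ennreal (c1 * (1/2) ^ Suc l)"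
      using U(4)[of l] by (intro mult_left_mono) auto
    also have "\<dots> = ennreal ((1/2) ^ Suc l)"
      using c by (subst ennreal_mult[symmetric]) auto
    finally show ?thesis .
  qed
  have "(\<integral>\<^sup>+ r. (\<Sum>l. G l r) \<partial>lborel) = (\<Sum>l. \<integral>\<^sup>+ r. G l r \<partial>lborel)"
    by (intro nn_integral_suminf) measurable
  also have "\<dots> \<le> (\<Sum>l. ennreal ((1/2) ^ Suc l))"
    using intG by (intro suminf_le summableI)
  also have "\<dots> = ennreal 1"
    by (intro suminf_ennreal_eq power_half_series) auto
  finally have "(\<integral>\<^sup>+ r. (\<Sum>l. G l r) \<partial>lborel) \<noteq> \<infinity>"
    by (auto simp: top_unique)
  then have "AE r in lborel. (\<Sum>l. G l r) \<noteq> \<infinity>"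
    by (intro nn_integral_noteq_infinite) measurable
  then show ?thesis
  proof (rule AE_mp, intro AE_I2 impI)
    fix r assume fin: "(\<Sum>l. G l r) \<noteq> \<infinity>"
    let ?S = "{x \<in> X. dist p x = r}"
    define V where "V l i = (if r \<in> I l i then U l i else {})" for l i
    have cov: "?S \<subseteq> (\<Union>i. V l i)" for l
      using U(1)[of l] I[of _ l] by (fastforce simp: V_def)
    have wt: "(\<Sum>i. hausdorff_weight m (V l i)) \<le> ennreal c0 * G l r" for l
    proof -
      have "(\<Sum>i. hausdorff_weight m (V l i)) \<le> (\<Sum>i. ennreal c0 * (ennreal (diameter (U l i) ^ m) * indicator (I l i) r))"
        using c dnn[of l] by (intro suminf_le summableI)
          (auto simp: V_def hausdorff_weight_def c0_def ennreal_mult[symmetric])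
      then show ?thesis by (simp add: G_def)
    qed
    show "hausdorff_measure m ?S = 0"
      unfolding hausdorff_measure_zero_iff hausdorff_content_zero_iff
    proof (intro allI impI)
      fix \<delta> e :: real assume \<delta>: "\<delta> > 0" and e: "e > 0"
      obtain N where N: "1 / real (Suc N) < \<delta>" using \<delta> nat_approx_posE by metis
      have "\<exists>l\<ge>N. G l r < ennreal (e / c0)"
      proof (rule ccontr)
        assume "\<not> ?thesis"
        then have ge: "ennreal (e / c0) \<le> G (l + N) r" for l by (auto simp: not_less)
        have "(\<Sum>l. ennreal (e / c0)) \<le> (\<Sum>l. G (l + N) r)"
          using ge by (intro suminf_le summableI) auto
        also have "\<dots> \<le> (\<Sum>l. G l r)"
        proof -
          have "(\<Sum>l. G l r) = (\<Sum>l. G (l + N) r) + (\<Sum>l<N. G l r)"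
            by (rule suminf_offset) (rule summableI)
          then show ?thesis by simp
        qed
        finally have "(\<Sum>l::nat. ennreal (e / c0)) \<noteq> top" using fin by (auto simp: top_unique)
        moreover have "(\<Sum>l::nat. ennreal (e / c0)) = top"
        proof (rule ccontr)
          assume "(\<Sum>l::nat. ennreal (e / c0)) \<noteq> top"
          then have "summable (\<lambda>l::nat. e / c0)"
            using e c by (intro summable_suminf_not_top) auto
          then show False using e c by (simp add: summable_const_iff)
        qed
        ultimately show False by blast
      qed
      then obtain l where l: "l \<ge> N" "G l r < ennreal (e / c0)" by blast
      have "(\<Sum>i. hausdorff_weight m (V l i)) < ennreal e"
      proof -
        have "ennreal c0 * G l r < ennreal c0 * ennreal (e / c0)"
          using l(2) c by (intro ennreal_mult_strict_left_mono) auto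
        also have "\<dots> = ennreal e" using c e by (subst ennreal_mult[symmetric]) auto
        finally show ?thesis using wt[of l] by (rule le_less_trans[rotated])
      qed
      moreover have "bounded (V l i)" "diameter (V l i) \<le> \<delta>" for i
      proof -
        have "1 / real (Suc l) \<le> 1 / real (Suc N)" using l(1) by (simp add: frac_le)
        then show "bounded (V l i)" "diameter (V l i) \<le> \<delta>"
          using U(2,3)[of l i] N \<delta> by (auto simp: V_def)
      qed
      ultimately show "\<exists>U::nat \<Rightarrow> 'a set. ?S \<subseteq> (\<Union>i. U i) \<and> (\<forall>i. bounded (U i) \<and> diameter (U i) \<le> \<delta>) \<and>
          (\<Sum>i. hausdorff_weight m (U i)) < ennreal e"
        using cov[of l] by blast
    qed
  qed
qed

text \<open>The frontier of a ball is contained in the sphere of the same radius, and by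
  \<open>sphere_slices_null\<close> arbitrarily small balls have null spheres.\<close>

theorem hausdorff_null_imp_ind_dim_le:
  fixes X :: "'a::metric_space set"
  assumes "hausdorff_measure m X = 0"
  shows "ind_dim_le (top_of_set X) (int m - 1)"
  using assms
proof (induction m arbitrary: X)
  case 0
  have "X = {}"
  proof (rule ccontr)
    assume "X \<noteq> {}"
    obtain U :: "nat \<Rightarrow> 'a set" where U: "X \<subseteq> (\<Union>i. U i)" "(\<Sum>i. hausdorff_weight 0 (U i)) < ennreal 1"
      using 0 unfolding hausdorff_measure_zero_iff hausdorff_content_zero_iff by (meson zero_less_one)
    obtain i where "U i \<noteq> {}" using \<open>X \<noteq> {}\<close> U(1) by fastforce
    then have "hausdorff_weight 0 (U i) = 1" by (simp add: hausdorff_weight_def)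
    moreover have "(\<Sum>i\<in>{i}. hausdorff_weight 0 (U i)) \<le> (\<Sum>i. hausdorff_weight 0 (U i))"
      by (intro sum_le_suminf summableI) auto
    ultimately show False using U(2) by simp
  qed
  then show ?case by (simp add: ind_dim_le.empty)
next
  case (Suc m)
  show ?case
  proof (rule ind_dim_le.step)
    fix V x assume V: "openin (top_of_set X) V" "x \<in> V"
    then obtain e where e: "e > 0" "ball x e \<inter> X \<subseteq> V" and x: "x \<in> X"
      by (meson openin_contains_ball in_mono)
    have "\<exists>r. 0 < r \<and> r < e \<and> hausdorff_measure m {y \<in> X. dist x y = r} = 0"
    proof (rule ccontr)
      assume neg: "\<not> ?thesis"
      have "AE r in lborel. r \<notin> {0<..<e}"
        using sphere_slices_null[OF Suc.prems x] by eventually_elim (use neg in auto)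
      then have "{0<..<e} \<in> null_sets lborel"
        by (subst AE_iff_null_sets) simp_all
      then show False using e(1) by (simp add: null_sets_def)
    qed
    then obtain r where r: "0 < r" "r < e" "hausdorff_measure m {y \<in> X. dist x y = r} = 0"
      by blast
    let ?U = "X \<inter> ball x r"
    have U: "openin (top_of_set X) ?U" by (auto simp: openin_open)
    have "top_of_set X frontier_of ?U \<subseteq> {y \<in> X. dist x y = r}"
    proof -
      have "top_of_set X closure_of ?U \<subseteq> X \<inter> cball x r"
        by (intro closure_of_minimal) (auto simp: closedin_closed)
      then show ?thesis
        unfolding frontier_of_openin[OF U] by auto
    qed
    then have "hausdorff_measure m (top_of_set X frontier_of ?U) = 0"
      using r(3) hausdorff_measure_null_subset by blast
    then have "ind_dim_le (top_of_set (top_of_set X frontier_of ?U)) (int m - 1)"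
      by (rule Suc.IH)
    moreover have "X \<inter> (top_of_set X frontier_of ?U) = top_of_set X frontier_of ?U"
      using frontier_of_subset_topspace[of "top_of_set X" ?U] by auto
    ultimately show "\<exists>U. openin (top_of_set X) U \<and> x \<in> U \<and> U \<subseteq> V \<and>
        ind_dim_le (subtopology (top_of_set X) (top_of_set X frontier_of U)) (int (Suc m) - 1 - 1)"
      using U r e x by (intro exI[of _ ?U]) (auto simp: subtopology_subtopology)
  qed simp
qed

section \<open>Extending maps without zeros over compact sets of small dimension\<close>

lemma ind_dim_le_subspace:
  assumes "ind_dim_le T k"
  shows "ind_dim_le (subtopology T S) k"
  using assms
proof (induction arbitrary: S rule: ind_dim_le.induct)
  case (empty T)
  then show ?case
    by (simp add: ind_dim_le.empty)
next
  case (step n T)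
  show ?case
  proof (rule ind_dim_le.step[OF step.hyps(1)])
    fix V x
    assume "openin (subtopology T S) V" and "x \<in> V"
    then obtain V' where V': "openin T V'" "V = V' \<inter> S"
      by (auto simp: openin_subtopology)
    then obtain U' where U': "openin T U'" "x \<in> U'" "U' \<subseteq> V'"
      and IH: "\<And>S. ind_dim_le (subtopology (subtopology T (T frontier_of U')) S) (n - 1)"
      using step.IH[of V' x] \<open>x \<in> V\<close> by blast
    let ?F = "subtopology T S frontier_of (U' \<inter> S)"
    have "?F \<subseteq> S"
      by (rule frontier_of_subset_subtopology)
    have "T frontier_of U' \<inter> ?F = ?F"
    proof -
      have "?F = S \<inter> ?F"
        using \<open>?F \<subseteq> S\<close> by blast
      moreover have "?F \<subseteq> T frontier_of U'"
      proof
        fix y assume y: "y \<in> ?F"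
        have c: "y \<in> T closure_of U'" 
          using y closure_of_subtopology_subset[of T S "U' \<inter> S"] closure_of_mono[of "U' \<inter> S" U' T]
          by (auto simp: frontier_of_def)
        have "y \<notin> U'"
        proof
          assume "y \<in> U'"
          have "openin (subtopology T S) (U' \<inter> S)"
            using U'(1) by (auto simp: openin_subtopology)
          then have "subtopology T S interior_of (U' \<inter> S) = U' \<inter> S"
            by (simp add: interior_of_openin)
          with y \<open>y \<in> U'\<close> \<open>?F \<subseteq> S\<close> show False
            by (auto simp: frontier_of_def)
        qed
        with c show "y \<in> T frontier_of U'"
          using U'(1) by (simp add: frontier_of_openin)
      qed
      ultimately show ?thesis by blast
    qed
    then have "subtopology (subtopology T S) ?F = subtopology (subtopology T (T frontier_of U')) ?F"
      using \<open>?F \<subseteq> S\<close> by (simp add: subtopology_subtopology inf.absorb2)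
    then have "ind_dim_le (subtopology (subtopology T S) ?F) (n - 1)"
      using IH by simp
    then show "\<exists>U. openin (subtopology T S) U \<and> x \<in> U \<and> U \<subseteq> V \<and>
        ind_dim_le (subtopology (subtopology T S) (subtopology T S frontier_of U)) (n - 1)"
      using U' V' \<open>x \<in> V\<close> by (intro exI[of _ "U' \<inter> S"]) (auto simp: openin_subtopology)
  qed
qed

lemma ind_dim_le_subset:
  assumes "ind_dim_le (top_of_set X) k" "Y \<subseteq> X"
  shows "ind_dim_le (top_of_set Y) k"
  using ind_dim_le_subspace[OF assms(1), of Y] assms(2)
  by (simp add: subtopology_subtopology inf.absorb2)

lemma Tietze_real:
  fixes f :: "'a::metric_space \<Rightarrow> real"
  assumes "closed S" "S \<subseteq> K" "continuous_on S f"
  shows "\<exists>g. continuous_on K g \<and> (\<forall>x\<in>S. g x = f x)"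
proof -
  have n: "normal_space (top_of_set K)"
    by (simp add: metrizable_imp_normal_space metrizable_space_subtopology metrizable_space_euclidean)
  have c: "closedin (top_of_set K) S"
    using assms by (simp add: closed_subset)
  have f: "continuous_map (subtopology (top_of_set K) S) euclideanreal f"
    using assms by (simp add: subtopology_subtopology inf.absorb2)
  show ?thesis
    by (rule Tietze_extension_realinterval[OF n c _ _ f, of UNIV]) auto
qed

lemma Tietze_real_bounded:
  fixes f :: "'a::metric_space \<Rightarrow> real"
  assumes "closed S" "S \<subseteq> K" "continuous_on S f" "\<And>x. x \<in> S \<Longrightarrow> \<bar>f x\<bar> \<le> e" "e \<ge> 0"
  shows "\<exists>g. continuous_on K g \<and> (\<forall>x\<in>S. g x = f x) \<and> (\<forall>x\<in>K. \<bar>g x\<bar> \<le> e)"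
proof -
  obtain g where "continuous_on K g" "\<And>x. x \<in> S \<Longrightarrow> g x = f x"
    using Tietze_real[OF assms(1-3)] by blast
  show ?thesis
  proof (intro exI[of _ "\<lambda>x. max (- e) (min e (g x))"] conjI ballI)
    show "continuous_on K (\<lambda>x. max (- e) (min e (g x)))"
      using \<open>continuous_on K g\<close> by (intro continuous_intros)
    show "max (- e) (min e (g x)) = f x" if "x \<in> S" for x
      using assms(4)[OF that] \<open>\<And>x. x \<in> S \<Longrightarrow> g x = f x\<close>[OF that]
      by (auto simp: max_def min_def)
    show "\<bar>max (- e) (min e (g x))\<bar> \<le> e" for x
      using \<open>e \<ge> 0\<close> by linarith
  qed
qed

text \<open>A family \<open>g\<close> indexed by \<open>S\<close> without common zero is a map into Euclidean space of dimension
  \<open>card S\<close> that avoids the origin, that is, up to homotopy a map into the sphere of dimension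
  \<open>card S - 1\<close>. So this is the extension property that characterizes covering dimension. Families
  indexed by a set are used because the induction on dimension removes one coordinate at a time.\<close>

definition nonvanishing_extension :: "'i set \<Rightarrow> 'a::metric_space set \<Rightarrow> bool" where
  "nonvanishing_extension S K \<longleftrightarrow>
    (\<forall>A g. closed A \<longrightarrow> A \<subseteq> K \<longrightarrow> (\<forall>i\<in>S. continuous_on A (g i)) \<longrightarrow> (\<forall>x\<in>A. \<exists>i\<in>S. g i x \<noteq> (0::real)) \<longrightarrow>
      (\<exists>h. (\<forall>i\<in>S. continuous_on K (h i) \<and> (\<forall>x\<in>A. h i x = g i x)) \<and> (\<forall>x\<in>K. \<exists>i\<in>S. h i x \<noteq> 0)))"

lemma nonvanishing_extensionI:
  assumes "\<And>A g. closed A \<Longrightarrow> A \<subseteq> K \<Longrightarrow> (\<And>i. i \<in> S \<Longrightarrow> continuous_on A (g i)) \<Longrightarrow>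
      (\<And>x. x \<in> A \<Longrightarrow> \<exists>i\<in>S. g i x \<noteq> (0::real)) \<Longrightarrow>
      \<exists>h. (\<forall>i\<in>S. continuous_on K (h i) \<and> (\<forall>x\<in>A. h i x = g i x)) \<and> (\<forall>x\<in>K. \<exists>i\<in>S. h i x \<noteq> 0)"
  shows "nonvanishing_extension S K"
  unfolding nonvanishing_extension_def by (intro allI impI) (rule assms, auto)

lemma nonvanishing_extensionD:
  assumes "nonvanishing_extension S K" "closed A" "A \<subseteq> K" "\<And>i. i \<in> S \<Longrightarrow> continuous_on A (g i)"
    "\<And>x. x \<in> A \<Longrightarrow> \<exists>i\<in>S. g i x \<noteq> (0::real)"
  shows "\<exists>h. (\<forall>i\<in>S. continuous_on K (h i) \<and> (\<forall>x\<in>A. h i x = g i x)) \<and> (\<forall>x\<in>K. \<exists>i\<in>S. h i x \<noteq> 0)"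
  using assms(1)[unfolded nonvanishing_extension_def, THEN spec, THEN spec, of A g] assms(2-)
  by simp

lemma nonvanishing_extensionE:
  assumes "nonvanishing_extension S K" "closed A" "A \<subseteq> K" "\<And>i. i \<in> S \<Longrightarrow> continuous_on A (g i)"
    "\<And>x. x \<in> A \<Longrightarrow> \<exists>i\<in>S. g i x \<noteq> (0::real)"
  obtains h where "\<And>i. i \<in> S \<Longrightarrow> continuous_on K (h i)" "\<And>i x. i \<in> S \<Longrightarrow> x \<in> A \<Longrightarrow> h i x = g i x"
    "\<And>x. x \<in> K \<Longrightarrow> \<exists>i\<in>S. h i x \<noteq> 0"
  using nonvanishing_extensionD[OF assms] by blast

lemma nonvanishing_extension_subset:
  assumes "nonvanishing_extension S K" "C \<subseteq> K"
  shows "nonvanishing_extension S C"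
proof (rule nonvanishing_extensionI)
  fix A and g :: "'a \<Rightarrow> 'b \<Rightarrow> real"
  assume A: "closed A" "A \<subseteq> C" "\<And>i. i \<in> S \<Longrightarrow> continuous_on A (g i)"
    "\<And>x. x \<in> A \<Longrightarrow> \<exists>i\<in>S. g i x \<noteq> (0::real)"
  have "A \<subseteq> K" using A(2) assms(2) by blast
  from nonvanishing_extensionE[OF assms(1) A(1) this A(3,4)]
  obtain h where "\<And>i. i \<in> S \<Longrightarrow> continuous_on K (h i)" "\<And>i x. i \<in> S \<Longrightarrow> x \<in> A \<Longrightarrow> h i x = g i x"
    "\<And>x. x \<in> K \<Longrightarrow> \<exists>i\<in>S. h i x \<noteq> 0"
    by blast
  then show "\<exists>h. (\<forall>i\<in>S. continuous_on C (h i) \<and> (\<forall>x\<in>A. h i x = g i x)) \<and> (\<forall>x\<in>C. \<exists>i\<in>S. h i x \<noteq> 0)"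
    using assms(2) by (intro exI[of _ h]) (auto intro: continuous_on_subset)
qed

text \<open>The small inductive dimension of a finite union is difficult to control. The extension property
  passes to unions at once: extend over the first set, then over the second. This is why the
  property, rather than the dimension itself, is carried through the induction.\<close>

lemma nonvanishing_extension_Un:
  assumes "nonvanishing_extension S K" "nonvanishing_extension S L" "closed K" "closed L"
  shows "nonvanishing_extension S (K \<union> L)"
proof (rule nonvanishing_extensionI)
  fix A and g :: "'a \<Rightarrow> 'b \<Rightarrow> real"
  assume A: "closed A" "A \<subseteq> K \<union> L" "\<And>i. i \<in> S \<Longrightarrow> continuous_on A (g i)"
    "\<And>x. x \<in> A \<Longrightarrow> \<exists>i\<in>S. g i x \<noteq> (0::real)"
  obtain h where h: "\<And>i. i \<in> S \<Longrightarrow> continuous_on K (h i)"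
    "\<And>i x. i \<in> S \<Longrightarrow> x \<in> A \<inter> K \<Longrightarrow> h i x = g i x"
    "\<And>x. x \<in> K \<Longrightarrow> \<exists>i\<in>S. h i x \<noteq> 0"
  proof (rule nonvanishing_extensionE[OF assms(1), of "A \<inter> K" g])
    show "closed (A \<inter> K)" using A(1) assms(3) by blast
    show "continuous_on (A \<inter> K) (g i)" if "i \<in> S" for i
      using A(3)[OF that] by (rule continuous_on_subset) blast
  qed (use A in auto)
  define g' where "g' i x = (if x \<in> K then h i x else g i x)" for i x
  have g': "continuous_on (K \<union> A) (g' i)" if "i \<in> S" for i
    unfolding g'_def using h A that assms
    by (intro continuous_on_If[of K A "h i" "g i" "\<lambda>x. x \<in> K"]) (auto simp: closed_Int)
  obtain h' where h': "\<And>i. i \<in> S \<Longrightarrow> continuous_on L (h' i)"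
    "\<And>i x. i \<in> S \<Longrightarrow> x \<in> (K \<union> A) \<inter> L \<Longrightarrow> h' i x = g' i x"
    "\<And>x. x \<in> L \<Longrightarrow> \<exists>i\<in>S. h' i x \<noteq> 0"
  proof (rule nonvanishing_extensionE[OF assms(2), of "(K \<union> A) \<inter> L" g'])
    show "closed ((K \<union> A) \<inter> L)" using A(1) assms(3,4) by blast
    show "continuous_on ((K \<union> A) \<inter> L) (g' i)" if "i \<in> S" for i
      using g'[OF that] by (auto intro: continuous_on_subset)
    show "\<exists>i\<in>S. g' i x \<noteq> 0" if "x \<in> (K \<union> A) \<inter> L" for x
      using that h(3)[of x] A(4)[of x] by (auto simp: g'_def)
  qed auto
  define k where "k i x = (if x \<in> K then h i x else h' i x)" for i x
  have "continuous_on (K \<union> L) (k i)" if "i \<in> S" for i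
    unfolding k_def using h h' that assms
    by (intro continuous_on_If[of K L "h i" "h' i" "\<lambda>x. x \<in> K"]) (auto simp: g'_def)
  moreover have "k i x = g i x" if "i \<in> S" "x \<in> A" for i x
    using that h(2)[of i x] h'(2)[of i x] A(2) by (auto simp: k_def g'_def)
  moreover have "\<exists>i\<in>S. k i x \<noteq> 0" if "x \<in> K \<union> L" for x
    using that h(3)[of x] h'(3)[of x] by (auto simp: k_def)
  ultimately show "\<exists>h. (\<forall>i\<in>S. continuous_on (K \<union> L) (h i) \<and> (\<forall>x\<in>A. h i x = g i x)) \<and>
      (\<forall>x\<in>K \<union> L. \<exists>i\<in>S. h i x \<noteq> 0)"
    by blast
qed

lemma nonvanishing_extension_UN:
  assumes "finite I" "\<And>i. i \<in> I \<Longrightarrow> nonvanishing_extension S (K i)" "\<And>i. i \<in> I \<Longrightarrow> closed (K i)"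
  shows "nonvanishing_extension S (\<Union>i\<in>I. K i)"
  using assms
proof (induction I rule: finite_induct)
  case empty
  show ?case by (rule nonvanishing_extensionI) auto
next
  case (insert i I)
  then show ?case
    by (auto intro!: nonvanishing_extension_Un closed_UN)
qed

text \<open>Values are changed only at points where every \<open>F i\<close> has modulus less than \<open>d = e / 2\<close>. The restriction of \<open>F\<close> to the set where
  some \<open>F i\<close> has modulus at least \<open>d\<close> extends to a family \<open>H\<close> without common zero. Replacing the part of
  \<open>F\<close> truncated to \<open>[-d, d]\<close> by the truncation of \<open>H\<close> moves each function by at most \<open>2 d\<close>, and
  truncation creates no zeros.\<close>

lemma nonvanishing_extension_perturb:
  assumes ext: "nonvanishing_extension S B" and "finite S" "closed B"
    and F: "\<And>i. i \<in> S \<Longrightarrow> continuous_on B (F i)" and "e > 0"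
  obtains h where "\<And>i. i \<in> S \<Longrightarrow> continuous_on B (h i)"
    "\<And>i x. i \<in> S \<Longrightarrow> x \<in> B \<Longrightarrow> \<bar>h i x - F i x\<bar> \<le> (e::real)"
    "\<And>x. x \<in> B \<Longrightarrow> \<exists>i\<in>S. h i x \<noteq> 0"
proof -
  define d where "d = e / 2"
  have d: "d > 0" using \<open>e > 0\<close> by (simp add: d_def)
  define T where "T = (\<Union>i\<in>S. {x \<in> B. d \<le> \<bar>F i x\<bar>})"
  have "closed {x \<in> B. d \<le> \<bar>F i x\<bar>}" if "i \<in> S" for i
    using F[OF that] \<open>closed B\<close>
    by (intro continuous_on_closed_Collect_le) (auto intro!: continuous_intros)
  then have T: "closed T"
    using \<open>finite S\<close> by (auto simp: T_def)
  obtain H where H: "\<And>i. i \<in> S \<Longrightarrow> continuous_on B (H i)"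
    "\<And>i x. i \<in> S \<Longrightarrow> x \<in> T \<Longrightarrow> H i x = F i x"
    "\<And>x. x \<in> B \<Longrightarrow> \<exists>i\<in>S. H i x \<noteq> 0"
  proof (rule nonvanishing_extensionE[OF ext T, of F])
    show "T \<subseteq> B" by (auto simp: T_def)
    then show "continuous_on T (F i)" if "i \<in> S" for i
      using F[OF that] by (rule continuous_on_subset[rotated])
    show "\<exists>i\<in>S. F i x \<noteq> 0" if "x \<in> T" for x
      using that d unfolding T_def by (auto, metis abs_zero not_le)
  qed auto
  define c where "c t = max (- d) (min d t)" for t :: real
  define h where "h i x = F i x - c (F i x) + c (H i x)" for i x
  show ?thesis
  proof (rule that[of h])
    show "continuous_on B (h i)" if "i \<in> S" for i
      unfolding h_def c_def using F H that by (auto intro!: continuous_intros)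
    show "\<bar>h i x - F i x\<bar> \<le> e" for i x
      unfolding h_def c_def d_def using \<open>e > 0\<close> by (auto simp: max_def min_def)
    show "\<exists>i\<in>S. h i x \<noteq> 0" if "x \<in> B" for x
    proof (cases "x \<in> T")
      case True
      then have "h i x = F i x" if "i \<in> S" for i
        using H(2) that by (simp add: h_def)
      with H(3)[OF that] H(2) True show ?thesis by auto
    next
      case False
      then have "c (F i x) = F i x" if "i \<in> S" for i
        using \<open>x \<in> B\<close> that d by (auto simp: T_def c_def not_le)
      moreover obtain i where "i \<in> S" "H i x \<noteq> 0" using H(3)[OF \<open>x \<in> B\<close>] by blast
      moreover have "c (H i x) \<noteq> 0" using d \<open>H i x \<noteq> 0\<close> by (auto simp: c_def max_def min_def)
      ultimately show ?thesis by (auto simp: h_def intro!: bexI[of _ i])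
    qed
  qed
qed

text \<open>Finitely many small neighbourhoods from the definition of dimension cover \<open>A\<close>. The frontier of
  their union lies in a finite union of sets of smaller dimension, which is all that
  \<open>nonvanishing_extension_UN\<close> needs.\<close>

lemma compact_nbhd_small_frontier:
  fixes K :: "'a::metric_space set"
  assumes K: "compact K" and dim: "ind_dim_le (top_of_set K) (int m)"
    and A: "closed A" "A \<subseteq> W" "openin (top_of_set K) W"
  obtains N I where "openin (top_of_set K) N" "A \<subseteq> N" "closure N \<subseteq> W" "finite I"
    "\<And>U. U \<in> I \<Longrightarrow> closed U \<and> U \<subseteq> K \<and> ind_dim_le (top_of_set U) (int m - 1)"
    "closure N - N \<subseteq> \<Union>I"
proof -
  obtain W' where W': "open W'" "W = W' \<inter> K"
    using A(3) by (auto simp: openin_open)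
  have ex: "\<exists>U. openin (top_of_set K) U \<and> x \<in> U \<and> closure U \<subseteq> W \<and>
      ind_dim_le (top_of_set (closure U - U)) (int m - 1)" if "x \<in> A" for x
  proof -
    have x: "x \<in> W'" "x \<in> K" using that A W' by auto
    obtain e where e: "e > 0" "cball x e \<subseteq> W'"
      using W'(1) x by (meson open_contains_cball)
    have "openin (top_of_set K) (ball x e \<inter> K)" "x \<in> ball x e \<inter> K"
      using x e by (auto simp: openin_open)
    with dim obtain U where U: "openin (top_of_set K) U" "x \<in> U" "U \<subseteq> ball x e \<inter> K"
      "ind_dim_le (subtopology (top_of_set K) (top_of_set K frontier_of U)) (int m - 1)"
      by (cases rule: ind_dim_le.cases) (force, blast)
    have "closure U \<subseteq> cball x e" using U(3) by (meson closed_cball closure_minimal inf.boundedE ball_subset_cball subset_trans)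
    moreover have UK: "closure U \<subseteq> K" using U(3) K by (simp add: closure_minimal compact_imp_closed)
    ultimately have "closure U \<subseteq> W" using e W' by blast
    moreover have "top_of_set K frontier_of U = closure U - U"
      using U(1) UK frontier_of_openin[OF U(1)] U(3)
      by (auto simp: closure_of_subtopology_subset closure_of_subtopology inf.absorb2)
    ultimately show ?thesis
      using U UK by (auto simp: subtopology_subtopology inf.absorb2 Int_absorb1 subset_trans[OF Diff_subset])
  qed
  then obtain U where U: "\<And>x. x \<in> A \<Longrightarrow> openin (top_of_set K) (U x) \<and> x \<in> U x \<and> closure (U x) \<subseteq> W \<and>
      ind_dim_le (top_of_set (closure (U x) - U x)) (int m - 1)"
    by metis
  have "A \<subseteq> K" using A W' by auto
  then have "compact A" using K A(1) by (metis compact_Int_closed inf.absorb2)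
  have "\<exists>O'. open O' \<and> U x = K \<inter> O'" if "x \<in> A" for x
    using U[OF that] by (auto simp: openin_open)
  then obtain O' where O': "\<And>x. x \<in> A \<Longrightarrow> open (O' x) \<and> U x = K \<inter> O' x"
    by metis
  obtain A' where A': "A' \<subseteq> A" "finite A'" "A \<subseteq> (\<Union>x\<in>A'. O' x)"
  proof (rule compactE_image[OF \<open>compact A\<close>, of A O'])
    show "open (O' x)" if "x \<in> A" for x
      using O'[OF that] by simp
    show "A \<subseteq> (\<Union>x\<in>A. O' x)"
    proof
      fix x assume "x \<in> A"
      then have "x \<in> U x" "U x = K \<inter> O' x"
        using U O' by blast+
      with \<open>x \<in> A\<close> show "x \<in> (\<Union>x\<in>A. O' x)" by blast
    qed
  qed auto
  define N where "N = (\<Union>x\<in>A'. U x)"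
  have cl: "closure N = (\<Union>x\<in>A'. closure (U x))"
    unfolding N_def using A'(2) by (induction A' rule: finite_induct) simp_all
  show ?thesis
  proof (rule that[of N "(\<lambda>x. closure (U x) - U x) ` A'"])
    show "openin (top_of_set K) N"
      unfolding N_def using U A' by (intro openin_Union) auto
    show "A \<subseteq> N"
    proof
      fix y assume "y \<in> A"
      then obtain x where "x \<in> A'" "y \<in> O' x" "y \<in> K" using A' \<open>A \<subseteq> K\<close> by blast
      moreover have "U x = K \<inter> O' x" using O' A' \<open>x \<in> A'\<close> by blast
      ultimately show "y \<in> N" unfolding N_def by blast
    qed
    show "closure N \<subseteq> W" using U A' unfolding cl by blast
    show "finite ((\<lambda>x. closure (U x) - U x) ` A')" using A' by simp
    show "closure N - N \<subseteq> \<Union>((\<lambda>x. closure (U x) - U x) ` A')"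
    proof
      fix y assume y: "y \<in> closure N - N"
      then obtain x where x: "x \<in> A'" "y \<in> closure (U x)" unfolding cl by blast
      then have "y \<notin> U x" using y unfolding N_def by blast
      with x show "y \<in> \<Union>((\<lambda>x. closure (U x) - U x) ` A')" by blast
    qed
    fix V assume "V \<in> (\<lambda>x. closure (U x) - U x) ` A'"
    then obtain x where x: "x \<in> A" "V = closure (U x) - U x" using A' by auto
    have "closure (U x) \<subseteq> K" using U[OF x(1)] W' by auto
    then have "V = closure (U x) - O' x" using x O'[OF x(1)] by blast
    then have "closed V" using O'[OF x(1)] by (simp add: closed_Diff)
    then show "closed V \<and> V \<subseteq> K \<and> ind_dim_le (top_of_set V) (int m - 1)"
      using U[OF x(1)] x \<open>closure (U x) \<subseteq> K\<close> by auto
  qed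
qed


text \<open>Let \<open>F\<close> be any extension of the given family to \<open>K\<close>, and let \<open>N\<close> be a neighbourhood of \<open>A\<close> on which \<open>F\<close> has
  no common zero and whose frontier \<open>B\<close> is covered by sets of smaller dimension. By induction the
  functions with index in \<open>S\<close> can be moved slightly so that they alone have no common zero on \<open>B\<close>. The
  correction is extended to \<open>K\<close>, small and equal to \<open>0\<close> on \<open>A\<close>, so no common zero arises in \<open>N\<close>.
  Outside \<open>N\<close> the common zeros of the functions with index in \<open>S\<close> then form a closed set \<open>Z\<close> that is disjoint
  from the closure of \<open>N\<close>, and the remaining function can be given the value \<open>1\<close> on \<open>Z\<close>.\<close>

theorem ind_dim_le_imp_nonvanishing_extension:
  fixes K :: "'a::metric_space set"
  assumes "finite S" "compact K" "ind_dim_le (top_of_set K) (int (card S) - 1)"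
  shows "nonvanishing_extension S K"
  using assms
proof (induction S arbitrary: K rule: finite_induct)
  case empty
  then have "K = {}"
    by (simp add: ind_dim_le_minus_one_iff)
  then show ?case
    by (intro nonvanishing_extensionI) auto
next
  case (insert k S)
  note K = \<open>compact K\<close>
  have "closed K" using K by (rule compact_imp_closed)
  have dim: "ind_dim_le (top_of_set K) (int (card S))"
    using insert by simp
  show ?case
  proof (rule nonvanishing_extensionI)
    fix A and g :: "'b \<Rightarrow> 'a \<Rightarrow> real"
    assume A: "closed A" "A \<subseteq> K" "\<And>i. i \<in> insert k S \<Longrightarrow> continuous_on A (g i)"
      "\<And>x. x \<in> A \<Longrightarrow> \<exists>i\<in>insert k S. g i x \<noteq> (0::real)"
    have "\<exists>F. continuous_on K F \<and> (\<forall>x\<in>A. F x = g i x)" if "i \<in> insert k S" for i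
      using Tietze_real[OF A(1,2) A(3)[OF that]] by metis
    then obtain F where F: "\<And>i. i \<in> insert k S \<Longrightarrow> continuous_on K (F i)"
      "\<And>i x. i \<in> insert k S \<Longrightarrow> x \<in> A \<Longrightarrow> F i x = g i x"
      by metis
    define W where "W = (\<Union>i\<in>insert k S. {x \<in> K. F i x \<in> - {0}})"
    have W: "openin (top_of_set K) W"
      unfolding W_def
    proof (intro openin_Union ballI, elim imageE)
      fix V i assume V: "V = {x \<in> K. F i x \<in> - {0}}" "i \<in> insert k S"
      show "openin (top_of_set K) V"
        using continuous_openin_preimage_gen[OF F(1)[OF V(2)], of "- {0}"] unfolding V(1)
        by (simp add: vimage_def Int_def open_Compl)
    qed
    have "A \<subseteq> W" 
    proof
      fix x assume "x \<in> A"
      then obtain i where "i \<in> insert k S" "g i x \<noteq> 0" using A(4) by blast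
      then have "F i x \<noteq> 0" "x \<in> K" using F(2) \<open>x \<in> A\<close> A(2) by auto
      with \<open>i \<in> insert k S\<close> show "x \<in> W" unfolding W_def by blast
    qed
    obtain N I where N: "openin (top_of_set K) N" "A \<subseteq> N" "closure N \<subseteq> W" and I: "finite I"
      "\<And>U. U \<in> I \<Longrightarrow> closed U \<and> U \<subseteq> K \<and> ind_dim_le (top_of_set U) (int (card S) - 1)"
      "closure N - N \<subseteq> \<Union>I"
      using compact_nbhd_small_frontier[OF K dim A(1) \<open>A \<subseteq> W\<close> W] by metis
    define B where "B = closure N - N"
    have WK: "W \<subseteq> K" by (auto simp: W_def)
    obtain N' where N': "open N'" "N = K \<inter> N'" using N(1) by (auto simp: openin_open)
    have clK: "closure N \<subseteq> K" using N(3) WK by blast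
    have Beq: "B = closure N - N'" using clK N' by (auto simp: B_def)
    then have "closed B" using N'(1) by (simp add: closed_Diff)
    have KN: "K - N = K - N'" using N' by blast
    have "closed (K - N)" unfolding KN using \<open>closed K\<close> N'(1) by (simp add: closed_Diff)
    have "nonvanishing_extension S U" if "U \<in> I" for U
      using insert.IH[of U] I(2)[OF that] K by (metis compact_Int_closed inf.absorb2)
    then have "nonvanishing_extension S (\<Union>U\<in>I. U)"
      using I by (intro nonvanishing_extension_UN) auto
    then have extB: "nonvanishing_extension S B"
      using I(3) by (auto simp: B_def intro: nonvanishing_extension_subset)
    \<comment> \<open>A bound that leaves room for the perturbation by \<open>e\<close>.\<close>
    have "\<exists>e>0. \<forall>x\<in>closure N. \<exists>i\<in>insert k S. e < \<bar>F i x\<bar>"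
    proof -
      \<comment> \<open>The sum of moduli is continuous and positive on the compact closure of \<open>N\<close>.\<close>
      define s where "s x = (\<Sum>i\<in>insert k S. \<bar>F i x\<bar>)" for x
      have cs: "continuous_on (closure N) s"
        unfolding s_def using F(1) clK by (intro continuous_intros) (auto intro: continuous_on_subset)
      have pos: "s x > 0" if "x \<in> closure N" for x
      proof -
        have "x \<in> W" using that N(3) by blast
        then obtain i where i: "i \<in> insert k S" "F i x \<noteq> 0" unfolding W_def by blast
        have "\<bar>F i x\<bar> \<le> s x"
          unfolding s_def using insert.hyps i by (intro member_le_sum) auto
        with i show ?thesis by simp
      qed
      have cN: "compact (closure N)" using compact_Int_closed[OF K closed_closure[of N]] clK by (simp add: inf.absorb2)
      obtain c where c: "c > 0" "\<And>x. x \<in> closure N \<Longrightarrow> c \<le> s x"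
      proof (cases "closure N = {}")
        case True then show ?thesis using that[of 1] by simp
      next
        case False
        then obtain y where "y \<in> closure N" "\<And>x. x \<in> closure N \<Longrightarrow> s y \<le> s x"
          using continuous_attains_inf[OF cN _ cs] by blast
        then show ?thesis using pos that by blast
      qed
      define e where "e = c / (2 * real (card (insert k S)))"
      have card: "real (card (insert k S)) > 0" using insert.hyps by (simp add: card_gt_0_iff)
      have e: "e > 0" using c card by (simp add: e_def)
      moreover have "\<exists>i\<in>insert k S. e < \<bar>F i x\<bar>" if x: "x \<in> closure N" for x
      proof (rule ccontr)
        assume "\<not> ?thesis"
        then have "s x \<le> real (card (insert k S)) * e"
          unfolding s_def by (intro sum_bounded_above) (auto simp: not_less)
        also have "\<dots> = c / 2" using card by (simp add: e_def)
        finally show False using c x by fastforce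
      qed
      ultimately show ?thesis by blast
    qed
    then obtain e where e: "e > 0" "\<And>x. x \<in> closure N \<Longrightarrow> \<exists>i\<in>insert k S. e < \<bar>F i x\<bar>"
      by blast
    obtain p where p: "\<And>i. i \<in> S \<Longrightarrow> continuous_on B (p i)"
      "\<And>i x. i \<in> S \<Longrightarrow> x \<in> B \<Longrightarrow> \<bar>p i x - F i x\<bar> \<le> e"
      "\<And>x. x \<in> B \<Longrightarrow> \<exists>i\<in>S. p i x \<noteq> 0"
    proof (rule nonvanishing_extension_perturb[OF extB \<open>finite S\<close> \<open>closed B\<close>, of F e])
      show "continuous_on B (F i)" if "i \<in> S" for i
        using F(1)[of i] that clK by (auto simp: B_def intro: continuous_on_subset)
    qed (use e in auto)
    have AB: "A \<inter> B = {}" using N(2) by (auto simp: B_def)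
    define P where "P i q \<longleftrightarrow> continuous_on K q \<and> (\<forall>x\<in>A. q x = 0) \<and>
        (\<forall>x\<in>B. q x = p i x - F i x) \<and> (\<forall>x\<in>K. \<bar>q x\<bar> \<le> e)" for i q
    have "\<exists>q. P i q" if "i \<in> S" for i
    proof -
      define q where "q x = (if x \<in> A then 0 else p i x - F i x)" for x
      have q1: "continuous_on (A \<union> B) q"
        unfolding q_def using A(1) \<open>closed B\<close> AB p(1)[OF that] F(1)[of i] that clK
        by (intro continuous_on_If[of A B "\<lambda>_. 0" "\<lambda>x. p i x - F i x" "\<lambda>x. x \<in> A"] continuous_intros)
           (auto simp: B_def intro: continuous_on_subset)
      have q2: "closed (A \<union> B)" "A \<union> B \<subseteq> K"
        using A \<open>closed B\<close> clK by (auto simp: B_def)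
      have q3: "\<bar>q x\<bar> \<le> e" if "x \<in> A \<union> B" for x
        using that p(2)[OF \<open>i \<in> S\<close>, of x] e(1) by (auto simp: q_def)
      obtain q' where q': "continuous_on K q'" "\<forall>x\<in>A \<union> B. q' x = q x" "\<forall>x\<in>K. \<bar>q' x\<bar> \<le> e"
        using Tietze_real_bounded[OF q2 q1 q3 less_imp_le[OF e(1)]] by blast
      have "\<forall>x\<in>A. q' x = 0" "\<forall>x\<in>B. q' x = p i x - F i x"
        using q'(2) AB by (auto simp: q_def)
      with q' show ?thesis
        unfolding P_def by blast
    qed
    then obtain q where qq: "\<And>i. i \<in> S \<Longrightarrow> P i (q i)"
      by metis
    have q: "\<And>i. i \<in> S \<Longrightarrow> continuous_on K (q i)" "\<And>i x. i \<in> S \<Longrightarrow> x \<in> A \<Longrightarrow> q i x = 0"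
      "\<And>i x. i \<in> S \<Longrightarrow> x \<in> B \<Longrightarrow> q i x = p i x - F i x" "\<And>i x. i \<in> S \<Longrightarrow> x \<in> K \<Longrightarrow> \<bar>q i x\<bar> \<le> e"
      using qq unfolding P_def by blast+
    define h where "h i x = F i x + q i x" for i x
    have h: "continuous_on K (h i)" if "i \<in> S" for i
      unfolding h_def using F(1)[of i] q(1)[of i] that by (auto intro!: continuous_intros)
    \<comment> \<open>The common zeros that the last function has to avoid.\<close>
    define Z where "Z = (K - N) \<inter> (\<Inter>i\<in>S. {x \<in> K. h i x = 0})"
    have "closed {x \<in> K. h i x = 0}" if "i \<in> S" for i
      using h[OF that] \<open>closed K\<close> by (intro continuous_closed_preimage_constant)
    then have "closed Z" unfolding Z_def using \<open>closed (K - N)\<close>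
      by (intro closed_Int closed_INT) auto
    have ZN: "closure N \<inter> Z = {}"
    proof (rule ccontr)
      assume "closure N \<inter> Z \<noteq> {}"
      then obtain x where x: "x \<in> B" "x \<in> Z" by (auto simp: Z_def B_def)
      then have "h i x = p i x" if "i \<in> S" for i using q(3)[OF that x(1)] by (simp add: h_def)
      then show False using p(3)[OF x(1)] x(2) by (auto simp: Z_def)
    qed
    obtain t where t: "continuous_on K t" "\<And>x. x \<in> closure N \<Longrightarrow> t x = F k x" "\<And>x. x \<in> Z \<Longrightarrow> t x = 1"
    proof -
      define t where "t x = (if x \<in> Z then 1 else F k x)" for x
      have t1: "continuous_on (Z \<union> closure N) t"
        unfolding t_def using \<open>closed Z\<close> ZN F(1)[of k] clK
        by (intro continuous_on_If[of Z "closure N" "\<lambda>_. 1" "F k" "\<lambda>x. x \<in> Z"])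
           (auto intro: continuous_on_subset)
      have t2: "closed (Z \<union> closure N)" "Z \<union> closure N \<subseteq> K"
        using \<open>closed Z\<close> clK by (auto simp: Z_def)
      obtain t' where t': "continuous_on K t'" "\<forall>x\<in>Z \<union> closure N. t' x = t x"
        using Tietze_real[OF t2 t1] by blast
      then show ?thesis
        using ZN by (intro that[of t']) (auto simp: t_def)
    qed
    define H where "H i = (if i = k then t else h i)" for i
    have "continuous_on K (H i)" if "i \<in> insert k S" for i
      using that h t by (auto simp: H_def)
    moreover have "H i x = g i x" if "i \<in> insert k S" "x \<in> A" for i x
      using that F(2)[OF that] q(2)[of i x] t(2)[of x] N(2) closure_subset[of N]
      by (auto simp: H_def h_def)
    moreover have "\<exists>i\<in>insert k S. H i x \<noteq> 0" if "x \<in> K" for x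
    proof (cases "x \<in> closure N")
      case True
      then obtain i where i: "i \<in> insert k S" "e < \<bar>F i x\<bar>" using e(2) by blast
      have "H i x \<noteq> 0"
      proof (cases "i = k")
        case True
        then show ?thesis using i t(2)[OF \<open>x \<in> closure N\<close>] e(1) by (auto simp: H_def)
      next
        case False
        then have "\<bar>q i x\<bar> \<le> e" using q(4)[of i x] i that by auto
        then show ?thesis using i False by (auto simp: H_def h_def)
      qed
      with i show ?thesis by blast
    next
      case False
      then have xN: "x \<in> K - N" using that closure_subset[of N] by auto
      show ?thesis
      proof (cases "x \<in> Z")
        case True
        then show ?thesis using t(3)[of x] by (auto simp: H_def)
      next
        case False
        then obtain i where "i \<in> S" "h i x \<noteq> 0" using xN by (auto simp: Z_def)
        then show ?thesis using \<open>k \<notin> S\<close> by (auto simp: H_def)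
      qed
    qed
    ultimately show "\<exists>h. (\<forall>i\<in>insert k S. continuous_on K (h i) \<and> (\<forall>x\<in>A. h i x = g i x)) \<and>
        (\<forall>x\<in>K. \<exists>i\<in>insert k S. h i x \<noteq> 0)"
      by (intro exI[of _ H]) blast
  qed
qed

text \<open>Without a zero, the map \<open>- H z / norm (H z)\<close> has a fixed point on the unit sphere, at which \<open>H\<close>
  points inward.\<close>

lemma outward_on_sphere_imp_zero:
  fixes H :: "'a::euclidean_space \<Rightarrow> 'a"
  assumes "continuous_on (cball 0 1) H" "\<And>z. norm z = 1 \<Longrightarrow> H z \<bullet> z > 0"
  obtains z where "z \<in> cball 0 1" "H z = 0"
proof (rule ccontr)
  assume "\<not> thesis"
  then have nz: "H z \<noteq> 0" if "z \<in> cball 0 1" for z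
    using that \<open>z \<in> cball 0 1 \<Longrightarrow> H z = 0 \<Longrightarrow> thesis\<close> by argo
  define u where "u z = - (H z /\<^sub>R norm (H z))" for z
  have "continuous_on (cball 0 1) u"
    unfolding u_def using assms(1) nz by (intro continuous_intros) auto
  moreover have "u \<in> cball 0 1 \<rightarrow> cball 0 1"
    using nz by (auto simp: u_def)
  ultimately obtain z where z: "z \<in> cball 0 1" "u z = z"
    using brouwer_ball[of 1 0 u] by auto
  have "norm (u z) = 1" using nz[OF z(1)] by (simp add: u_def)
  then have n: "norm z = 1" using z by simp
  have "z \<bullet> z = - ((H z \<bullet> z) / norm (H z))"
    using z(2) by (metis u_def inner_minus_left inner_scaleR_left divide_inverse mult.commute)
  also have "\<dots> < 0" using assms(2)[OF n] nz[OF z(1)] by (simp add: divide_pos_pos)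
  finally show False using inner_ge_zero[of z] by linarith
qed

text \<open>If the dimension of the image were smaller, then \<open>G\<close>, restricted to the image of the sphere, would
  extend over the image of the ball without zero. The composition with \<open>f\<close> points outward on the sphere
  and contradicts \<open>outward_on_sphere_imp_zero\<close>.\<close>

lemma not_ind_dim_le_if_outward:
  fixes f :: "'a::euclidean_space \<Rightarrow> 'b::metric_space" and G :: "'b \<Rightarrow> 'a"
  assumes f: "continuous_on (cball 0 1) f" and G: "continuous_on (f ` cball 0 1) G"
    and pos: "\<And>z. norm z = 1 \<Longrightarrow> G (f z) \<bullet> z > 0"
  shows "\<not> ind_dim_le (top_of_set (f ` cball 0 1)) (int DIM('a) - 1)"
proof
  let ?K = "f ` cball 0 1"
  assume dim: "ind_dim_le (top_of_set ?K) (int DIM('a) - 1)"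
  have K: "compact ?K" by (intro compact_continuous_image f compact_cball)
  have ext: "nonvanishing_extension (Basis :: 'a set) ?K"
    by (rule ind_dim_le_imp_nonvanishing_extension) (use K dim in auto)
  have sub: "f ` sphere 0 1 \<subseteq> ?K" by (intro image_mono sphere_cball)
  have closed: "closed (f ` sphere 0 1)"
    by (intro compact_imp_closed compact_continuous_image continuous_on_subset[OF f]) auto
  define g where "g i x = G x \<bullet> i" for i x
  have g: "continuous_on (f ` sphere 0 1) (g i)" for i
    unfolding g_def using continuous_on_subset[OF G sub] by (intro continuous_intros)
  have nz: "\<exists>i\<in>Basis. g i x \<noteq> 0" if x: "x \<in> f ` sphere 0 1" for x
  proof -
    obtain z where "norm z = 1" "x = f z"
      using x by (elim imageE) simp
    then have "G x \<noteq> 0"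
      using pos[of z] by force
    then show ?thesis
      unfolding g_def using euclidean_eqI[of "G x" 0] by force
  qed
  obtain h where h: "\<forall>i\<in>Basis. continuous_on ?K (h i) \<and> (\<forall>x\<in>f ` sphere 0 1. h i x = g i x)"
    "\<forall>x\<in>?K. \<exists>i\<in>Basis. h i x \<noteq> 0"
    using nonvanishing_extensionD[OF ext closed sub g nz] by blast
  have h1: "continuous_on ?K (h i)" if "i \<in> Basis" for i
    using h(1) that by blast
  define H where "H z = (\<Sum>i\<in>Basis. h i (f z) *\<^sub>R i)" for z
  have Hi: "H z \<bullet> i = h i (f z)" if "i \<in> Basis" for z i
    using that by (simp add: H_def)
  have "continuous_on (cball 0 1) H"
    unfolding H_def by (intro continuous_intros continuous_on_compose2[OF h1 f]) auto
  moreover have "H z \<bullet> z > 0" if "norm z = 1" for z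
  proof -
    have fz: "f z \<in> f ` sphere 0 1"
      using that by (intro imageI) simp
    have "H z = G (f z)"
    proof (rule euclidean_eqI)
      fix i :: 'a assume i: "i \<in> Basis"
      then have "h i (f z) = g i (f z)"
        using h(1) fz by blast
      then show "H z \<bullet> i = G (f z) \<bullet> i"
        by (simp add: Hi[OF i] g_def)
    qed
    with pos[OF that] show ?thesis by simp
  qed
  ultimately obtain z where z: "z \<in> cball 0 1" "H z = 0"
    by (rule outward_on_sphere_imp_zero)
  from z(1) have "f z \<in> ?K" by (rule imageI)
  then obtain i where "i \<in> Basis" "h i (f z) \<noteq> 0"
    using h(2) by blast
  with Hi[of i z] z(2) show False by simp
qed

section \<open>Almost affine functions\<close>

text \<open>Lattice points of mesh \<open>1 / N\<close> in the cube of half side length \<open>R\<close>.\<close>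

definition grid :: "nat \<Rightarrow> nat \<Rightarrow> 'a::euclidean_space set" where
  "grid N R = {z. \<forall>b\<in>Basis. real N * (z \<bullet> b) \<in> \<int> \<and> \<bar>z \<bullet> b\<bar> \<le> real R}"

text \<open>With \<open>S\<close> one element short of the basis, this counts the points of a slice; the exponent
  \<open>DIM('a) - 1\<close> is what makes degenerate points contribute little to the Hausdorff sum.\<close>

lemma grid_slice_card:
  fixes S :: "'a::euclidean_space set"
  assumes "N > 0" "S \<subseteq> Basis"
  shows "finite {z \<in> grid N R. \<forall>b\<in>Basis - S. z \<bullet> b = 0}"
    and "card {z \<in> grid N R. \<forall>b\<in>Basis - S. z \<bullet> b = 0} \<le> (2 * N * R + 1) ^ card S"
proof -
  let ?G = "{z \<in> grid N R. \<forall>b\<in>Basis - S. z \<bullet> b = 0}"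
  let ?P = "PiE S (\<lambda>_. {- int (N * R)..int (N * R)})"
  define \<phi> where "\<phi> z = restrict (\<lambda>b. \<lfloor>real N * (z \<bullet> b)\<rfloor>) S" for z :: 'a
  have fS: "finite S" using assms(2) finite_Basis by (rule finite_subset)
  have eq: "real_of_int \<lfloor>real N * (z \<bullet> b)\<rfloor> = real N * (z \<bullet> b)" if "z \<in> grid N R" "b \<in> Basis" for z b :: 'a
    using that by (auto simp: grid_def)
  have inj: "inj_on \<phi> ?G"
  proof (rule inj_onI)
    fix x y assume x: "x \<in> ?G" and y: "y \<in> ?G" and "\<phi> x = \<phi> y"
    show "x = y"
    proof (rule euclidean_eqI)
      fix b :: 'a assume b: "b \<in> Basis"
      show "x \<bullet> b = y \<bullet> b"
      proof (cases "b \<in> S")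
        case True
        have "\<phi> x b = \<phi> y b" using \<open>\<phi> x = \<phi> y\<close> by simp
        then have "\<lfloor>real N * (x \<bullet> b)\<rfloor> = \<lfloor>real N * (y \<bullet> b)\<rfloor>"
          using True by (simp add: \<phi>_def)
        moreover have "x \<in> grid N R" "y \<in> grid N R" using x y by auto
        ultimately have "real N * (x \<bullet> b) = real N * (y \<bullet> b)"
          using eq[OF _ b] by metis
        then show ?thesis using assms(1) by simp
      next
        case False
        then show ?thesis using x y b by simp
      qed
    qed
  qed
  have sub: "\<phi> ` ?G \<subseteq> ?P"
  proof (rule image_subsetI)
    fix z assume z: "z \<in> ?G"
    show "\<phi> z \<in> ?P"
    proof (rule PiE_I)
      fix b assume b: "b \<in> S"
      then have "b \<in> Basis" using assms(2) by blast
      then have "\<bar>z \<bullet> b\<bar> \<le> real R" using z by (simp add: grid_def)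
      then have "\<bar>real N * (z \<bullet> b)\<bar> \<le> real N * real R"
        by (simp add: abs_mult mult_left_mono)
      moreover have "real_of_int \<lfloor>real N * (z \<bullet> b)\<rfloor> = real N * (z \<bullet> b)"
        using eq[OF _ \<open>b \<in> Basis\<close>] z by blast
      ultimately have "\<bar>real_of_int \<lfloor>real N * (z \<bullet> b)\<rfloor>\<bar> \<le> real N * real R"
        by presburger
      then have "real_of_int \<bar>\<lfloor>real N * (z \<bullet> b)\<rfloor>\<bar> \<le> real_of_int (int (N * R))"
        by simp
      then have "\<bar>\<lfloor>real N * (z \<bullet> b)\<rfloor>\<bar> \<le> int (N * R)"
        by (simp only: of_int_le_iff)
      then show "\<phi> z b \<in> {- int (N * R)..int (N * R)}"
        using b unfolding \<phi>_def by auto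
    qed (simp add: \<phi>_def)
  qed
  have fP: "finite ?P" using fS by (intro finite_PiE) auto
  show fin: "finite ?G" using inj_on_finite[OF inj sub fP] .
  have "card ?G \<le> card ?P" using card_inj_on_le[OF inj sub fP] .
  also have "card ?P = (2 * N * R + 1) ^ card S"
  proof -
    have "nat (int (N * R) + 1 + int (N * R)) = 2 * N * R + 1" by linarith
    then show ?thesis using fS by (simp add: card_PiE)
  qed
  finally show "card ?G \<le> (2 * N * R + 1) ^ card S" .
qed

lemma finite_grid: "N > 0 \<Longrightarrow> finite (grid N R)"
  using grid_slice_card(1)[of N Basis R] by simp

definition round_grid :: "nat \<Rightarrow> 'a::euclidean_space \<Rightarrow> 'a" where
  "round_grid N z = (\<Sum>b\<in>Basis. (real_of_int \<lfloor>real N * (z \<bullet> b)\<rfloor> / real N) *\<^sub>R b)"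

lemma round_grid_inner: "b \<in> Basis \<Longrightarrow> round_grid N z \<bullet> b = real_of_int \<lfloor>real N * (z \<bullet> b)\<rfloor> / real N"
  by (simp add: round_grid_def)

lemma round_grid_inner_diff:
  assumes "N > 0" "b \<in> Basis"
  shows "\<bar>(z - round_grid N z) \<bullet> b\<bar> \<le> 1 / real N"
proof -
  have "z \<bullet> b - real_of_int \<lfloor>real N * (z \<bullet> b)\<rfloor> / real N
      = (real N * (z \<bullet> b) - real_of_int \<lfloor>real N * (z \<bullet> b)\<rfloor>) / real N"
    using assms(1) by (simp add: field_simps)
  moreover have "\<bar>\<dots>\<bar> \<le> 1 / real N"
  proof -
    have "\<bar>real N * (z \<bullet> b) - real_of_int \<lfloor>real N * (z \<bullet> b)\<rfloor>\<bar> \<le> 1"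
      by linarith
    then show ?thesis by (simp add: abs_divide divide_right_mono)
  qed
  ultimately show ?thesis
    using assms by (simp add: inner_diff_left round_grid_inner)
qed

lemma norm_round_grid_diff:
  assumes "N > 0"
  shows "norm (z - round_grid N z :: 'a::euclidean_space) \<le> real DIM('a) / real N"
proof -
  have "norm (z - round_grid N z) \<le> (\<Sum>b\<in>Basis. \<bar>(z - round_grid N z) \<bullet> b\<bar>)"
    by (rule norm_le_l1)
  also have "\<dots> \<le> (\<Sum>b\<in>(Basis::'a set). 1 / real N)"
    using assms by (intro sum_mono round_grid_inner_diff)
  finally show ?thesis by simp
qed

lemma round_grid_in_grid:
  assumes "N > 0" "\<And>b. b \<in> Basis \<Longrightarrow> \<bar>z \<bullet> b\<bar> \<le> real R"
  shows "round_grid N z \<in> grid N R"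
  unfolding grid_def
proof (intro CollectI ballI conjI)
  fix b :: 'a assume b: "b \<in> Basis"
  have eq: "real N * (round_grid N z \<bullet> b) = real_of_int \<lfloor>real N * (z \<bullet> b)\<rfloor>"
    using assms(1) b by (simp add: round_grid_inner)
  then show "real N * (round_grid N z \<bullet> b) \<in> \<int>" by simp
  have "\<bar>real N * (z \<bullet> b)\<bar> \<le> real N * real R"
    using assms(2)[OF b] by (simp add: abs_mult mult_left_mono)
  then have "- int (N * R) \<le> \<lfloor>real N * (z \<bullet> b)\<rfloor>" "\<lfloor>real N * (z \<bullet> b)\<rfloor> \<le> int (N * R)"
    by (simp_all add: le_floor_iff floor_le_iff)
  then have "\<bar>\<lfloor>real N * (z \<bullet> b)\<rfloor>\<bar> \<le> int (N * R)" by linarith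
  then have "real_of_int \<bar>\<lfloor>real N * (z \<bullet> b)\<rfloor>\<bar> \<le> real_of_int (int (N * R))"
    by (simp only: of_int_le_iff)
  then have "\<bar>real N * (round_grid N z \<bullet> b)\<bar> \<le> real N * real R"
    unfolding eq by simp
  then show "\<bar>round_grid N z \<bullet> b\<bar> \<le> real R"
    using assms(1) by (simp add: abs_mult)
qed

lemma zero_in_grid: "0 \<in> grid N R"
  by (simp add: grid_def)

text \<open>The midpoint condition gives approximate additivity on the lattice, since \<open>(p + q) / 2\<close> is the midpoint of
  \<open>p, q\<close> and also of \<open>0, p + q\<close>. Approximate additivity is iterated along each axis and then summed over the
  axes, with an error proportional to \<open>\<eta>\<close>. The Lipschitz condition extends the estimate from the lattice to the
  cube.\<close>

lemma almost_affine:
  fixes u :: "'a::euclidean_space \<Rightarrow> real"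
  assumes N: "N > 0" and lip: "\<And>x y. \<bar>u x - u y\<bar> \<le> M * norm (x - y)"
    and mid: "\<And>p q. p \<in> grid N R \<Longrightarrow> q \<in> grid N R \<Longrightarrow> \<bar>u p + u q - 2 * u ((1/2) *\<^sub>R (p + q))\<bar> \<le> \<eta>"
  shows "\<exists>a. (\<forall>b\<in>Basis. \<bar>a \<bullet> b\<bar> \<le> M) \<and>
    (\<forall>z. (\<forall>b\<in>Basis. \<bar>z \<bullet> b\<bar> \<le> real R) \<longrightarrow>
      \<bar>u z - u 0 - a \<bullet> z\<bar> \<le> 2 * M * real DIM('a) / real N + 2 * real DIM('a) * (real N * real R + 2) * \<eta>)"
proof -
  define v where "v z = u z - u 0" for z
  have v0: "v 0 = 0" by (simp add: v_def)
  have \<eta>: "\<eta> \<ge> 0" using mid[OF zero_in_grid zero_in_grid] by simp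
  have M: "M \<ge> 0"
  proof -
    obtain b :: 'a where b: "b \<in> Basis" using nonempty_Basis by blast
    have "0 \<le> M * norm (b - 0)" using lip[of b 0] by linarith
    then show ?thesis using b by simp
  qed
  \<comment> \<open>The midpoint of \<open>p, q\<close> is also the midpoint of \<open>0, p + q\<close>.\<close>
  have add: "\<bar>v (p + q) - v p - v q\<bar> \<le> 2 * \<eta>" if "p \<in> grid N R" "q \<in> grid N R" "p + q \<in> grid N R" for p q
    using mid[OF that(1,2)] mid[OF zero_in_grid that(3)] by (simp add: v_def)
  have mult: "(real k / real N) *\<^sub>R b \<in> grid N R" "(- (real k / real N)) *\<^sub>R b \<in> grid N R"
    if "b \<in> Basis" "k \<le> N * R" for k b
  proof -
    have "real k \<le> real N * real R" using that(2) by (simp flip: of_nat_mult)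
    then have "real k / real N \<le> real R" using N by (simp add: field_simps)
    then show "(real k / real N) *\<^sub>R b \<in> grid N R" "(- (real k / real N)) *\<^sub>R b \<in> grid N R"
      using that(1) N by (auto simp: grid_def inner_Basis)
  qed
  have line: "\<bar>v ((real k / real N) *\<^sub>R b) - real k * v ((1 / real N) *\<^sub>R b)\<bar> \<le> 2 * real k * \<eta>"
    if "b \<in> Basis" "k \<le> N * R" for k b
    using that(2)
  proof (induction k)
    case 0
    then show ?case by (simp add: v0)
  next
    case (Suc k)
    have e: "(real (Suc k) / real N) *\<^sub>R b = (real k / real N) *\<^sub>R b + (1 / real N) *\<^sub>R b"
      by (simp add: add_divide_distrib scaleR_add_left)
    have "1 \<le> N * R" using Suc.prems by linarith
    then have one: "(1 / real N) *\<^sub>R b \<in> grid N R" using mult(1)[OF that(1), of 1] by simp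
    have "\<bar>v ((real (Suc k) / real N) *\<^sub>R b) - v ((real k / real N) *\<^sub>R b) - v ((1 / real N) *\<^sub>R b)\<bar> \<le> 2 * \<eta>"
      using add[OF mult(1)[OF that(1), of k] one] mult(1)[OF that(1), of "Suc k"] Suc.prems
      unfolding e by simp
    moreover have "\<bar>v ((real k / real N) *\<^sub>R b) - real k * v ((1 / real N) *\<^sub>R b)\<bar> \<le> 2 * real k * \<eta>"
      using Suc by simp
    ultimately show ?case by (simp add: algebra_simps abs_le_iff)
  qed
  define C where "C = 2 * (real N * real R + 1) * \<eta>"
  have axis: "\<bar>v ((z \<bullet> b) *\<^sub>R b) - real N * (z \<bullet> b) * v ((1 / real N) *\<^sub>R b)\<bar> \<le> C"
    if b: "b \<in> Basis" and z: "z \<in> grid N R" for b z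
  proof -
    obtain m where m: "real N * (z \<bullet> b) = real_of_int m"
      using z b by (auto simp: grid_def elim!: Ints_cases)
    define k where "k = nat \<bar>m\<bar>"
    have zb: "\<bar>z \<bullet> b\<bar> = real k / real N"
    proof -
      have "real N * \<bar>z \<bullet> b\<bar> = real k" using m by (simp add: k_def abs_mult flip: m)
      then show ?thesis using N by (simp add: field_simps)
    qed
    have "\<bar>z \<bullet> b\<bar> \<le> real R" using z b by (simp add: grid_def)
    then have "real k \<le> real N * real R" using zb N by (simp add: field_simps)
    then have k: "k \<le> N * R" by (simp flip: of_nat_mult)
    have kC: "2 * real k * \<eta> + 2 * \<eta> \<le> C"
      using \<open>real k \<le> real N * real R\<close> \<eta> unfolding C_def
      by (simp add: algebra_simps mult_left_mono)
    note l = line[OF b k]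
    show ?thesis
    proof (cases "z \<bullet> b \<ge> 0")
      case True
      then have "z \<bullet> b = real k / real N" using zb by simp
      then show ?thesis using l kC \<eta> N by simp
    next
      case False
      then have zb': "z \<bullet> b = - (real k / real N)" using zb by simp
      have "\<bar>v ((real k / real N) *\<^sub>R b + (- (real k / real N)) *\<^sub>R b) - v ((real k / real N) *\<^sub>R b)
          - v ((- (real k / real N)) *\<^sub>R b)\<bar> \<le> 2 * \<eta>"
        using mult[OF b k] by (intro add) (simp_all add: zero_in_grid)
      then have "\<bar>v ((real k / real N) *\<^sub>R b) + v ((- (real k / real N)) *\<^sub>R b)\<bar> \<le> 2 * \<eta>"
        by (simp add: v0)
      then show ?thesis using l kC N unfolding zb' by (simp add: abs_le_iff)
    qed
  qed
  have part: "\<bar>v (\<Sum>b\<in>S. (z \<bullet> b) *\<^sub>R b) - (\<Sum>b\<in>S. v ((z \<bullet> b) *\<^sub>R b))\<bar> \<le> 2 * real (card S) * \<eta>"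
    if z: "z \<in> grid N R" and "finite S" "S \<subseteq> Basis" for z S
    using that(2,3)
  proof (induction S rule: finite_induct)
    case empty
    then show ?case by (simp add: v0)
  next
    case (insert b S)
    have ing: "(\<Sum>b\<in>T. (z \<bullet> b) *\<^sub>R b) \<in> grid N R" if "T \<subseteq> Basis" for T
    proof -
      have "(\<Sum>b\<in>T. (z \<bullet> b) *\<^sub>R b) \<bullet> c = (if c \<in> T then z \<bullet> c else 0)" if "c \<in> Basis" for c
      proof -
        have "(\<Sum>b\<in>T. (z \<bullet> b) *\<^sub>R b) \<bullet> c = (\<Sum>b\<in>T. if b = c then z \<bullet> c else 0)"
          unfolding inner_sum_left using \<open>T \<subseteq> Basis\<close> that
          by (intro sum.cong) (auto simp: inner_Basis subset_iff)
        also have "\<dots> = (if c \<in> T then z \<bullet> c else 0)"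
          using finite_subset[OF \<open>T \<subseteq> Basis\<close> finite_Basis] by simp
        finally show ?thesis .
      qed
      then show ?thesis using z by (simp add: grid_def)
    qed
    have "\<bar>v ((z \<bullet> b) *\<^sub>R b + (\<Sum>b\<in>S. (z \<bullet> b) *\<^sub>R b)) - v ((z \<bullet> b) *\<^sub>R b) - v (\<Sum>b\<in>S. (z \<bullet> b) *\<^sub>R b)\<bar> \<le> 2 * \<eta>"
      using ing[of "{b}"] ing[of S] ing[of "insert b S"] insert by (intro add) auto
    moreover have "\<bar>v (\<Sum>b\<in>S. (z \<bullet> b) *\<^sub>R b) - (\<Sum>b\<in>S. v ((z \<bullet> b) *\<^sub>R b))\<bar> \<le> 2 * real (card S) * \<eta>"
      using insert by simp
    ultimately show ?case using insert.hyps by (simp add: algebra_simps abs_le_iff)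
  qed
  define a where "a = (\<Sum>b\<in>Basis. (real N * v ((1 / real N) *\<^sub>R b)) *\<^sub>R b)"
  have ab: "a \<bullet> b = real N * v ((1 / real N) *\<^sub>R b)" if "b \<in> Basis" for b
    using that by (simp add: a_def)
  have abM: "\<bar>a \<bullet> b\<bar> \<le> M" if "b \<in> Basis" for b
  proof -
    have "\<bar>v ((1 / real N) *\<^sub>R b)\<bar> \<le> M * (1 / real N)"
      using lip[of "(1 / real N) *\<^sub>R b" 0] that by (simp add: v_def)
    then show ?thesis using N by (simp add: ab[OF that] abs_mult field_simps)
  qed
  have onlat: "\<bar>v z - a \<bullet> z\<bar> \<le> 2 * real DIM('a) * (real N * real R + 2) * \<eta>" if z: "z \<in> grid N R" for z
  proof -
    have 1: "\<bar>v z - (\<Sum>b\<in>Basis. v ((z \<bullet> b) *\<^sub>R b))\<bar> \<le> 2 * real DIM('a) * \<eta>"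
      using part[OF z, of Basis] by (simp add: euclidean_representation)
    have az: "a \<bullet> z = (\<Sum>b\<in>Basis. real N * (z \<bullet> b) * v ((1 / real N) *\<^sub>R b))"
      unfolding a_def inner_sum_left by (intro sum.cong) (simp_all add: inner_commute)
    have "\<bar>(\<Sum>b\<in>Basis. v ((z \<bullet> b) *\<^sub>R b)) - a \<bullet> z\<bar> \<le> (\<Sum>b\<in>(Basis::'a set). C)"
      unfolding az sum_subtractf[symmetric] by (rule order_trans[OF sum_abs]) (intro sum_mono axis z)
    then have 2: "\<bar>(\<Sum>b\<in>Basis. v ((z \<bullet> b) *\<^sub>R b)) - a \<bullet> z\<bar> \<le> real DIM('a) * C" by simp
    have "\<bar>v z - a \<bullet> z\<bar> \<le> 2 * real DIM('a) * \<eta> + real DIM('a) * C"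
      using 1 2 by linarith
    also have "\<dots> = 2 * real DIM('a) * (real N * real R + 2) * \<eta>"
      by (simp add: C_def algebra_simps)
    finally show ?thesis .
  qed
  have "\<bar>u z - u 0 - a \<bullet> z\<bar> \<le> 2 * M * real DIM('a) / real N + 2 * real DIM('a) * (real N * real R + 2) * \<eta>"
    if z: "\<And>b. b \<in> Basis \<Longrightarrow> \<bar>z \<bullet> b\<bar> \<le> real R" for z
  proof -
    let ?q = "round_grid N z"
    have 1: "\<bar>v ?q - a \<bullet> ?q\<bar> \<le> 2 * real DIM('a) * (real N * real R + 2) * \<eta>"
      by (intro onlat round_grid_in_grid N z)
    have "\<bar>v z - v ?q\<bar> \<le> M * norm (z - ?q)" using lip[of z ?q] by (simp add: v_def)
    also have "\<dots> \<le> M * (real DIM('a) / real N)"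
      by (intro mult_left_mono norm_round_grid_diff N M)
    finally have 2: "\<bar>v z - v ?q\<bar> \<le> M * real DIM('a) / real N" by simp
    have "\<bar>a \<bullet> (z - ?q)\<bar> = \<bar>\<Sum>b\<in>Basis. (a \<bullet> b) * ((z - ?q) \<bullet> b)\<bar>"
      by (subst euclidean_inner) simp
    also have "\<dots> \<le> (\<Sum>b\<in>Basis. \<bar>(a \<bullet> b) * ((z - ?q) \<bullet> b)\<bar>)" by (rule sum_abs)
    also have "\<dots> \<le> (\<Sum>b\<in>(Basis::'a set). M * (1 / real N))"
      unfolding abs_mult using M by (intro sum_mono mult_mono abM round_grid_inner_diff N) auto
    finally have 3: "\<bar>a \<bullet> (z - ?q)\<bar> \<le> M * real DIM('a) / real N" by (simp add: mult.commute)
    have "u z - u 0 - a \<bullet> z = (v z - v ?q) + (v ?q - a \<bullet> ?q) - a \<bullet> (z - ?q)"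
      by (simp add: v_def inner_diff_right)
    then have "\<bar>u z - u 0 - a \<bullet> z\<bar> \<le> M * real DIM('a) / real N + 2 * real DIM('a) * (real N * real R + 2) * \<eta> + M * real DIM('a) / real N"
      using 1 2 3 by linarith
    also have "\<dots> = 2 * M * real DIM('a) / real N + 2 * real DIM('a) * (real N * real R + 2) * \<eta>"
      by (simp add: field_simps)
    finally show ?thesis .
  qed
  with abM show ?thesis by blast
qed

section \<open>Increments at small dyadic scales\<close>

lemma nn_integral_lborel_translate:
  fixes g :: "'a::euclidean_space \<Rightarrow> ennreal"
  assumes [measurable]: "g \<in> borel_measurable borel"
  shows "(\<integral>\<^sup>+ x. g (x + h) \<partial>lborel) = (\<integral>\<^sup>+ x. g x \<partial>lborel)"
proof -
  have "(\<integral>\<^sup>+ x. g x \<partial>lborel) = (\<integral>\<^sup>+ x. g x \<partial>(distr lborel borel ((+) h)))"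
    by (simp add: lborel_distr_plus)
  also have "\<dots> = (\<integral>\<^sup>+ x. g (h + x) \<partial>lborel)"
    by (subst nn_integral_distr) simp_all
  finally show ?thesis by (simp add: add.commute)
qed

lemma emeasure_lborel_translate:
  fixes A :: "'a::euclidean_space set"
  assumes [measurable]: "A \<in> sets borel"
  shows "emeasure lborel {x. x + h \<in> A} = emeasure lborel A"
proof -
  have "{x. x + h \<in> A} \<in> sets borel" by measurable
  then have "emeasure lborel {x. x + h \<in> A} = (\<integral>\<^sup>+ x. indicator {x. x + h \<in> A} x \<partial>lborel)"
    by simp
  also have "\<dots> = (\<integral>\<^sup>+ x. indicator A (x + h) \<partial>lborel)"
    by (simp add: indicator_def)
  also have "\<dots> = emeasure lborel A"
    by (subst nn_integral_lborel_translate) simp_all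
  finally show ?thesis .
qed

text \<open>For an increasing sequence this says that it is eventually constant up to \<open>e\<close>.\<close>

lemma ennreal_bounded_seq_near_sup:
  fixes s :: "nat \<Rightarrow> ennreal"
  assumes "\<And>k. s k \<le> C" "C < \<infinity>" "e > 0"
  shows "\<exists>k0. \<forall>k. s k \<le> s k0 + ennreal e"
proof -
  have "(SUP k. s k) \<le> C" using assms by (intro SUP_least)
  from le_less_trans[OF this assms(2)] have lt: "(SUP k. s k) < top" by simp
  show ?thesis
  proof (cases "(SUP k. s k) = 0")
    case True
    then have "s k \<le> s 0 + ennreal e" for k
      by (simp add: SUP_eq_iff)
    then show ?thesis by blast
  next
    case False
    then have "(SUP k. s k) - ennreal e < (SUP k. s k)"
      using lt assms(3) by (intro ennreal_between) (simp_all add: zero_less_iff_neq_zero)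
    then obtain k0 where "(SUP k. s k) - ennreal e < s k0"
      by (auto simp: less_SUP_iff)
    then have *: "(SUP k. s k) \<le> s k0 + ennreal e"
      by (metis ennreal_minus_le_iff less_imp_le top_neq_ennreal add.commute)
    have "s k \<le> s k0 + ennreal e" for k
      using SUP_upper[of k UNIV s] * by (auto intro: order_trans)
    then show ?thesis by blast
  qed
qed

text \<open>For an index set \<open>I\<close> let \<open>s I h\<close> be the integral of the supremum over \<open>i \<in> I\<close> of the increments
  \<open>\<bar>w i (x + h) - w i x\<bar>\<close>. The triangle inequality and translation invariance give
  \<open>s I (2 h) \<le> 2 s I h\<close>, so \<open>2\<^sup>k s I (v / 2\<^sup>k)\<close> increases with \<open>k\<close>, and it is bounded. Choose a scale
  \<open>k0\<close> at which the value for all indices is nearly its limit, and then a finite set of indices that nearly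
  attains this value at the scale \<open>k0\<close>. By monotonicity the finite set is nearly optimal at every
  smaller scale, and Markov's inequality turns this into a bound on the exceptional set.\<close>

lemma sup_increment_attained_by_finite:
  fixes w :: "nat \<Rightarrow> 'a::euclidean_space \<Rightarrow> real"
  assumes lip: "\<And>j x y. \<bar>w j x - w j y\<bar> \<le> M * norm (x - y)" and M: "M \<ge> 0"
    and supp: "\<And>j x. norm x > \<rho> \<Longrightarrow> w j x = 0" and e: "e > 0" and \<tau>: "\<tau> > 0"
  shows "\<exists>J k0. \<forall>k\<ge>k0. \<forall>J'\<ge>J.
    emeasure lborel {x. \<exists>j. \<forall>i<J'. \<bar>w j (x + (1/2^k) *\<^sub>R v) - w j x\<bar>
        > \<bar>w i (x + (1/2^k) *\<^sub>R v) - w i x\<bar> + \<tau> * (1/2^k)} \<le> ennreal e"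
proof -
  have cont: "continuous_on UNIV (w j)" for j
  proof -
    have "M-lipschitz_on UNIV (w j)"
      using lip M by (intro lipschitz_onI) (auto simp: dist_norm)
    then show ?thesis by (rule lipschitz_on_continuous_on)
  qed
  have [measurable]: "w j \<in> borel_measurable borel" for j
    using cont by (rule borel_measurable_continuous_onI)
  define D where "D h j x = ennreal \<bar>w j (x + h) - w j x\<bar>" for h j x
  have [measurable]: "D h j \<in> borel_measurable borel" for h j
    unfolding D_def by measurable
  have [measurable]: "(\<lambda>x. SUP j\<in>I. D h j x) \<in> borel_measurable borel" for I h
    by (intro borel_measurable_SUP) auto
  define S where "S h = (\<integral>\<^sup>+ x. (SUP j. D h j x) \<partial>lborel)" for h
  define SJ where "SJ J h = (\<integral>\<^sup>+ x. (SUP j\<in>{..<J}. D h j x) \<partial>lborel)" for J :: nat and h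
  have doubling: "(\<integral>\<^sup>+ x. (SUP j\<in>I. D (2 *\<^sub>R h) j x) \<partial>lborel) \<le> 2 * (\<integral>\<^sup>+ x. (SUP j\<in>I. D h j x) \<partial>lborel)"
    for I :: "nat set" and h
  proof -
    have "(SUP j\<in>I. D (2 *\<^sub>R h) j x) \<le> (SUP j\<in>I. D h j (x + h)) + (SUP j\<in>I. D h j x)" for x
    proof (rule SUP_least)
      fix j assume j: "j \<in> I"
      have "D (2 *\<^sub>R h) j x \<le> D h j (x + h) + D h j x"
      proof -
        have "\<bar>w j (x + 2 *\<^sub>R h) - w j x\<bar> \<le> \<bar>w j (x + h + h) - w j (x + h)\<bar> + \<bar>w j (x + h) - w j x\<bar>"
          by (simp add: scaleR_2 add.assoc)
        then show ?thesis
          unfolding D_def by (simp add: ennreal_leI flip: ennreal_plus)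
      qed
      also have "\<dots> \<le> (SUP j\<in>I. D h j (x + h)) + (SUP j\<in>I. D h j x)"
        using j by (intro add_mono SUP_upper)
      finally show "D (2 *\<^sub>R h) j x \<le> \<dots>" .
    qed
    then have "(\<integral>\<^sup>+ x. (SUP j\<in>I. D (2 *\<^sub>R h) j x) \<partial>lborel)
        \<le> (\<integral>\<^sup>+ x. (SUP j\<in>I. D h j (x + h)) + (SUP j\<in>I. D h j x) \<partial>lborel)"
      by (intro nn_integral_mono)
    also have "\<dots> = (\<integral>\<^sup>+ x. (SUP j\<in>I. D h j (x + h)) \<partial>lborel) + (\<integral>\<^sup>+ x. (SUP j\<in>I. D h j x) \<partial>lborel)"
      by (intro nn_integral_add measurable_compose[of "\<lambda>x. x + h" lborel borel "\<lambda>x. SUP j\<in>I. D h j x"]) simp_all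
    also have "(\<integral>\<^sup>+ x. (SUP j\<in>I. D h j (x + h)) \<partial>lborel) = (\<integral>\<^sup>+ x. (SUP j\<in>I. D h j x) \<partial>lborel)"
      by (rule nn_integral_lborel_translate) simp
    finally show ?thesis by (simp add: mult_2)
  qed
  define r :: "nat \<Rightarrow> real" where "r k = 1 / 2 ^ k" for k
  have r: "r k > 0" "r k \<le> 1" for k by (simp_all add: r_def)
  define h where "h k = r k *\<^sub>R v" for k
  have hS: "h k = 2 *\<^sub>R h (Suc k)" for k by (simp add: h_def r_def)
  define s where "s k = ennreal (2 ^ k) * S (h k)" for k
  define sJ where "sJ J k = ennreal (2 ^ k) * SJ J (h k)" for J k
  have two: "ennreal (2 ^ Suc k) = ennreal (2 ^ k) * 2" for k
    by (simp add: ennreal_mult mult.commute)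
  have incJ: "sJ J k \<le> sJ J (Suc k)" for J k
    using doubling[where I = "{..<J}" and h = "h (Suc k)"] unfolding sJ_def SJ_def hS[symmetric] two mult.assoc
    by (intro mult_left_mono) simp_all
  have incJ': "k \<le> l \<Longrightarrow> sJ J k \<le> sJ J l" for J k l
    using lift_Suc_mono_le[of "sJ J" k l] incJ by blast
  have monoJ: "sJ J k \<le> sJ J' k" if "J \<le> J'" for J J' k
    unfolding sJ_def SJ_def using that
    by (intro mult_left_mono nn_integral_mono SUP_subset_mono) auto
  have sJ_le: "sJ J k \<le> s k" for J k
    unfolding sJ_def s_def S_def SJ_def
    by (intro mult_left_mono nn_integral_mono SUP_subset_mono) auto
  have bound: "s k \<le> ennreal (M * norm v) * emeasure lborel (cball (0::'a) (\<rho> + norm v))" for k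
  proof -
    have hk: "norm (h k) \<le> norm v" using r[of k] by (simp add: h_def mult_left_le_one_le)
    have pt: "D (h k) j x \<le> ennreal (M * (r k * norm v)) * indicator (cball (0::'a) (\<rho> + norm v)) x" for j x
    proof (cases "x \<in> cball 0 (\<rho> + norm v)")
      case True
      then show ?thesis using lip[of j "x + h k" x] r[of k]
        by (auto simp: D_def h_def intro!: ennreal_leI)
    next
      case False
      then have "norm x > \<rho> + norm v" by simp
      then have "norm x > \<rho>" "norm (x + h k) > \<rho>"
        using hk norm_diff_ineq[of x "h k"] norm_ge_zero[of v] by linarith+
      then show ?thesis by (simp add: D_def supp)
    qed
    have "S (h k) \<le> (\<integral>\<^sup>+ x. ennreal (M * (r k * norm v)) * indicator (cball (0::'a) (\<rho> + norm v)) x \<partial>lborel)"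
      unfolding S_def by (intro nn_integral_mono SUP_least pt)
    also have "\<dots> = ennreal (M * (r k * norm v)) * emeasure lborel (cball (0::'a) (\<rho> + norm v))"
      by (subst nn_integral_cmult_indicator) simp_all
    finally have "s k \<le> ennreal (2 ^ k) * (ennreal (M * (r k * norm v)) * emeasure lborel (cball (0::'a) (\<rho> + norm v)))"
      unfolding s_def by (intro mult_left_mono) simp_all
    also have "ennreal (2 ^ k) * (ennreal (M * (r k * norm v)) * emeasure lborel (cball (0::'a) (\<rho> + norm v)))
       = ennreal (2 ^ k * (M * (r k * norm v))) * emeasure lborel (cball (0::'a) (\<rho> + norm v))"
      using M r[of k] by (simp add: ennreal_mult mult.assoc)
    also have "2 ^ k * (M * (r k * norm v)) = M * norm v" by (simp add: r_def)
    finally show ?thesis .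
  qed
  have bfin: "ennreal (M * norm v) * emeasure lborel (cball (0::'a) (\<rho> + norm v)) < \<infinity>"
    using emeasure_lborel_cball_finite[of "0::'a" "\<rho> + norm v"] by (simp add: ennreal_mult_less_top)
  define e' where "e' = e * \<tau> / 2"
  have e': "e' > 0" using e \<tau> by (simp add: e'_def)
  obtain k0 where k0: "\<And>k. s k \<le> s k0 + ennreal e'"
    using ennreal_bounded_seq_near_sup[of s, OF bound bfin e'] by blast
  have "(SUP J. sJ J k0) = s k0"
  proof -
    have "(SUP J. SJ J (h k0)) = (\<integral>\<^sup>+ x. (SUP J. SUP j\<in>{..<J}. D (h k0) j x) \<partial>lborel)"
      unfolding SJ_def
      by (subst nn_integral_monotone_convergence_SUP)
         (auto simp: incseq_def le_fun_def intro!: SUP_subset_mono)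
    also have "\<dots> = S (h k0)"
    proof -
      have "(SUP J. SUP j\<in>{..<J}. D (h k0) j x) = (SUP j. D (h k0) j x)" for x
      proof (rule antisym)
        show "(SUP J. SUP j\<in>{..<J}. D (h k0) j x) \<le> (SUP j. D (h k0) j x)"
          by (intro SUP_least SUP_upper) simp
        show "(SUP j. D (h k0) j x) \<le> (SUP J. SUP j\<in>{..<J}. D (h k0) j x)"
        proof (rule SUP_least)
          fix j
          show "D (h k0) j x \<le> (SUP J. SUP j\<in>{..<J}. D (h k0) j x)"
            by (rule SUP_upper2[of "Suc j"]) (auto intro: SUP_upper)
        qed
      qed
      then show ?thesis by (simp add: S_def)
    qed
    finally show ?thesis
      unfolding sJ_def s_def SUP_mult_left_ennreal[symmetric] by simp
  qed
  moreover obtain J where J: "\<And>J'. sJ J' k0 \<le> sJ J k0 + ennreal e'"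
    using ennreal_bounded_seq_near_sup[of "\<lambda>J. sJ J k0", OF order_trans[OF sJ_le bound] bfin e'] by blast
  ultimately have "s k0 \<le> sJ J k0 + ennreal e'"
    by (metis SUP_least)
  have main: "s k \<le> sJ J' k + ennreal (e * \<tau>)" if "k \<ge> k0" "J' \<ge> J" for k J'
  proof -
    have "s k \<le> s k0 + ennreal e'" by (rule k0)
    also have "\<dots> \<le> (sJ J k0 + ennreal e') + ennreal e'"
      using \<open>s k0 \<le> sJ J k0 + ennreal e'\<close> by (intro add_mono) auto
    also have "\<dots> = sJ J k0 + ennreal (e * \<tau>)"
      using e' by (simp add: e'_def add.assoc mult.commute flip: ennreal_plus)
    also have "\<dots> \<le> sJ J' k + ennreal (e * \<tau>)"
      using order_trans[OF monoJ[OF that(2), of k0] incJ'[OF that(1), of J']] by (intro add_mono) auto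
    finally show ?thesis .
  qed
  show ?thesis
  \<comment> \<open>\<open>Suc J\<close> excludes \<open>J' = 0\<close>, for which the exceptional set is the whole space.\<close>
  proof (rule exI[of _ "Suc J"], rule exI[of _ k0], intro allI impI)
    fix k J' assume k: "k \<ge> k0" "J' \<ge> Suc J"
    let ?B = "{x. \<exists>j. \<forall>i<J'. \<bar>w j (x + (1/2^k) *\<^sub>R v) - w j x\<bar>
        > \<bar>w i (x + (1/2^k) *\<^sub>R v) - w i x\<bar> + \<tau> * (1/2^k)}"
    have B: "?B \<in> sets borel" by measurable
    have pt: "(SUP j\<in>{..<J'}. D (h k) j x) + ennreal (\<tau> * r k) * indicator ?B x \<le> (SUP j. D (h k) j x)" for x
    proof (cases "x \<in> ?B")
      case True
      then obtain j where j: "\<forall>i<J'. \<bar>w j (x + h k) - w j x\<bar> > \<bar>w i (x + h k) - w i x\<bar> + \<tau> * r k"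
        by (auto simp: h_def r_def)
      have "(SUP i\<in>{..<J'}. D (h k) i x) + ennreal (\<tau> * r k) \<le> D (h k) j x"
      proof -
        have "(SUP i\<in>{..<J'}. D (h k) i x) + ennreal (\<tau> * r k) = (SUP i\<in>{..<J'}. D (h k) i x + ennreal (\<tau> * r k))"
          using k by (intro ennreal_SUP_add_left[symmetric]) (auto simp: lessThan_empty_iff)
        also have "\<dots> \<le> D (h k) j x"
        proof (rule SUP_least)
          fix i assume "i \<in> {..<J'}"
          then have "\<bar>w i (x + h k) - w i x\<bar> + \<tau> * r k \<le> \<bar>w j (x + h k) - w j x\<bar>"
            using j by (auto simp: less_imp_le)
          then show "D (h k) i x + ennreal (\<tau> * r k) \<le> D (h k) j x"
            unfolding D_def using \<tau> r[of k] by (simp flip: ennreal_plus add: ennreal_leI)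
        qed
        finally show ?thesis .
      qed
      also have "\<dots> \<le> (SUP j. D (h k) j x)" by (rule SUP_upper) simp
      finally show ?thesis using True by simp
    next
      case False
      then show ?thesis by (auto intro!: SUP_subset_mono)
    qed
    have "SJ J' (h k) + ennreal (\<tau> * r k) * emeasure lborel ?B
        = (\<integral>\<^sup>+ x. (SUP j\<in>{..<J'}. D (h k) j x) + ennreal (\<tau> * r k) * indicator ?B x \<partial>lborel)"
      unfolding SJ_def using B
      by (subst nn_integral_add) (auto simp: nn_integral_cmult_indicator)
    also have "\<dots> \<le> S (h k)"
      unfolding S_def by (intro nn_integral_mono pt)
    finally have "ennreal (2 ^ k) * (SJ J' (h k) + ennreal (\<tau> * r k) * emeasure lborel ?B) \<le> s k"
      unfolding s_def by (rule mult_left_mono) simp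
    moreover have "ennreal (2 ^ k) * (SJ J' (h k) + ennreal (\<tau> * r k) * emeasure lborel ?B)
        = sJ J' k + ennreal \<tau> * emeasure lborel ?B"
    proof -
      have "ennreal (2 ^ k) * ennreal (\<tau> * r k) = ennreal \<tau>"
        using \<tau> by (subst ennreal_mult[symmetric]) (simp_all add: r_def)
      then show ?thesis
        unfolding sJ_def distrib_left mult.assoc[symmetric] by simp
    qed
    ultimately have "sJ J' k + ennreal \<tau> * emeasure lborel ?B \<le> sJ J' k + ennreal (e * \<tau>)"
      using order_trans[OF _ main[of k J']] k by simp
    moreover have "sJ J' k \<noteq> \<infinity>"
      using le_less_trans[OF order_trans[OF sJ_le bound] bfin, of J' k] by auto
    ultimately have "ennreal \<tau> * emeasure lborel ?B \<le> ennreal (e * \<tau>)"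
      by (auto simp: ennreal_add_left_cancel_le)
    then have "ennreal \<tau> * emeasure lborel ?B \<le> ennreal \<tau> * ennreal e"
      using e \<tau> by (simp add: ennreal_mult mult.commute)
    then show "emeasure lborel ?B \<le> ennreal e"
      using \<tau> by (subst (asm) ennreal_mult_le_mult_iff) auto
  qed
qed

text \<open>Let \<open>Q h\<close> be the integral of the squared increments of \<open>u\<close> with step \<open>h\<close>, and \<open>P h\<close> that of the
  squared second increments. The parallelogram law integrates to \<open>Q (2 h) + P h = 4 Q h\<close>. Hence
  \<open>4\<^sup>k Q (v / 2\<^sup>k)\<close> increases with \<open>k\<close>, its differences are the quantities \<open>4\<^sup>k P (v / 2\<^bsup>k + 1\<^esup>)\<close>, and these tend to \<open>0\<close>
  because the sequence is bounded.\<close>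

lemma second_increment_eventually_small:
  fixes u :: "'a::euclidean_space \<Rightarrow> real"
  assumes lip: "\<And>x y. \<bar>u x - u y\<bar> \<le> M * norm (x - y)" and M: "M \<ge> 0"
    and supp: "\<And>x. norm x > \<rho> \<Longrightarrow> u x = 0" and e: "e > 0" and c: "c > 0"
  shows "\<exists>k0. \<forall>k\<ge>k0.
    emeasure lborel {x. \<bar>u (x + (2/2^k) *\<^sub>R v) - 2 * u (x + (1/2^k) *\<^sub>R v) + u x\<bar> > c * (1/2^k)} \<le> ennreal e"
proof -
  have "M-lipschitz_on UNIV u"
    using lip M by (intro lipschitz_onI) (auto simp: dist_norm)
  then have "continuous_on UNIV u" by (rule lipschitz_on_continuous_on)
  then have [measurable]: "u \<in> borel_measurable borel"
    by (rule borel_measurable_continuous_onI)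
  define Q where "Q h = (\<integral>\<^sup>+ x. ennreal ((u (x + h) - u x)\<^sup>2) \<partial>lborel)" for h
  define P where "P h = (\<integral>\<^sup>+ x. ennreal ((u (x + 2 *\<^sub>R h) - 2 * u (x + h) + u x)\<^sup>2) \<partial>lborel)" for h
  have parallelogram: "Q (2 *\<^sub>R h) + P h = 4 * Q h" for h
  proof -
    have pt: "ennreal ((u (x + 2 *\<^sub>R h) - u x)\<^sup>2) + ennreal ((u (x + 2 *\<^sub>R h) - 2 * u (x + h) + u x)\<^sup>2)
        = 2 * ennreal ((u (x + h + h) - u (x + h))\<^sup>2) + 2 * ennreal ((u (x + h) - u x)\<^sup>2)" for x
    proof -
      have "(u (x + 2 *\<^sub>R h) - u x)\<^sup>2 + (u (x + 2 *\<^sub>R h) - 2 * u (x + h) + u x)\<^sup>2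
        = 2 * (u (x + h + h) - u (x + h))\<^sup>2 + 2 * (u (x + h) - u x)\<^sup>2"
        by (simp add: scaleR_2 add.assoc power2_eq_square algebra_simps)
      moreover have "2 * ennreal (t\<^sup>2) = ennreal (2 * t\<^sup>2)" for t :: real
        by (simp add: ennreal_mult)
      ultimately show ?thesis
        by (simp flip: ennreal_plus)
    qed
    have "Q (2 *\<^sub>R h) + P h = (\<integral>\<^sup>+ x. ennreal ((u (x + 2 *\<^sub>R h) - u x)\<^sup>2)
        + ennreal ((u (x + 2 *\<^sub>R h) - 2 * u (x + h) + u x)\<^sup>2) \<partial>lborel)"
      unfolding Q_def P_def by (subst nn_integral_add) simp_all
    also have "\<dots> = (\<integral>\<^sup>+ x. 2 * ennreal ((u (x + h + h) - u (x + h))\<^sup>2) \<partial>lborel)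
        + (\<integral>\<^sup>+ x. 2 * ennreal ((u (x + h) - u x)\<^sup>2) \<partial>lborel)"
      unfolding pt by (subst nn_integral_add) simp_all
    also have "\<dots> = 2 * (\<integral>\<^sup>+ x. ennreal ((u (x + h + h) - u (x + h))\<^sup>2) \<partial>lborel) + 2 * Q h"
      unfolding Q_def by (simp add: nn_integral_cmult)
    also have "(\<integral>\<^sup>+ x. ennreal ((u (x + h + h) - u (x + h))\<^sup>2) \<partial>lborel) = Q h"
      unfolding Q_def by (rule nn_integral_lborel_translate[of "\<lambda>x. ennreal ((u (x + h) - u x)\<^sup>2)"]) simp
    also have "2 * Q h + 2 * Q h = 4 * Q h"
      by (simp flip: distrib_right)
    finally show ?thesis .
  qed
  define r :: "nat \<Rightarrow> real" where "r k = 1 / 2 ^ k" for k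
  have r: "r k > 0" "r k \<le> 1" for k by (simp_all add: r_def)
  define h where "h k = r k *\<^sub>R v" for k
  have hS: "2 *\<^sub>R h (Suc k) = h k" for k by (simp add: h_def r_def)
  define q where "q k = ennreal (4 ^ k) * Q (h k)" for k
  have step: "q k + ennreal (4 ^ k) * P (h (Suc k)) = q (Suc k)" for k
  proof -
    have "q (Suc k) = ennreal (4 ^ k) * (4 * Q (h (Suc k)))"
      by (simp add: q_def ennreal_mult mult_ac)
    also have "\<dots> = q k + ennreal (4 ^ k) * P (h (Suc k))"
      unfolding parallelogram[symmetric] hS q_def by (simp add: distrib_left)
    finally show ?thesis by simp
  qed
  have "q k \<le> q (Suc k)" for k
    unfolding step[of k, symmetric] by simp
  then have inc: "k \<le> l \<Longrightarrow> q k \<le> q l" for k l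
    using lift_Suc_mono_le[of q k l] by blast
  have bound: "q k \<le> ennreal ((M * norm v)\<^sup>2) * emeasure lborel (cball (0::'a) (\<rho> + norm v))" for k
  proof -
    have hk: "norm (h k) \<le> norm v" using r[of k] by (simp add: h_def mult_left_le_one_le)
    have "ennreal ((u (x + h k) - u x)\<^sup>2) \<le> ennreal ((M * (r k * norm v))\<^sup>2) * indicator (cball (0::'a) (\<rho> + norm v)) x" for x
    proof (cases "x \<in> cball 0 (\<rho> + norm v)")
      case True
      have "\<bar>u (x + h k) - u x\<bar> \<le> M * (r k * norm v)"
        using lip[of "x + h k" x] r[of k] by (simp add: h_def)
      then have "(u (x + h k) - u x)\<^sup>2 \<le> (M * (r k * norm v))\<^sup>2"
        using power_mono[of "\<bar>u (x + h k) - u x\<bar>" _ 2] by simp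
      with True show ?thesis by (simp add: ennreal_leI)
    next
      case False
      then have "norm x > \<rho> + norm v" by simp
      then have "norm x > \<rho>" "norm (x + h k) > \<rho>"
        using hk norm_diff_ineq[of x "h k"] norm_ge_zero[of v] by linarith+
      then show ?thesis by (simp add: supp)
    qed
    then have "Q (h k) \<le> (\<integral>\<^sup>+ x. ennreal ((M * (r k * norm v))\<^sup>2) * indicator (cball (0::'a) (\<rho> + norm v)) x \<partial>lborel)"
      unfolding Q_def by (rule nn_integral_mono)
    also have "\<dots> = ennreal ((M * (r k * norm v))\<^sup>2) * emeasure lborel (cball (0::'a) (\<rho> + norm v))"
      by (subst nn_integral_cmult_indicator) simp_all
    finally have "q k \<le> ennreal (4 ^ k) * (ennreal ((M * (r k * norm v))\<^sup>2) * emeasure lborel (cball (0::'a) (\<rho> + norm v)))"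
      unfolding q_def by (intro mult_left_mono) simp_all
    also have "\<dots> = ennreal (4 ^ k * (M * (r k * norm v))\<^sup>2) * emeasure lborel (cball (0::'a) (\<rho> + norm v))"
      by (subst ennreal_mult) (simp_all add: mult.assoc)
    also have "4 ^ k * (M * (r k * norm v))\<^sup>2 = (M * norm v)\<^sup>2"
    proof -
      have "(4::real) ^ k = (2 ^ k)\<^sup>2" by (simp add: power2_eq_square flip: power_mult_distrib)
      then have "4 ^ k * (r k)\<^sup>2 = 1" by (simp add: r_def power_divide)
      then show ?thesis by (simp add: power_mult_distrib mult_ac)
    qed
    finally show ?thesis .
  qed
  have bfin: "ennreal ((M * norm v)\<^sup>2) * emeasure lborel (cball (0::'a) (\<rho> + norm v)) < \<infinity>"
    using emeasure_lborel_cball_finite[of "0::'a" "\<rho> + norm v"] by (simp add: ennreal_mult_less_top)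
  have pos: "e * (c\<^sup>2 / 4) > 0" using e c by simp
  obtain k0 where k0: "\<And>k. q k \<le> q k0 + ennreal (e * (c\<^sup>2 / 4))"
    using ennreal_bounded_seq_near_sup[of q, OF bound bfin pos] by blast
  show ?thesis
  proof (intro exI[of _ "Suc k0"] allI impI)
    fix l assume "l \<ge> Suc k0"
    then obtain k where k: "l = Suc k" "k \<ge> k0" by (metis Suc_le_D Suc_le_mono)
    let ?B = "{x. \<bar>u (x + (2/2^l) *\<^sub>R v) - 2 * u (x + (1/2^l) *\<^sub>R v) + u x\<bar> > c * (1/2^l)}"
    have B: "?B \<in> sets borel" by measurable
    have "q k0 + ennreal (4 ^ k) * P (h l) \<le> q k + ennreal (4 ^ k) * P (h l)"
      using inc[OF k(2)] by (rule add_right_mono)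
    also have "\<dots> \<le> q k0 + ennreal (e * (c\<^sup>2 / 4))"
      using step[of k] k0[of l] k by simp
    finally have "ennreal (4 ^ k) * P (h l) \<le> ennreal (e * (c\<^sup>2 / 4))"
      using le_less_trans[OF bound bfin, of k0] by (auto simp: ennreal_add_left_cancel_le)
    moreover have "ennreal ((c * r l)\<^sup>2) * emeasure lborel ?B \<le> P (h l)"
    proof -
      have "ennreal ((c * r l)\<^sup>2) * emeasure lborel ?B = (\<integral>\<^sup>+ x. ennreal ((c * r l)\<^sup>2) * indicator ?B x \<partial>lborel)"
        using B by (subst nn_integral_cmult_indicator) simp_all
      also have "\<dots> \<le> P (h l)"
        unfolding P_def
      proof (intro nn_integral_mono)
        fix x
        show "ennreal ((c * r l)\<^sup>2) * indicator ?B x \<le> ennreal ((u (x + 2 *\<^sub>R h l) - 2 * u (x + h l) + u x)\<^sup>2)"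
        proof (cases "x \<in> ?B")
          case True
          then have "c * r l \<le> \<bar>u (x + 2 *\<^sub>R h l) - 2 * u (x + h l) + u x\<bar>"
            by (simp add: h_def r_def)
          then have "(c * r l)\<^sup>2 \<le> (u (x + 2 *\<^sub>R h l) - 2 * u (x + h l) + u x)\<^sup>2"
            using power_mono[of "c * r l" "\<bar>u (x + 2 *\<^sub>R h l) - 2 * u (x + h l) + u x\<bar>" 2] c r[of l] by simp
          with True show ?thesis by (simp add: ennreal_leI)
        qed simp
      qed
      finally show ?thesis .
    qed
    ultimately have "ennreal (4 ^ k) * (ennreal ((c * r l)\<^sup>2) * emeasure lborel ?B) \<le> ennreal (e * (c\<^sup>2 / 4))"
      by (meson mult_left_mono order_trans zero_le)
    moreover have "ennreal (4 ^ k) * (ennreal ((c * r l)\<^sup>2) * emeasure lborel ?B) = ennreal (c\<^sup>2 / 4) * emeasure lborel ?B"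
    proof -
      have "(4::real) ^ k = (2 ^ k)\<^sup>2" by (simp add: power2_eq_square flip: power_mult_distrib)
      then have "4 ^ k * (c * r l)\<^sup>2 = c\<^sup>2 / 4"
        by (simp add: r_def k power_divide power_mult_distrib)
      then have "ennreal (4 ^ k) * ennreal ((c * r l)\<^sup>2) = ennreal (c\<^sup>2 / 4)"
        by (simp flip: ennreal_mult)
      then show ?thesis
        by (simp only: mult.assoc[symmetric])
    qed
    ultimately have "ennreal (c\<^sup>2 / 4) * emeasure lborel ?B \<le> ennreal (c\<^sup>2 / 4) * ennreal e"
      using e c by (simp add: mult.commute flip: ennreal_mult)
    then show "emeasure lborel ?B \<le> ennreal e"
      using c by (subst (asm) ennreal_mult_le_mult_iff) auto
  qed
qed

section \<open>Thin images at good points\<close>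

lemma grid_diff:
  assumes "x \<in> grid N R" "y \<in> grid N S"
  shows "x - y \<in> grid N (R + S)"
  unfolding grid_def
proof (intro CollectI ballI conjI)
  fix b :: 'a assume b: "b \<in> Basis"
  have "real N * (x \<bullet> b) \<in> \<int>" "real N * (y \<bullet> b) \<in> \<int>" "\<bar>x \<bullet> b\<bar> \<le> real R" "\<bar>y \<bullet> b\<bar> \<le> real S"
    using assms b by (simp_all add: grid_def)
  then show "real N * ((x - y) \<bullet> b) \<in> \<int>" "\<bar>(x - y) \<bullet> b\<bar> \<le> real (R + S)"
    by (simp_all add: inner_diff_left right_diff_distrib Ints_diff)
qed

lemma abs_inner_le_DIM:
  fixes a z :: "'a::euclidean_space"
  assumes "\<And>b. b \<in> Basis \<Longrightarrow> \<bar>a \<bullet> b\<bar> \<le> M" "\<And>b. b \<in> Basis \<Longrightarrow> \<bar>z \<bullet> b\<bar> \<le> s" "M \<ge> 0"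
  shows "\<bar>a \<bullet> z\<bar> \<le> real DIM('a) * (M * s)"
proof -
  have "\<bar>a \<bullet> z\<bar> = \<bar>\<Sum>b\<in>Basis. (a \<bullet> b) * (z \<bullet> b)\<bar>"
    by (subst euclidean_inner) simp
  also have "\<dots> \<le> (\<Sum>b\<in>Basis. \<bar>(a \<bullet> b) * (z \<bullet> b)\<bar>)" by (rule sum_abs)
  also have "\<dots> \<le> (\<Sum>b\<in>(Basis::'a set). M * s)"
    unfolding abs_mult using assms by (intro sum_mono mult_mono) auto
  finally show ?thesis by simp
qed

text \<open>Here \<open>x\<close> is a point at which, at the scale \<open>r\<close>, finitely many distance functions determine distances along
  the image and each of them is nearly affine, with gradient \<open>a i\<close>. Suppose that no direction is almost
  annihilated by all \<open>a i\<close>. Then the quadratic form \<open>\<Sum>i. (a i \<bullet> z)\<^sup>2\<close> is bounded below on the unit sphere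
  and dominates the errors, so that the sum \<open>G\<close> of the normalized distance functions times \<open>a i\<close> points
  outward, against the bound on the dimension. So there is a direction \<open>w\<close> along which \<open>f\<close> moves by
  \<open>O (r / N)\<close> only. Sliding along \<open>w\<close> brings every point of the ball to a hyperplane \<open>z \<bullet> i = 0\<close>, and the lattice
  points of that hyperplane yield the centres.\<close>

lemma thin_cover_at_good_point:
  fixes f :: "'a::euclidean_space \<Rightarrow> 'b::metric_space" and p :: "nat \<Rightarrow> 'b" and a :: "nat \<Rightarrow> 'a"
  assumes lip: "\<And>x y. dist (f x) (f y) \<le> M * norm (x - y)" and M: "M \<ge> 0"
    and ran: "range f \<subseteq> X" and dim: "ind_dim_le (top_of_set X) (int DIM('a) - 1)"
    and N: "N > 0" and r: "r > 0"
    and incr: "\<And>z v. z \<in> grid N 2 \<Longrightarrow> v \<in> grid N 6 \<Longrightarrow> \<exists>i<J. dist (f (x + r *\<^sub>R z)) (f (x + r *\<^sub>R (z + v)))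
        \<le> \<bar>dist (p i) (f (x + r *\<^sub>R (z + v))) - dist (p i) (f (x + r *\<^sub>R z))\<bar> + r / real N"
    and aM: "\<And>i b. i < J \<Longrightarrow> b \<in> Basis \<Longrightarrow> \<bar>a i \<bullet> b\<bar> \<le> M"
    and aff: "\<And>i z. i < J \<Longrightarrow> (\<And>b. b \<in> Basis \<Longrightarrow> \<bar>z \<bullet> b\<bar> \<le> 4) \<Longrightarrow>
        \<bar>dist (p i) (f (x + r *\<^sub>R z)) - dist (p i) (f x) - r * (a i \<bullet> z)\<bar> \<le> r * \<eta>"
    and \<eta>: "\<eta> \<le> 1 / real N" and \<eta>': "real J * (\<eta> * (real DIM('a) * M)) < 1 / (real N * real DIM('a))\<^sup>2"
  shows "\<exists>P. finite P \<and> card P \<le> (8 * N + 1) ^ (DIM('a) - 1) \<and>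
    f ` cball x (2 * r) \<subseteq> (\<Union>q\<in>P. cball q ((5 + 3 * real DIM('a) * M) * (r / real N)))"
proof -
  define n where "n = real DIM('a)"
  have n: "n \<ge> 1" by (simp add: n_def Suc_leI)
  have box1: "\<bar>z \<bullet> b\<bar> \<le> s" if "norm z \<le> s" "b \<in> Basis" for z b :: 'a and s
    using Basis_le_norm[OF that(2), of z] that(1) by simp
  have "\<exists>i\<in>Basis. \<exists>w. w \<bullet> i = 1 \<and> (\<forall>b\<in>Basis. \<bar>w \<bullet> b\<bar> \<le> 1) \<and> (\<forall>j<J. \<bar>a j \<bullet> w\<bar> \<le> 1 / real N)"
  proof (rule ccontr)
    assume neg: "\<not> ?thesis"
    \<comment> \<open>In the coordinate \<open>z = (y - x) / r\<close> the map \<open>G \<circ> F\<close> is nearly the linear map \<open>z \<mapsto> \<Sum>j. (a j \<bullet> z) a j\<close>.\<close>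
    define G where "G y = (\<Sum>j<J. ((dist (p j) y - dist (p j) (f x)) / r) *\<^sub>R a j)" for y
    define F where "F z = f (x + r *\<^sub>R z)" for z
    have pos: "G (F z) \<bullet> z > 0" if z: "norm z = 1" for z
    proof -
      have zb: "\<bar>z \<bullet> b\<bar> \<le> 1" if "b \<in> Basis" for b using box1[of z 1 b] z that by simp
      obtain i where i: "i \<in> Basis" "\<And>b. b \<in> Basis \<Longrightarrow> \<bar>z \<bullet> b\<bar> \<le> \<bar>z \<bullet> i\<bar>"
      proof -
        have "Max ((\<lambda>b. \<bar>z \<bullet> b\<bar>) ` Basis) \<in> (\<lambda>b. \<bar>z \<bullet> b\<bar>) ` Basis" by (intro Max_in) auto
        then obtain i where "Max ((\<lambda>b. \<bar>z \<bullet> b\<bar>) ` Basis) = \<bar>z \<bullet> i\<bar>" "i \<in> Basis"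
          by (rule imageE)
        then show ?thesis using that[of i] Max_ge[of "(\<lambda>b. \<bar>z \<bullet> b\<bar>) ` Basis"] by simp
      qed
      have "1 \<le> (\<Sum>b\<in>Basis. \<bar>z \<bullet> b\<bar>)" using norm_le_l1[of z] z by simp
      also have "\<dots> \<le> (\<Sum>b\<in>(Basis::'a set). \<bar>z \<bullet> i\<bar>)" by (intro sum_mono i(2))
      finally have zi: "1 \<le> n * \<bar>z \<bullet> i\<bar>" by (simp add: n_def)
      then have zi0: "\<bar>z \<bullet> i\<bar> > 0" by (cases "z \<bullet> i = 0") auto
      \<comment> \<open>Scaling by the largest coordinate gives an admissible direction.\<close>
      define w where "w = (1 / (z \<bullet> i)) *\<^sub>R z"
      have "w \<bullet> i = 1" using zi0 by (simp add: w_def)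
      moreover have "\<forall>b\<in>Basis. \<bar>w \<bullet> b\<bar> \<le> 1"
        using i(2) zi0 by (simp add: w_def abs_mult divide_le_eq)
      ultimately obtain j where j: "j < J" "1 / real N < \<bar>a j \<bullet> w\<bar>"
        using neg i(1) by (meson not_le)
      have "\<bar>a j \<bullet> z\<bar> = \<bar>a j \<bullet> w\<bar> * \<bar>z \<bullet> i\<bar>" using zi0 by (simp add: w_def abs_mult)
      also have "\<dots> \<ge> 1 / real N * \<bar>z \<bullet> i\<bar>" using j(2) by (intro mult_right_mono) auto
      finally have "1 / real N * \<bar>z \<bullet> i\<bar> \<le> \<bar>a j \<bullet> z\<bar>" .
      moreover have "1 / (real N * n) \<le> 1 / real N * \<bar>z \<bullet> i\<bar>"
        using zi n N by (simp add: field_simps)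
      ultimately have "1 / (real N * n) \<le> \<bar>a j \<bullet> z\<bar>" by linarith
      then have "(1 / (real N * n))\<^sup>2 \<le> \<bar>a j \<bullet> z\<bar>\<^sup>2"
        using n by (intro power_mono) auto
      then have "1 / (real N * n)\<^sup>2 \<le> (a j \<bullet> z)\<^sup>2"
        by (simp add: power_divide)
      also have "\<dots> \<le> (\<Sum>j<J. (a j \<bullet> z)\<^sup>2)"
        using j(1) by (intro member_le_sum) auto
      finally have big: "1 / (real N * n)\<^sup>2 \<le> (\<Sum>j<J. (a j \<bullet> z)\<^sup>2)" .
      define \<psi> where "\<psi> j = (dist (p j) (F z) - dist (p j) (f x)) / r" for j
      have tm: "(a j \<bullet> z)\<^sup>2 - \<eta> * (n * M) \<le> \<psi> j * (a j \<bullet> z)" if "j < J" for j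
      proof -
        have "\<bar>z \<bullet> b\<bar> \<le> 4" if "b \<in> Basis" for b using zb[OF that] by linarith
        note aff[OF \<open>j < J\<close> this]
        moreover have "r * (\<psi> j - a j \<bullet> z) = dist (p j) (F z) - dist (p j) (f x) - r * (a j \<bullet> z)"
          using r by (simp add: \<psi>_def diff_divide_distrib right_diff_distrib)
        ultimately have "\<bar>r * (\<psi> j - a j \<bullet> z)\<bar> \<le> r * \<eta>"
          by (simp add: F_def)
        then have "\<bar>\<psi> j - a j \<bullet> z\<bar> \<le> \<eta>" using r by (simp add: abs_mult)
        moreover have "\<bar>a j \<bullet> z\<bar> \<le> n * M"
          using abs_inner_le_DIM[of "a j" M z 1] aM[OF that] zb M by (simp add: n_def)
        ultimately have "\<bar>\<psi> j - a j \<bullet> z\<bar> * \<bar>a j \<bullet> z\<bar> \<le> \<eta> * (n * M)"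
          by (intro mult_mono) auto
        then have "- ((\<psi> j - a j \<bullet> z) * (a j \<bullet> z)) \<le> \<eta> * (n * M)"
          by (simp add: abs_mult[symmetric])
        then show ?thesis by (simp add: algebra_simps power2_eq_square)
      qed
      have "0 < (\<Sum>j<J. (a j \<bullet> z)\<^sup>2) - real J * (\<eta> * (n * M))"
        using big \<eta>' by (simp add: n_def)
      also have "\<dots> = (\<Sum>j<J. (a j \<bullet> z)\<^sup>2 - \<eta> * (n * M))"
        by (simp add: sum_subtractf)
      also have "\<dots> \<le> (\<Sum>j<J. \<psi> j * (a j \<bullet> z))"
        using tm by (intro sum_mono) auto
      also have "\<dots> = G (F z) \<bullet> z"
        by (simp add: G_def \<psi>_def inner_sum_left)
      finally show ?thesis .
    qed
    have "M-lipschitz_on UNIV f"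
      using lip M by (intro lipschitz_onI) (simp_all add: dist_norm)
    then have cf: "continuous_on UNIV f" by (rule lipschitz_on_continuous_on)
    have cF: "continuous_on (cball 0 1) F"
      unfolding F_def by (intro continuous_on_compose2[OF cf] continuous_intros) auto
    have cG: "continuous_on (F ` cball 0 1) G"
      unfolding G_def using r by (intro continuous_intros) auto
    have "\<not> ind_dim_le (top_of_set (F ` cball 0 1)) (int DIM('a) - 1)"
      by (rule not_ind_dim_le_if_outward[OF cF cG pos])
    moreover have "F ` cball 0 1 \<subseteq> X" using ran by (auto simp: F_def)
    ultimately show False using ind_dim_le_subset[OF dim] by blast
  qed
  then obtain i w where i: "i \<in> Basis" and w: "w \<bullet> i = 1" "\<And>b. b \<in> Basis \<Longrightarrow> \<bar>w \<bullet> b\<bar> \<le> 1"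
    "\<And>j. j < J \<Longrightarrow> \<bar>a j \<bullet> w\<bar> \<le> 1 / real N"
    by blast
  \<comment> \<open>Lattice points of the hyperplane orthogonal to \<open>i\<close>, in the form that \<open>grid_slice_card\<close> counts.\<close>
  define Q where "Q = {z \<in> grid N 4. \<forall>b\<in>Basis - (Basis - {i}). z \<bullet> b = 0}"
  have Q: "finite Q" "card Q \<le> (8 * N + 1) ^ (DIM('a) - 1)"
    using grid_slice_card[OF N, of "Basis - {i}" 4] i by (simp_all add: Q_def mult_ac)
  define P where "P = (\<lambda>q. f (x + r *\<^sub>R q)) ` Q"
  have "finite P" "card P \<le> (8 * N + 1) ^ (DIM('a) - 1)"
    using Q card_image_le[OF Q(1), of "\<lambda>q. f (x + r *\<^sub>R q)"] by (simp_all add: P_def)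
  moreover have "f ` cball x (2 * r) \<subseteq> (\<Union>q\<in>P. cball q ((5 + 3 * real DIM('a) * M) * (r / real N)))"
  proof (rule image_subsetI)
    fix y assume y: "y \<in> cball x (2 * r)"
    define z where "z = (1 / r) *\<^sub>R (y - x)"
    have yz: "y = x + r *\<^sub>R z" using r by (simp add: z_def)
    have "norm z \<le> 2" using y r by (simp add: z_def dist_norm norm_minus_commute divide_le_eq)
    then have zb: "\<bar>z \<bullet> b\<bar> \<le> 2" if "b \<in> Basis" for b using box1 that by blast
    \<comment> \<open>The parameter at which the line through \<open>z\<close> in direction \<open>w\<close> meets the hyperplane.\<close>
    define t where "t = - (z \<bullet> i)"
    have t: "\<bar>t\<bar> \<le> 2" using zb[OF i] by (simp add: t_def)
    define s where "s = z + t *\<^sub>R w"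
    have si: "s \<bullet> i = 0" using w(1) by (simp add: s_def t_def inner_add_left inner_diff_left)
    have sb: "\<bar>s \<bullet> b\<bar> \<le> 4" if "b \<in> Basis" for b
    proof -
      have "\<bar>t * (w \<bullet> b)\<bar> \<le> 2 * 1" unfolding abs_mult using t w(2)[OF that] by (intro mult_mono) auto
      then show ?thesis using zb[OF that] by (simp add: s_def inner_add_left)
    qed
    define q where "q = round_grid N z"
    define q' where "q' = round_grid N s"
    have q: "q \<in> grid N 2" unfolding q_def using zb by (intro round_grid_in_grid N) auto
    have q': "q' \<in> grid N 4" unfolding q'_def using sb by (intro round_grid_in_grid N) auto
    have "q' \<bullet> i = 0" using i by (simp add: q'_def round_grid_inner si)
    then have "q' \<in> Q" using q' i by (auto simp: Q_def)
    have "q' - q \<in> grid N (4 + 2)" by (rule grid_diff[OF q' q])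
    then have v: "q' - q \<in> grid N 6" by simp
    obtain j where j: "j < J" and dj: "dist (f (x + r *\<^sub>R q)) (f (x + r *\<^sub>R q'))
        \<le> \<bar>dist (p j) (f (x + r *\<^sub>R q')) - dist (p j) (f (x + r *\<^sub>R q))\<bar> + r / real N"
      using incr[OF q v] by auto
    have box: "\<bar>u \<bullet> b\<bar> \<le> 4" if "u \<in> grid N R" "R \<le> 4" "b \<in> Basis" for u b R
    proof -
      have "\<bar>u \<bullet> b\<bar> \<le> real R" using that by (simp add: grid_def)
      then show ?thesis using that(2) by linarith
    qed
    have "\<bar>a j \<bullet> (q' - q)\<bar> \<le> 2 / real N + 2 * n * M / real N"
    proof -
      have "q' - q = t *\<^sub>R w + (z - q) - (s - q')" by (simp add: s_def)
      then have "a j \<bullet> (q' - q) = a j \<bullet> (t *\<^sub>R w + (z - q) - (s - q'))" by (rule arg_cong)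
      also have "\<dots> = t * (a j \<bullet> w) + a j \<bullet> (z - q) - a j \<bullet> (s - q')"
        by (simp only: inner_add_right inner_diff_right inner_scaleR_right)
      finally have split: "a j \<bullet> (q' - q) = t * (a j \<bullet> w) + a j \<bullet> (z - q) - a j \<bullet> (s - q')" .
      have tri: "\<bar>\<alpha> + \<beta> - \<gamma>\<bar> \<le> \<alpha>' + \<beta>' + \<gamma>'" if "\<bar>\<alpha>\<bar> \<le> \<alpha>'" "\<bar>\<beta>\<bar> \<le> \<beta>'" "\<bar>\<gamma>\<bar> \<le> \<gamma>'"
        for \<alpha> \<beta> \<gamma> \<alpha>' \<beta>' \<gamma>' :: real
        using that by linarith
      have "\<bar>t * (a j \<bullet> w)\<bar> \<le> 2 * (1 / real N)"
        unfolding abs_mult using t w(3)[OF j] by (intro mult_mono) auto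
      moreover have "\<bar>a j \<bullet> (z - q)\<bar> \<le> n * (M * (1 / real N))"
        unfolding n_def q_def by (intro abs_inner_le_DIM aM j M round_grid_inner_diff N)
      moreover have "\<bar>a j \<bullet> (s - q')\<bar> \<le> n * (M * (1 / real N))"
        unfolding n_def q'_def by (intro abs_inner_le_DIM aM j M round_grid_inner_diff N)
      ultimately have "\<bar>a j \<bullet> (q' - q)\<bar> \<le> 2 * (1 / real N) + n * (M * (1 / real N)) + n * (M * (1 / real N))"
        unfolding split by (rule tri)
      then show ?thesis by (simp add: field_simps)
    qed
    then have main: "r * \<bar>a j \<bullet> (q' - q)\<bar> \<le> r * (2 / real N + 2 * n * M / real N)"
      using r by (intro mult_left_mono) auto
    have 1: "\<bar>dist (p j) (f (x + r *\<^sub>R q')) - dist (p j) (f x) - r * (a j \<bullet> q')\<bar> \<le> r * (1 / real N)"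
      using order_trans[OF aff[OF j box[OF q' order_refl]] mult_left_mono[OF \<eta>, of r]] r by simp
    have 2: "\<bar>dist (p j) (f (x + r *\<^sub>R q)) - dist (p j) (f x) - r * (a j \<bullet> q)\<bar> \<le> r * (1 / real N)"
      using order_trans[OF aff[OF j box[OF q]] mult_left_mono[OF \<eta>, of r]] r by simp
    have 3: "\<bar>dist (p j) (f (x + r *\<^sub>R q')) - dist (p j) (f (x + r *\<^sub>R q))\<bar>
        \<le> r * \<bar>a j \<bullet> (q' - q)\<bar> + 2 * (r * (1 / real N))"
    proof -
      have "r * \<bar>a j \<bullet> (q' - q)\<bar> = \<bar>r * (a j \<bullet> q') - r * (a j \<bullet> q)\<bar>"
        using r by (simp add: inner_diff_right abs_mult flip: right_diff_distrib)
      then show ?thesis using 1 2 by linarith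
    qed
    have 4: "dist (f y) (f (x + r *\<^sub>R q)) \<le> n * M * (r / real N)"
    proof -
      have "dist (f y) (f (x + r *\<^sub>R q)) \<le> M * norm (r *\<^sub>R (z - q))"
        using lip[of y "x + r *\<^sub>R q"] by (simp add: yz scaleR_diff_right)
      also have "\<dots> = M * (r * norm (z - q))" using r by simp
      also have "\<dots> \<le> M * (r * (n / real N))"
        unfolding n_def q_def using r by (intro mult_left_mono norm_round_grid_diff N M) auto
      finally show ?thesis by (simp add: field_simps)
    qed
    have "dist (f y) (f (x + r *\<^sub>R q')) \<le> dist (f y) (f (x + r *\<^sub>R q)) + dist (f (x + r *\<^sub>R q)) (f (x + r *\<^sub>R q'))"
      by (rule dist_triangle)
    also have "\<dots> \<le> n * M * (r / real N) + (r * (2 / real N + 2 * n * M / real N) + 2 * (r * (1 / real N)) + r / real N)"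
      using dj 3 4 main by linarith
    also have "\<dots> = (5 + 3 * n * M) * (r / real N)" using N by (simp add: field_simps)
    finally have "f y \<in> cball (f (x + r *\<^sub>R q')) ((5 + 3 * n * M) * (r / real N))"
      by (simp add: dist_commute)
    with \<open>q' \<in> Q\<close> show "f y \<in> (\<Union>q\<in>P. cball q ((5 + 3 * real DIM('a) * M) * (r / real N)))"
      unfolding P_def n_def by blast
  qed
  ultimately show ?thesis by blast
qed

lemma borel_measurable_if_lipschitz:
  fixes u :: "'a::euclidean_space \<Rightarrow> real"
  assumes "\<And>x y. \<bar>u x - u y\<bar> \<le> M * norm (x - y)" "M \<ge> 0"
  shows "u \<in> borel_measurable borel"
proof -
  have "M-lipschitz_on UNIV u"
    using assms by (intro lipschitz_onI) (auto simp: dist_norm)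
  then show ?thesis
    by (intro borel_measurable_continuous_onI lipschitz_on_continuous_on)
qed

lemma emeasure_UN_translates_le:
  fixes B :: "'i \<Rightarrow> 'a::euclidean_space set"
  assumes "finite I" "\<And>i. i \<in> I \<Longrightarrow> B i \<in> sets borel" "\<And>i. i \<in> I \<Longrightarrow> emeasure lborel (B i) \<le> ennreal e"
    "real (card I) * e \<le> e'" "e \<ge> 0"
  shows "(\<Union>i\<in>I. {x. x + h i \<in> B i}) \<in> sets borel"
    and "emeasure lborel (\<Union>i\<in>I. {x. x + h i \<in> B i}) \<le> ennreal e'"
proof -
  have m: "{x. x + h i \<in> B i} \<in> sets borel" if "i \<in> I" for i
  proof -
    note [measurable] = assms(2)[OF that]
    show ?thesis by measurable
  qed
  show "(\<Union>i\<in>I. {x. x + h i \<in> B i}) \<in> sets borel"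
    using m assms(1) by (intro sets.finite_UN) auto
  have "emeasure lborel (\<Union>i\<in>I. {x. x + h i \<in> B i}) \<le> (\<Sum>i\<in>I. emeasure lborel {x. x + h i \<in> B i})"
    using m assms(1) by (intro emeasure_subadditive_finite) auto
  also have "\<dots> = (\<Sum>i\<in>I. emeasure lborel (B i))"
    using assms(2) by (intro sum.cong refl emeasure_lborel_translate)
  also have "\<dots> \<le> (\<Sum>i\<in>I. ennreal e)"
    using assms(3) by (intro sum_mono)
  also have "\<dots> = ennreal (real (card I) * e)"
    using assms(5) by (simp add: ennreal_mult ennreal_of_nat_eq_real_of_nat)
  also have "\<dots> \<le> ennreal e'" using assms(4) by (rule ennreal_leI)
  finally show "emeasure lborel (\<Union>i\<in>I. {x. x + h i \<in> B i}) \<le> ennreal e'" .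
qed

text \<open>The integrals over the whole space must be finite, so the distances to a dense sequence \<open>p\<close> in the image
  of a large ball are multiplied by a cutoff function. Within radius \<open>\<rho>\<close> the products are still distance
  functions, and by density their increments determine the distances between image points.\<close>

lemma cutoff_distances:
  fixes f :: "'a::euclidean_space \<Rightarrow> 'b::metric_space"
  assumes lip: "\<And>x y. dist (f x) (f y) \<le> L * norm (x - y)" and L: "L \<ge> 0" and \<rho>: "\<rho> > 0"
  obtains p :: "nat \<Rightarrow> 'b" and w :: "nat \<Rightarrow> 'a \<Rightarrow> real" and M where
    "M \<ge> L" "\<And>j x y. \<bar>w j x - w j y\<bar> \<le> M * norm (x - y)"
    "\<And>j x. norm x > \<rho> + 1 \<Longrightarrow> w j x = 0"
    "\<And>j x. norm x \<le> \<rho> \<Longrightarrow> w j x = dist (p j) (f x)"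
    "\<And>x y c. norm x \<le> \<rho> \<Longrightarrow> norm y \<le> \<rho> \<Longrightarrow> (\<And>j. \<bar>w j x - w j y\<bar> \<le> c) \<Longrightarrow> dist (f x) (f y) \<le> c"
proof -
  define R where "R = \<rho> + 1"
  have R: "R > 0" using \<rho> by (simp add: R_def)
  obtain T :: "'a set" where T: "countable T" "T \<subseteq> cball 0 R" "cball 0 R \<subseteq> closure T"
    using separable by blast
  have "T \<noteq> {}" using T(3) R by auto
  define p where "p j = f (from_nat_into T j)" for j
  have pT: "from_nat_into T j \<in> cball 0 R" for j
    using from_nat_into[OF \<open>T \<noteq> {}\<close>, of j] T(2) by blast
  define \<phi> where "\<phi> x = max 0 (min 1 (R - norm x))" for x :: 'a
  have \<phi>: "0 \<le> \<phi> x" "\<phi> x \<le> 1" "\<bar>\<phi> x - \<phi> y\<bar> \<le> norm (x - y)" for x y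
    using norm_triangle_ineq3[of x y] norm_ge_zero[of "x - y"] unfolding \<phi>_def by linarith+
  have \<phi>0: "\<phi> x = 0" if "norm x \<ge> R" for x using that by (simp add: \<phi>_def)
  have \<phi>1: "\<phi> x = 1" if "norm x \<le> \<rho>" for x using that by (simp add: \<phi>_def R_def)
  define w where "w j x = \<phi> x * dist (p j) (f x)" for j x
  define M where "M = 2 * L * R + L"
  have M: "M \<ge> L" "M \<ge> 0" using L R by (simp_all add: M_def)
  have near: "\<bar>w j x - w j y\<bar> \<le> M * norm (x - y)" if x: "norm x \<le> R" for j x y
  proof -
    have d: "dist (p j) (f x) \<le> 2 * L * R"
    proof -
      have "dist (p j) (f x) \<le> L * norm (from_nat_into T j - x)" unfolding p_def by (rule lip)
      also have "\<dots> \<le> L * (R + R)"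
        using pT[of j] x L norm_triangle_ineq4[of "from_nat_into T j" x] by (intro mult_left_mono) auto
      finally show ?thesis by simp
    qed
    have dd: "\<bar>dist (p j) (f x) - dist (p j) (f y)\<bar> \<le> L * norm (x - y)"
    proof -
      have "\<bar>dist (p j) (f x) - dist (p j) (f y)\<bar> \<le> dist (f x) (f y)"
        using dist_triangle[of "p j" "f x" "f y"] dist_triangle[of "p j" "f y" "f x"]
        by (simp add: dist_commute abs_le_iff)
      then show ?thesis using lip[of x y] by linarith
    qed
    have "w j x - w j y = (\<phi> x - \<phi> y) * dist (p j) (f x) + \<phi> y * (dist (p j) (f x) - dist (p j) (f y))"
      by (simp add: w_def algebra_simps)
    then have "\<bar>w j x - w j y\<bar> \<le> \<bar>\<phi> x - \<phi> y\<bar> * dist (p j) (f x) + \<phi> y * \<bar>dist (p j) (f x) - dist (p j) (f y)\<bar>"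
      using abs_triangle_ineq[of "(\<phi> x - \<phi> y) * dist (p j) (f x)" "\<phi> y * (dist (p j) (f x) - dist (p j) (f y))"] \<phi>(1)[of y]
      by (simp add: abs_mult)
    also have "\<dots> \<le> norm (x - y) * (2 * L * R) + 1 * (L * norm (x - y))"
      using \<phi> d dd L by (intro add_mono mult_mono) auto
    also have "\<dots> = M * norm (x - y)" by (simp add: M_def algebra_simps)
    finally show ?thesis .
  qed
  show ?thesis
  proof (rule that[of M w p])
    show "M \<ge> L" by (rule M)
    show "\<bar>w j x - w j y\<bar> \<le> M * norm (x - y)" for j x y
    proof (cases "norm x \<le> R")
      case True
      then show ?thesis by (rule near)
    next
      case x: False
      show ?thesis
      proof (cases "norm y \<le> R")
        case True
        then show ?thesis using near[of y j x] by (simp add: norm_minus_commute abs_minus_commute)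
      next
        case False
        then show ?thesis using x M by (simp add: w_def \<phi>0)
      qed
    qed
    show "w j x = 0" if "norm x > \<rho> + 1" for j x using that by (simp add: w_def \<phi>0 R_def)
    show "w j x = dist (p j) (f x)" if "norm x \<le> \<rho>" for j x using that by (simp add: w_def \<phi>1)
    show "dist (f x) (f y) \<le> c" if x: "norm x \<le> \<rho>" and y: "norm y \<le> \<rho>" and c: "\<And>j. \<bar>w j x - w j y\<bar> \<le> c" for x y c
    proof (rule field_le_epsilon)
      fix e :: real assume "e > 0"
      define d where "d = e / (2 * (L + 1))"
      have "d > 0" using \<open>e > 0\<close> L by (simp add: d_def)
      have "x \<in> closure T" using T(3) x by (auto simp: R_def)
      then obtain t where t: "t \<in> T" "dist t x < d" using \<open>d > 0\<close> by (auto simp: closure_approachable)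
      obtain j where "from_nat_into T j = t" using T(1) t(1) from_nat_into_surj by metis
      then have pj: "p j = f t" by (simp add: p_def)
      have small: "dist (p j) (f x) \<le> e / 2"
      proof -
        have "dist (p j) (f x) \<le> L * d" unfolding pj
          using lip[of t x] mult_left_mono[of "norm (t - x)" d L] t(2) L by (simp add: dist_norm)
        also have "\<dots> \<le> (L + 1) * d" using \<open>d > 0\<close> by simp
        also have "\<dots> = e / 2"
        proof -
          have "K * (e / (2 * K)) = e / 2" if "K \<noteq> 0" for K :: real using that by simp
          moreover have "L + 1 \<noteq> 0" using L by linarith
          ultimately show ?thesis unfolding d_def by blast
        qed
        finally show ?thesis .
      qed
      have "\<bar>dist (p j) (f x) - dist (p j) (f y)\<bar> \<le> c"
        using c[of j] x y by (simp add: w_def \<phi>1)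
      then have "dist (p j) (f y) \<le> c + e / 2" using small by linarith
      moreover have "dist (f x) (f y) \<le> dist (p j) (f x) + dist (p j) (f y)"
        using dist_triangle[of "f x" "f y" "p j"] by (simp add: dist_commute)
      ultimately show "dist (f x) (f y) \<le> c + e" using small by linarith
    qed
  qed
qed


text \<open>The centre of a second increment that starts at \<open>x + r y\<close> and ends at \<open>x + r z\<close>.\<close>

lemma midpoint_increment:
  fixes x y z :: "'a::euclidean_space"
  shows "x + r *\<^sub>R y + r *\<^sub>R ((1/2) *\<^sub>R (z - y)) = x + r *\<^sub>R ((1/2) *\<^sub>R (y + z))"
proof (rule euclidean_eqI)
  fix b :: 'a assume "b \<in> Basis"
  have "(x + r *\<^sub>R y + r *\<^sub>R ((1/2) *\<^sub>R (z - y))) \<bullet> b = x \<bullet> b + r * (y \<bullet> b) + r * ((1/2) * (z \<bullet> b - y \<bullet> b))"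
    by (simp only: inner_add_left inner_scaleR_left inner_diff_left)
  also have "\<dots> = x \<bullet> b + r * ((1/2) * (y \<bullet> b + z \<bullet> b))" by (simp add: algebra_simps)
  also have "\<dots> = (x + r *\<^sub>R ((1/2) *\<^sub>R (y + z))) \<bullet> b"
    by (simp only: inner_add_left inner_scaleR_left inner_diff_left)
  finally show "(x + r *\<^sub>R y + r *\<^sub>R ((1/2) *\<^sub>R (z - y))) \<bullet> b = (x + r *\<^sub>R ((1/2) *\<^sub>R (y + z))) \<bullet> b" .
qed

text \<open>The parameters are chosen in the order \<open>N\<close>, \<open>J\<close>, \<open>\<eta>'\<close>, \<open>N'\<close>, \<open>\<eta>\<close>. The number \<open>J\<close> of distance functions
  depends on \<open>N\<close> and \<open>e\<close> only. The precision \<open>\<eta>'\<close> of their affine approximations has to be small relative to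
  \<open>J\<close>, and the finer lattice of mesh \<open>1 / N'\<close> and the bound \<open>\<eta>\<close> on second increments are those that
  \<open>almost_affine\<close> requires for \<open>\<eta>'\<close>. The constant \<open>C\<close> is chosen before
  \<open>N\<close>, so that the Hausdorff sums become small as \<open>N\<close> grows.\<close>

lemma good_points_thin_cover:
  fixes f :: "'a::euclidean_space \<Rightarrow> 'b::metric_space"
  assumes lip: "\<And>x y. dist (f x) (f y) \<le> L * norm (x - y)" and L: "L \<ge> 0" and \<rho>: "\<rho> > 0"
    and ran: "range f \<subseteq> X" and dim: "ind_dim_le (top_of_set X) (int DIM('a) - 1)"
  obtains C where "C \<ge> 0" "\<And>N e. N > 0 \<Longrightarrow> e > 0 \<Longrightarrow> \<exists>k0. \<forall>k\<ge>k0. \<exists>B. B \<in> sets borel \<and>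
    emeasure lborel B \<le> ennreal e \<and> (\<forall>x. norm x \<le> \<rho> \<longrightarrow> x \<notin> B \<longrightarrow>
      (\<exists>P. finite P \<and> card P \<le> (8 * N + 1) ^ (DIM('a) - 1) \<and>
        f ` cball x (2 * (1 / 2 ^ k)) \<subseteq> (\<Union>q\<in>P. cball q (C * (1 / 2 ^ k / real N)))))"
proof -
  define n where "n = real DIM('a)"
  have n: "n \<ge> 1" by (simp add: n_def Suc_leI)
  have "\<rho> + 1 > 0" using \<rho> by simp
  from cutoff_distances[OF lip L this]
  obtain p :: "nat \<Rightarrow> 'b" and w :: "nat \<Rightarrow> 'a \<Rightarrow> real" and M where M: "M \<ge> L"
    and wlip: "\<And>j x y. \<bar>w j x - w j y\<bar> \<le> M * norm (x - y)"
    and supp: "\<And>j x. norm x > \<rho> + 1 + 1 \<Longrightarrow> w j x = 0"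
    and wd: "\<And>j x. norm x \<le> \<rho> + 1 \<Longrightarrow> w j x = dist (p j) (f x)"
    and sup: "\<And>x y c. norm x \<le> \<rho> + 1 \<Longrightarrow> norm y \<le> \<rho> + 1 \<Longrightarrow> (\<And>j. \<bar>w j x - w j y\<bar> \<le> c) \<Longrightarrow> dist (f x) (f y) \<le> c"
    by metis
  have M0: "M \<ge> 0" using M L by linarith
  have [measurable]: "w j \<in> borel_measurable borel" for j
    using wlip M0 by (rule borel_measurable_if_lipschitz)
  have flip: "dist (f x) (f y) \<le> M * norm (x - y)" for x y
    using order_trans[OF lip[of x y] mult_right_mono[OF M norm_ge_zero]] .
  show ?thesis
  proof (rule that[of "5 + 3 * n * M"])
    show "5 + 3 * n * M \<ge> 0" using M0 n by simp
    fix N :: nat and e :: real assume N: "N > 0" and e: "e > 0"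
    \<comment> \<open>Base points within \<open>2\<close> and end points within \<open>4\<close> of the centre differ by vectors in \<open>V\<close>.\<close>
    define V where "V = (grid N 6 :: 'a set)"
    define Z where "Z = (grid N 2 :: 'a set)"
    have fin: "finite V" "finite Z" using N by (simp_all add: V_def Z_def finite_grid)
    define B1 where "B1 J k v = {x. \<exists>j. \<forall>i<J. \<bar>w j (x + (1/2^k) *\<^sub>R v) - w j x\<bar>
        > \<bar>w i (x + (1/2^k) *\<^sub>R v) - w i x\<bar> + (1 / real N) * (1/2^k)}" for J :: nat and k :: nat and v
    have B1m: "B1 J k v \<in> sets borel" for J k v unfolding B1_def by measurable
    define e1 where "e1 = e / (2 * (real (card (Z \<times> V)) + 1))"
    have e1: "e1 > 0" "real (card (Z \<times> V)) * e1 \<le> e / 2"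
      using e by (simp_all add: e1_def field_simps)
    have "\<exists>J k0. \<forall>k\<ge>k0. \<forall>J'\<ge>J. emeasure lborel (B1 J' k v) \<le> ennreal e1" for v
    proof -
      have "1 / real N > 0" using N by simp
      from sup_increment_attained_by_finite[OF wlip M0 supp e1(1) this, where v = v]
      show ?thesis unfolding B1_def by simp
    qed
    then obtain Jf kf where Jf: "\<And>v k J'. k \<ge> kf v \<Longrightarrow> J' \<ge> Jf v \<Longrightarrow> emeasure lborel (B1 J' k v) \<le> ennreal e1"
      by metis
    define J where "J = (\<Sum>v\<in>V. Jf v)"
    have J: "Jf v \<le> J" if "v \<in> V" for v
      unfolding J_def using fin that by (intro member_le_sum) auto
    define k1 where "k1 = (\<Sum>v\<in>V. kf v)"
    have k1: "kf v \<le> k1" if "v \<in> V" for v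
      unfolding k1_def using fin that by (intro member_le_sum) auto
    \<comment> \<open>The second bound makes the total error of the \<open>J\<close> affine approximations smaller than the quadratic form.\<close>
    define \<eta>' where "\<eta>' = min (1 / real N) (1 / (2 * (real J * n * M + 1) * (real N * n)\<^sup>2))"
    have JnM: "real J * n * M \<ge> 0" using M0 n by simp
    have \<eta>': "\<eta>' > 0" "\<eta>' \<le> 1 / real N"
      using N n JnM by (simp_all add: \<eta>'_def add_nonneg_pos)
    have \<eta>'2: "real J * (\<eta>' * (n * M)) < 1 / (real N * n)\<^sup>2"
    proof -
      have Nn: "(real N * n)\<^sup>2 > 0" using N n by simp
      have "real J * (\<eta>' * (n * M)) = (real J * n * M) * \<eta>'" by simp
      also have "\<dots> \<le> (real J * n * M) * (1 / (2 * (real J * n * M + 1) * (real N * n)\<^sup>2))"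
        using JnM by (intro mult_left_mono) (simp_all add: \<eta>'_def)
      also have "\<dots> < 1 / (real N * n)\<^sup>2"
      proof -
        have "K * (1 / (2 * (K + 1) * S)) < 1 / S" if "K \<ge> 0" "S > 0" for K S :: real
        proof -
          have "K / (2 * (K + 1)) < 1" using that by (subst divide_less_eq) auto
          then have "K / (2 * (K + 1)) / S < 1 / S" using that by (intro divide_strict_right_mono)
          then show ?thesis by simp
        qed
        then show ?thesis using JnM Nn by blast
      qed
      finally show ?thesis .
    qed
    obtain N' :: nat where N': "N' > 0" "4 * M * n / real N' \<le> \<eta>'"
    proof -
      obtain N' :: nat where "real N' > 4 * M * n / \<eta>' + 1" using reals_Archimedean2 by blast
      moreover have "4 * M * n / \<eta>' \<ge> 0" using M0 n \<eta>'(1) by simp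
      ultimately have N'0: "real N' > 0" and "4 * M * n / \<eta>' \<le> real N'" by linarith+
      then have "4 * M * n \<le> real N' * \<eta>'" using \<eta>'(1) by (simp add: divide_le_eq)
      then have "4 * M * n / real N' \<le> \<eta>'" using N'0 by (simp add: divide_le_eq mult.commute)
      then show ?thesis using that[of N'] N'0 by simp
    qed
    define \<eta> where "\<eta> = \<eta>' / (4 * n * (real N' * 4 + 2))"
    have \<eta>: "\<eta> > 0" using \<eta>' n by (simp add: \<eta>_def)
    have aff_err: "2 * M * n / real N' + 2 * n * (real N' * real 4 + 2) * \<eta> \<le> \<eta>'"
    proof -
      have "2 * K * (\<eta>' / (4 * K)) = \<eta>' / 2" if "K \<noteq> 0" for K :: real using that by simp
      from this[of "n * (real N' * 4 + 2)"] have "2 * n * (real N' * 4 + 2) * \<eta> = \<eta>' / 2"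
        using n by (simp add: \<eta>_def mult.assoc add_nonneg_eq_0_iff)
      moreover have "2 * M * n / real N' \<le> \<eta>' / 2" using N'(2) by simp
      ultimately show ?thesis by simp
    qed
    define I where "I = {..<J} \<times> (grid N' 4 :: 'a set) \<times> (grid N' 4 :: 'a set)"
    have finI: "finite I" using N' by (simp add: I_def finite_grid)
    define B2 where "B2 k ipq = (case ipq of (i, p, q) \<Rightarrow> {x. \<bar>w i (x + (2/2^k) *\<^sub>R ((1/2) *\<^sub>R (q - p)))
        - 2 * w i (x + (1/2^k) *\<^sub>R ((1/2) *\<^sub>R (q - p))) + w i x\<bar> > \<eta> * (1/2^k)})" for k :: nat and ipq :: "nat \<times> 'a \<times> 'a"
    have B2m: "B2 k ipq \<in> sets borel" for k ipq unfolding B2_def by (cases ipq) simp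
    define e2 where "e2 = e / (2 * (real (card I) + 1))"
    have e2: "e2 > 0" "real (card I) * e2 \<le> e / 2"
      using e by (simp_all add: e2_def field_simps)
    have "\<exists>k0. \<forall>k\<ge>k0. emeasure lborel (B2 k ipq) \<le> ennreal e2" for ipq
    proof (cases ipq)
      case (fields i p q)
      from second_increment_eventually_small[of "w i", OF wlip M0 supp e2(1) \<eta>, where v = "(1/2) *\<^sub>R (q - p)"]
      show ?thesis unfolding B2_def fields by simp
    qed
    then obtain kg where kg: "\<And>ipq k. k \<ge> kg ipq \<Longrightarrow> emeasure lborel (B2 k ipq) \<le> ennreal e2"
      by metis
    define k2 where "k2 = (\<Sum>ipq\<in>I. kg ipq)"
    have k2: "kg ipq \<le> k2" if "ipq \<in> I" for ipq
      unfolding k2_def using finI that by (intro member_le_sum) auto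
    \<comment> \<open>Scales so small that all points involved lie where the cutoff equals \<open>1\<close>.\<close>
    define k3 where "k3 = 8 * DIM('a)"
    show "\<exists>k0. \<forall>k\<ge>k0. \<exists>B. B \<in> sets borel \<and>
      emeasure lborel B \<le> ennreal e \<and> (\<forall>x. norm x \<le> \<rho> \<longrightarrow> x \<notin> B \<longrightarrow>
      (\<exists>P. finite P \<and> card P \<le> (8 * N + 1) ^ (DIM('a) - 1) \<and>
        f ` cball x (2 * (1 / 2 ^ k)) \<subseteq> (\<Union>q\<in>P. cball q ((5 + 3 * n * M) * (1 / 2 ^ k / real N)))))"
    proof (intro exI[of _ "k1 + k2 + k3"] allI impI)
      fix k assume k: "k \<ge> k1 + k2 + k3"
      define r :: real where "r = 1 / 2 ^ k"
      have r: "r > 0" by (simp add: r_def)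
      have r8: "r * (8 * n) \<le> 1"
      proof -
        have "k3 < 2 ^ k3" by (rule less_exp)
        also have "(2::nat) ^ k3 \<le> 2 ^ k" using k by (intro power_increasing) auto
        finally have "real k3 \<le> 2 ^ k" by (metis less_imp_le of_nat_le_iff of_nat_numeral of_nat_power)
        then show ?thesis by (simp add: r_def k3_def n_def)
      qed
      \<comment> \<open>A point is bad if one of the finitely many estimates fails at one of the surrounding lattice points.\<close>
      define B where "B = (\<Union>zv\<in>Z \<times> V. {x. x + r *\<^sub>R fst zv \<in> B1 J k (snd zv)}) \<union>
        (\<Union>ipq\<in>I. {x. x + r *\<^sub>R fst (snd ipq) \<in> B2 k ipq})"
      have "emeasure lborel (B1 J k (snd zv)) \<le> ennreal e1" if "zv \<in> Z \<times> V" for zv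
        using that k k1[of "snd zv"] J[of "snd zv"] by (intro Jf) auto
      note 1 = emeasure_UN_translates_le[of "Z \<times> V" "\<lambda>zv. B1 J k (snd zv)" e1 "e / 2" "\<lambda>zv. r *\<^sub>R fst zv",
          OF _ B1m this e1(2) less_imp_le[OF e1(1)]]
      have "emeasure lborel (B2 k ipq) \<le> ennreal e2" if "ipq \<in> I" for ipq
        using that k k2[of ipq] by (intro kg) auto
      note 2 = emeasure_UN_translates_le[of I "B2 k" e2 "e / 2" "\<lambda>ipq. r *\<^sub>R fst (snd ipq)",
          OF finI B2m this e2(2) less_imp_le[OF e2(1)]]
      have Bm: "B \<in> sets borel"
        unfolding B_def using 1(1) 2(1) fin by (intro sets.Un) auto
      have "emeasure lborel B \<le> ennreal (e / 2) + ennreal (e / 2)"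
        unfolding B_def using 1 2 fin by (intro order_trans[OF emeasure_subadditive] add_mono) auto
      also have "\<dots> = ennreal e" using e by (simp flip: ennreal_plus)
      finally have Be: "emeasure lborel B \<le> ennreal e" .
      have "\<exists>P. finite P \<and> card P \<le> (8 * N + 1) ^ (DIM('a) - 1) \<and>
        f ` cball x (2 * r) \<subseteq> (\<Union>q\<in>P. cball q ((5 + 3 * n * M) * (r / real N)))"
        if x: "norm x \<le> \<rho>" "x \<notin> B" for x
      proof -
        have near: "norm (x + r *\<^sub>R z) \<le> \<rho> + 1" if "\<And>b. b \<in> Basis \<Longrightarrow> \<bar>z \<bullet> b\<bar> \<le> 8" for z
        proof -
          have "norm z \<le> (\<Sum>b\<in>Basis. \<bar>z \<bullet> b\<bar>)" by (rule norm_le_l1)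
          also have "\<dots> \<le> (\<Sum>b\<in>(Basis::'a set). 8)" by (intro sum_mono that)
          finally have "norm z \<le> 8 * n" by (simp add: n_def)
          then have "r * norm z \<le> r * (8 * n)" using r by (intro mult_left_mono) auto
          then have "r * norm z \<le> 1" using r8 by (rule order_trans)
          then have "norm (r *\<^sub>R z) \<le> 1" using r by simp
          then show ?thesis using x(1) norm_triangle_ineq[of x "r *\<^sub>R z"] by linarith
        qed
        have gridb: "\<bar>z \<bullet> b\<bar> \<le> real R" if "z \<in> grid m R" "b \<in> Basis" for z :: 'a and b m R
          using that by (simp add: grid_def)
        have incr: "\<exists>i<J. dist (f (x + r *\<^sub>R z)) (f (x + r *\<^sub>R (z + v)))
          \<le> \<bar>dist (p i) (f (x + r *\<^sub>R (z + v))) - dist (p i) (f (x + r *\<^sub>R z))\<bar> + r / real N"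
          if z: "z \<in> grid N 2" and v: "v \<in> grid N 6" for z v
        proof -
          define D where "D i = \<bar>w i (x + r *\<^sub>R (z + v)) - w i (x + r *\<^sub>R z)\<bar>" for i
          have "x + r *\<^sub>R z \<notin> B1 J k v"
            using x(2) z v by (auto simp: B_def Z_def V_def)
          then have D1: "\<exists>i<J. D j \<le> D i + r / real N" for j
            unfolding B1_def D_def by (auto simp: r_def not_less scaleR_add_right add.assoc mult.commute)
          then have "J > 0" by (metis gr_zeroI not_less_zero)
          \<comment> \<open>The largest of the \<open>J\<close> increments serves for all indices at once.\<close>
          have "\<exists>i<J. \<forall>j<J. D j \<le> D i"
          proof -
            have "Max (D ` {..<J}) \<in> D ` {..<J}" using \<open>J > 0\<close> by (intro Max_in) auto
            then obtain i where "Max (D ` {..<J}) = D i" "i \<in> {..<J}" by (rule imageE)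
            moreover have "D j \<le> Max (D ` {..<J})" if "j < J" for j using that by (intro Max_ge) auto
            ultimately show ?thesis by auto
          qed
          then obtain i where i: "i < J" "\<And>j. j < J \<Longrightarrow> D j \<le> D i" by blast
          have zvb: "\<bar>(z + v) \<bullet> b\<bar> \<le> 8" "\<bar>z \<bullet> b\<bar> \<le> 8" if "b \<in> Basis" for b
            using gridb[OF z that] gridb[OF v that] by (simp_all add: inner_add_left)
          have n1: "norm (x + r *\<^sub>R z) \<le> \<rho> + 1" "norm (x + r *\<^sub>R (z + v)) \<le> \<rho> + 1"
            by (intro near zvb; assumption)+
          have all: "\<bar>w j (x + r *\<^sub>R z) - w j (x + r *\<^sub>R (z + v))\<bar> \<le> D i + r / real N" for j
          proof -
            obtain i' where "i' < J" "D j \<le> D i' + r / real N" using D1 by blast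
            then show ?thesis using i(2)[of i'] by (simp add: D_def abs_minus_commute)
          qed
          have "dist (f (x + r *\<^sub>R z)) (f (x + r *\<^sub>R (z + v))) \<le> D i + r / real N"
            by (rule sup[OF n1 all])
          then show ?thesis using i(1) by (auto simp: D_def wd[OF n1(1)] wd[OF n1(2)])
        qed
        define A where "A i a \<longleftrightarrow> (\<forall>b\<in>Basis. \<bar>a \<bullet> b\<bar> \<le> M) \<and> (\<forall>z. (\<forall>b\<in>Basis. \<bar>z \<bullet> b\<bar> \<le> 4) \<longrightarrow>
          \<bar>dist (p i) (f (x + r *\<^sub>R z)) - dist (p i) (f x) - r * (a \<bullet> z)\<bar> \<le> r * \<eta>')" for i a
        have "\<exists>a. A i a" if i: "i < J" for i
        proof -
          define u where "u z = w i (x + r *\<^sub>R z) / r" for z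
          have ulip: "\<bar>u y - u z\<bar> \<le> M * norm (y - z)" for y z
          proof -
            have "\<bar>w i (x + r *\<^sub>R y) - w i (x + r *\<^sub>R z)\<bar> \<le> M * (r * norm (y - z))"
              using wlip[of i "x + r *\<^sub>R y" "x + r *\<^sub>R z"] r by (simp flip: scaleR_diff_right)
            then have "\<bar>w i (x + r *\<^sub>R y) - w i (x + r *\<^sub>R z)\<bar> / r \<le> M * norm (y - z)"
              using r by (simp add: divide_le_eq mult_ac)
            moreover have "u y - u z = (w i (x + r *\<^sub>R y) - w i (x + r *\<^sub>R z)) / r"
              by (simp add: u_def diff_divide_distrib)
            ultimately show ?thesis using r by (simp add: abs_divide)
          qed
          have umid: "\<bar>u y + u z - 2 * u ((1/2) *\<^sub>R (y + z))\<bar> \<le> \<eta>" if yz: "y \<in> grid N' 4" "z \<in> grid N' 4" for y z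
          proof -
            have "(i, y, z) \<in> I" using i yz by (simp add: I_def)
            then have "x + r *\<^sub>R y \<notin> B2 k (i, y, z)" using x(2) by (force simp: B_def)
            then have nb: "\<not> \<bar>w i (x + r *\<^sub>R y + (2/2^k) *\<^sub>R ((1/2) *\<^sub>R (z - y)))
              - 2 * w i (x + r *\<^sub>R y + (1/2^k) *\<^sub>R ((1/2) *\<^sub>R (z - y))) + w i (x + r *\<^sub>R y)\<bar> > \<eta> * (1/2^k)"
              unfolding B2_def by (simp only: prod.case mem_Collect_eq not_False_eq_True)
            have eq1: "x + r *\<^sub>R y + (2/2^k) *\<^sub>R ((1/2) *\<^sub>R (z - y)) = x + r *\<^sub>R z"
              by (simp add: r_def scaleR_diff_right)
            have eq2: "x + r *\<^sub>R y + (1/2^k) *\<^sub>R ((1/2) *\<^sub>R (z - y)) = x + r *\<^sub>R ((1/2) *\<^sub>R (y + z))"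
              unfolding r_def by (rule midpoint_increment)
            have "\<bar>w i (x + r *\<^sub>R z) - 2 * w i (x + r *\<^sub>R ((1/2) *\<^sub>R (y + z))) + w i (x + r *\<^sub>R y)\<bar> \<le> \<eta> * r"
              using nb unfolding eq1 eq2 by (simp only: not_less r_def)
            moreover have "u y + u z - 2 * u ((1/2) *\<^sub>R (y + z))
              = (w i (x + r *\<^sub>R z) - 2 * w i (x + r *\<^sub>R ((1/2) *\<^sub>R (y + z))) + w i (x + r *\<^sub>R y)) / r"
              by (simp add: u_def add_divide_distrib diff_divide_distrib)
            ultimately show ?thesis using r by (simp add: abs_divide divide_le_eq)
          qed
          obtain a where a: "\<forall>b\<in>Basis. \<bar>a \<bullet> b\<bar> \<le> M"
            "\<forall>z. (\<forall>b\<in>Basis. \<bar>z \<bullet> b\<bar> \<le> real 4) \<longrightarrow> \<bar>u z - u 0 - a \<bullet> z\<bar>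
              \<le> 2 * M * real DIM('a) / real N' + 2 * real DIM('a) * (real N' * real 4 + 2) * \<eta>"
            using almost_affine[OF N'(1) ulip umid] by blast
          have "\<bar>dist (p i) (f (x + r *\<^sub>R z)) - dist (p i) (f x) - r * (a \<bullet> z)\<bar> \<le> r * \<eta>'"
            if z: "\<And>b. b \<in> Basis \<Longrightarrow> \<bar>z \<bullet> b\<bar> \<le> 4" for z
          proof -
            have "\<bar>u z - u 0 - a \<bullet> z\<bar> \<le> \<eta>'"
              using a(2)[rule_format, of z] z aff_err by (simp add: n_def)
            then have le: "r * \<bar>u z - u 0 - a \<bullet> z\<bar> \<le> r * \<eta>'" using r by (intro mult_left_mono) auto
            have n1: "norm (x + r *\<^sub>R z) \<le> \<rho> + 1" by (intro near order_trans[OF z]) simp_all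
            have n2: "norm x \<le> \<rho> + 1" using x(1) by simp
            have "r * (u z - u 0 - a \<bullet> z) = w i (x + r *\<^sub>R z) - w i x - r * (a \<bullet> z)"
              using r by (simp add: u_def diff_divide_distrib right_diff_distrib)
            then have e: "dist (p i) (f (x + r *\<^sub>R z)) - dist (p i) (f x) - r * (a \<bullet> z) = r * (u z - u 0 - a \<bullet> z)"
              using n1 n2 by (simp add: wd)
            show ?thesis
              unfolding e abs_mult using le r by (simp only: abs_of_pos)
          qed
          with a(1) show ?thesis unfolding A_def by blast
        qed
        then obtain a where a: "\<And>i. i < J \<Longrightarrow> A i (a i)"
          by metis
        have a1: "\<bar>a i \<bullet> b\<bar> \<le> M" if "i < J" "b \<in> Basis" for i b
          using a[OF that(1)] that(2) unfolding A_def by blast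
        have a2: "\<bar>dist (p i) (f (x + r *\<^sub>R z)) - dist (p i) (f x) - r * (a i \<bullet> z)\<bar> \<le> r * \<eta>'"
          if "i < J" "\<And>b. b \<in> Basis \<Longrightarrow> \<bar>z \<bullet> b\<bar> \<le> 4" for i z
          using a[OF that(1)] that(2) unfolding A_def by blast
        show ?thesis
          unfolding n_def
          by (rule thin_cover_at_good_point[OF flip M0 ran dim N r incr a1 a2 \<eta>'(2) \<eta>'2[unfolded n_def]])
      qed
      with Bm Be show "\<exists>B. B \<in> sets borel \<and>
        emeasure lborel B \<le> ennreal e \<and> (\<forall>x. norm x \<le> \<rho> \<longrightarrow> x \<notin> B \<longrightarrow>
        (\<exists>P. finite P \<and> card P \<le> (8 * N + 1) ^ (DIM('a) - 1) \<and>
          f ` cball x (2 * (1 / 2 ^ k)) \<subseteq> (\<Union>q\<in>P. cball q ((5 + 3 * n * M) * (1 / 2 ^ k / real N)))))"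
        unfolding r_def by blast
    qed
  qed
qed

section \<open>Covering the image\<close>

lemma diameter_leI:
  fixes S :: "'a::metric_space set"
  assumes "\<And>x y. x \<in> S \<Longrightarrow> y \<in> S \<Longrightarrow> dist x y \<le> d" "d \<ge> 0"
  shows "diameter S \<le> d"
  unfolding diameter_def using assms by (auto intro!: cSUP_least)

text \<open>The balls of radius \<open>r / 2\<close> around the points of \<open>T\<close> are disjoint and contained in \<open>B\<close>.\<close>

lemma packing_bound:
  fixes T :: "'a::euclidean_space set"
  assumes "finite T" and r: "r > 0" and sep: "\<And>x y. x \<in> T \<Longrightarrow> y \<in> T \<Longrightarrow> x \<noteq> y \<Longrightarrow> r \<le> dist x y"
    and sub: "\<And>c. c \<in> T \<Longrightarrow> ball c (r / 2) \<subseteq> B" and B: "B \<in> sets borel" "emeasure lborel B \<le> ennreal m" "m \<ge> 0"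
  shows "real (card T) * r ^ DIM('a) \<le> 2 ^ DIM('a) / unit_ball_vol (real DIM('a)) * m"
proof -
  let ?n = "DIM('a)" and ?\<omega> = "unit_ball_vol (real DIM('a))"
  have \<omega>: "?\<omega> > 0" by simp
  have disj: "disjoint_family_on (\<lambda>c. ball c (r / 2)) T"
    unfolding disjoint_family_on_def
  proof (intro ballI impI equals0I)
    fix x y z assume xy: "x \<in> T" "y \<in> T" "x \<noteq> y" and z: "z \<in> ball x (r / 2) \<inter> ball y (r / 2)"
    have "dist x y \<le> dist x z + dist y z" by (rule dist_triangle2)
    then show False using sep[OF xy] z by simp
  qed
  have "(\<Sum>c\<in>T. ennreal (?\<omega> * (r / 2) ^ ?n)) = (\<Sum>c\<in>T. emeasure lborel (ball c (r / 2)))"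
    using r by (intro sum.cong refl) (simp add: emeasure_ball)
  also have "\<dots> = emeasure lborel (\<Union>c\<in>T. ball c (r / 2))"
    using \<open>finite T\<close> disj by (intro sum_emeasure) auto
  also have "\<dots> \<le> emeasure lborel B"
    using sub B(1) by (intro emeasure_mono) auto
  also have "\<dots> \<le> ennreal m" by (rule B(2))
  finally have "ennreal (real (card T) * (?\<omega> * (r / 2) ^ ?n)) \<le> ennreal m"
    using r \<omega> by (simp add: ennreal_mult ennreal_of_nat_eq_real_of_nat)
  then have "real (card T) * (?\<omega> * (r / 2) ^ ?n) \<le> m" using B(3) by simp
  then have "real (card T) * r ^ ?n * (?\<omega> / 2 ^ ?n) \<le> m" by (simp add: power_divide mult_ac)
  then have "real (card T) * r ^ ?n \<le> m / (?\<omega> / 2 ^ ?n)"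
    using \<omega> by (subst pos_le_divide_eq) auto
  then show ?thesis by (simp add: mult.commute)
qed

text \<open>A separated subset of maximal cardinality has these properties, and one exists because packing
  bounds the cardinality.\<close>

lemma separated_net_exists:
  assumes r: "r > 0" "r \<le> 1" and \<rho>: "\<rho> \<ge> 0"
  obtains T where "finite T" "T \<subseteq> cball (0::'a::euclidean_space) \<rho>"
    "\<And>x y. x \<in> T \<Longrightarrow> y \<in> T \<Longrightarrow> x \<noteq> y \<Longrightarrow> r \<le> dist x y"
    "cball 0 \<rho> \<subseteq> (\<Union>c\<in>T. cball c r)"
    "real (card T) * r ^ DIM('a) \<le> (2 * (\<rho> + 1)) ^ DIM('a)"
proof -
  define P where "P T \<longleftrightarrow> finite T \<and> T \<subseteq> cball (0::'a) \<rho> \<and> (\<forall>x\<in>T. \<forall>y\<in>T. x \<noteq> y \<longrightarrow> r \<le> dist x y)" for T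
  have bound: "real (card T) * r ^ DIM('a) \<le> (2 * (\<rho> + 1)) ^ DIM('a)" if "P T" for T
  proof -
    have "real (card T) * r ^ DIM('a) \<le> 2 ^ DIM('a) / unit_ball_vol (real DIM('a)) *
      (unit_ball_vol (real DIM('a)) * (\<rho> + 1) ^ DIM('a))"
    proof (rule packing_bound[of T r "cball 0 (\<rho> + 1)"])
      show "ball c (r / 2) \<subseteq> cball 0 (\<rho> + 1)" if "c \<in> T" for c
      proof
        fix z assume "z \<in> ball c (r / 2)"
        moreover have "norm c \<le> \<rho>" using \<open>P T\<close> that by (auto simp: P_def)
        ultimately show "z \<in> cball 0 (\<rho> + 1)"
          using norm_triangle_ineq2[of z c] r(2) by (simp add: dist_norm norm_minus_commute)
      qed
      show "emeasure lborel (cball (0::'a) (\<rho> + 1)) \<le> ennreal (unit_ball_vol (real DIM('a)) * (\<rho> + 1) ^ DIM('a))"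
        using \<rho> by (simp add: emeasure_cball)
    qed (use that r \<rho> in \<open>auto simp: P_def\<close>)
    also have "\<dots> = (2 * (\<rho> + 1)) ^ DIM('a)"
    proof -
      have "2 ^ DIM('a) / \<omega> * (\<omega> * (\<rho> + 1) ^ DIM('a)) = (2 * (\<rho> + 1)) ^ DIM('a)" if "\<omega> > 0" for \<omega> :: real
        using that by (simp only: power_mult_distrib) simp
      from this[OF unit_ball_vol_pos[OF of_nat_0_le_iff]] show ?thesis .
    qed
    finally show ?thesis .
  qed
  have "card T < nat \<lfloor>(2 * (\<rho> + 1)) ^ DIM('a) / r ^ DIM('a)\<rfloor> + 1" if "P T" for T
  proof -
    have "real (card T) \<le> (2 * (\<rho> + 1)) ^ DIM('a) / r ^ DIM('a)"
      using bound[OF that] r by (simp add: pos_le_divide_eq)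
    then show ?thesis by (simp add: le_nat_floor less_Suc_eq_le)
  qed
  moreover have "P {}" by (simp add: P_def)
  ultimately obtain T where T: "P T" "\<And>S. P S \<Longrightarrow> card S \<le> card T"
    using ex_has_greatest_nat[of P "{}" card "nat \<lfloor>(2 * (\<rho> + 1)) ^ DIM('a) / r ^ DIM('a)\<rfloor> + 1"] by blast
  have "cball 0 \<rho> \<subseteq> (\<Union>c\<in>T. cball c r)"
  proof (rule ccontr)
    assume "\<not> ?thesis"
    then obtain x where x: "x \<in> cball 0 \<rho>" "x \<notin> (\<Union>c\<in>T. cball c r)" by blast
    then have far: "r < dist c x" if "c \<in> T" for c using that by (simp add: not_le)
    have "x \<notin> T" using far[of x] r by auto
    have "P (insert x T)"
      using T(1) x(1) far unfolding P_def by (auto simp: dist_commute less_imp_le)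
    from T(2)[OF this] show False using T(1) \<open>x \<notin> T\<close> by (simp add: P_def)
  qed
  then show ?thesis
    using T(1) bound[OF T(1)] by (intro that[of T]) (auto simp: P_def)
qed

lemma small_dyadic:
  assumes "\<delta> > 0" "K \<ge> (0::real)"
  obtains k1 where "\<And>k. k \<ge> k1 \<Longrightarrow> K * (1 / 2 ^ k) \<le> \<delta>"
proof -
  obtain k1 :: nat where "K / \<delta> < 2 ^ k1"
    using real_arch_pow[of 2 "K / \<delta>"] by auto
  show ?thesis
  proof (rule that[of k1])
    fix k assume "k \<ge> k1"
    then have "(2::real) ^ k1 \<le> 2 ^ k" by (intro power_increasing) auto
    with \<open>K / \<delta> < 2 ^ k1\<close> have "K / \<delta> \<le> 2 ^ k" by linarith
    then show "K * (1 / 2 ^ k) \<le> \<delta>" using assms(1) by (simp add: divide_le_eq mult.commute)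
  qed
qed

lemma image_cball_lipschitz:
  fixes f :: "'a::euclidean_space \<Rightarrow> 'b::metric_space"
  assumes lip: "\<And>x y. dist (f x) (f y) \<le> L * norm (x - y)" and L: "L \<ge> 0" and r: "r \<ge> 0"
  shows "bounded (f ` cball c r)" "diameter (f ` cball c r) \<le> 2 * L * r"
proof -
  have d: "dist (f x) (f y) \<le> 2 * L * r" if "x \<in> cball c r" "y \<in> cball c r" for x y
  proof -
    have "norm (x - y) \<le> 2 * r"
      using that dist_triangle[of x y c] by (simp add: dist_norm norm_minus_commute)
    then have "L * norm (x - y) \<le> L * (2 * r)" using L by (intro mult_left_mono)
    then show ?thesis using lip[of x y] by simp
  qed
  show "diameter (f ` cball c r) \<le> 2 * L * r"
    using d L r by (intro diameter_leI) auto
  show "bounded (f ` cball c r)"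
    unfolding bounded_def using d[of c] r by (intro exI[of _ "f c"] exI[of _ "2 * L * r"]) auto
qed

lemma lipschitz_image_cball_null_Suc:
  fixes f :: "'a::euclidean_space \<Rightarrow> 'b::metric_space"
  assumes lip: "\<And>x y. dist (f x) (f y) \<le> L * norm (x - y)" and L: "L \<ge> 0" and \<rho>: "\<rho> \<ge> 0"
  shows "hausdorff_measure (Suc DIM('a)) (f ` cball 0 \<rho>) = 0"
proof (rule hausdorff_measure_null_if_finite_covers)
  fix \<delta> e :: real assume \<delta>: "\<delta> > 0" and e: "e > 0"
  define W where "W = (2 * (\<rho> + 1)) ^ DIM('a) * (2 * L) ^ Suc DIM('a)"
  have W: "W \<ge> 0" using L \<rho> by (simp add: W_def)
  have "2 * L \<ge> 0" using L by simp
  then obtain k1 where k1: "\<And>k. k \<ge> k1 \<Longrightarrow> 2 * L * (1 / 2 ^ k) \<le> \<delta>" using small_dyadic[OF \<delta>] by blast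
  obtain k2 where k2: "\<And>k. k \<ge> k2 \<Longrightarrow> W * (1 / 2 ^ k) \<le> e" using small_dyadic[OF e W] by blast
  define r :: real where "r = 1 / 2 ^ (max k1 k2)"
  have r: "r > 0" "r \<le> 1" "2 * L * r \<le> \<delta>" "W * r \<le> e"
    using k1[of "max k1 k2"] k2[of "max k1 k2"] by (simp_all add: r_def)
  obtain T where T: "finite T" "cball (0::'a) \<rho> \<subseteq> (\<Union>c\<in>T. cball c r)"
    "real (card T) * r ^ DIM('a) \<le> (2 * (\<rho> + 1)) ^ DIM('a)"
    using separated_net_exists[OF r(1,2) \<rho>] by metis
  note im = image_cball_lipschitz[OF lip L less_imp_le[OF r(1)]]
  show "\<exists>F. finite F \<and> f ` cball 0 \<rho> \<subseteq> \<Union>F \<and> (\<forall>V\<in>F. bounded V \<and> diameter V \<le> \<delta>) \<and>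
    (\<Sum>V\<in>F. diameter V ^ Suc DIM('a)) \<le> e"
  proof (intro exI[of _ "(\<lambda>c. f ` cball c r) ` T"] conjI ballI)
    show "finite ((\<lambda>c. f ` cball c r) ` T)" using T(1) by simp
    show "f ` cball 0 \<rho> \<subseteq> \<Union>((\<lambda>c. f ` cball c r) ` T)" using T(2) by blast
    show "bounded V" "diameter V \<le> \<delta>" if "V \<in> (\<lambda>c. f ` cball c r) ` T" for V
      using that im order_trans[OF im(2) r(3)] by auto
    have "(\<Sum>V\<in>(\<lambda>c. f ` cball c r) ` T. diameter V ^ Suc DIM('a)) \<le> (\<Sum>c\<in>T. diameter (f ` cball c r) ^ Suc DIM('a))"
      by (rule sum_image_le[where g = "\<lambda>V. diameter V ^ Suc DIM('a)", unfolded comp_def])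
         (use T(1) diameter_ge_0[OF im(1)] in simp_all)
    also have "\<dots> \<le> (\<Sum>c\<in>T. (2 * L * r) ^ Suc DIM('a))"
      using im by (intro sum_mono power_mono diameter_ge_0)
    also have "\<dots> = (2 * L) ^ Suc DIM('a) * r * (real (card T) * r ^ DIM('a))"
      by (simp add: power_mult_distrib)
    also have "\<dots> \<le> (2 * L) ^ Suc DIM('a) * r * (2 * (\<rho> + 1)) ^ DIM('a)"
      using L r T(3) by (intro mult_left_mono) auto
    also have "\<dots> = W * r" by (simp add: W_def mult_ac)
    also have "\<dots> \<le> e" by (rule r)
    finally show "(\<Sum>V\<in>(\<lambda>c. f ` cball c r) ` T. diameter V ^ Suc DIM('a)) \<le> e" .
  qed
qed simp

text \<open>The ball is covered by balls of radius \<open>r\<close> around a separated net \<open>T\<close>. Centres in \<open>Tb\<close>, whose half-size ball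
  consists of bad points, are few because of \<open>packing_bound\<close>, and the trivial estimate of the diameter
  suffices for them. Around every other centre there is a good point, and the image of the ball is
  covered by \<open>(9 N)\<^bsup>n - 1\<^esup>\<close> balls of radius \<open>C r / N\<close>. All powers of \<open>r\<close> cancel; the remaining sum is of order
  \<open>1 / N\<close> plus the measure of the bad set.\<close>

lemma lipschitz_image_cball_null:
  fixes f :: "'a::euclidean_space \<Rightarrow> 'b::metric_space"
  assumes lip: "\<And>x y. dist (f x) (f y) \<le> L * norm (x - y)" and L: "L \<ge> 0" and \<rho>: "\<rho> \<ge> 0"
    and ran: "range f \<subseteq> X" and dim: "ind_dim_le (top_of_set X) (int DIM('a) - 1)"
  shows "hausdorff_measure DIM('a) (f ` cball 0 \<rho>) = 0"
proof (rule hausdorff_measure_null_if_finite_covers)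
  let ?n = "DIM('a)" and ?\<omega> = "unit_ball_vol (real DIM('a))"
  have \<omega>: "?\<omega> > 0" by simp
  fix \<delta> e :: real assume \<delta>: "\<delta> > 0" and e: "e > 0"
  have "\<rho> + 1 > 0" using \<rho> by simp
  define covered where "covered C N k x \<longleftrightarrow> (\<exists>P. finite P \<and> card P \<le> (8 * N + 1) ^ (DIM('a) - 1) \<and>
        f ` cball x (2 * (1 / 2 ^ k)) \<subseteq> (\<Union>q\<in>P. cball q (C * (1 / 2 ^ k / real N))))" for C N k x
  have "\<exists>C\<ge>0. \<forall>N>0. \<forall>e>0. \<exists>k0. \<forall>k\<ge>k0. \<exists>B. B \<in> sets borel \<and>
    emeasure lborel B \<le> ennreal e \<and> (\<forall>x. norm x \<le> \<rho> + 1 \<longrightarrow> x \<notin> B \<longrightarrow> covered C N k x)"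
    unfolding covered_def
    by (rule good_points_thin_cover[OF lip L \<open>\<rho> + 1 > 0\<close> ran dim]) blast
  then obtain C where C: "C \<ge> 0" and good: "\<forall>N>0. \<forall>e>0. \<exists>k0. \<forall>k\<ge>k0. \<exists>B. B \<in> sets borel \<and>
    emeasure lborel B \<le> ennreal e \<and> (\<forall>x. norm x \<le> \<rho> + 1 \<longrightarrow> x \<notin> B \<longrightarrow> covered C N k x)"
    by blast
  define W where "W = (2 * (\<rho> + 1)) ^ ?n * (9 ^ (?n - 1) * (2 * C) ^ ?n)"
  have W: "W \<ge> 0" using C \<rho> by (simp add: W_def)
  obtain N :: nat where "real N > 2 * W / e" using reals_Archimedean2 by blast
  moreover have "2 * W / e \<ge> 0" using W e by simp
  ultimately have N0: "real N > 0" and "2 * W / e \<le> real N" by linarith+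
  then have WN: "W / real N \<le> e / 2" using e by (simp add: field_simps)
  have N: "N > 0" using N0 by simp
  \<comment> \<open>The added \<open>1\<close> keeps the denominator positive when \<open>L = 0\<close>.\<close>
  define eB where "eB = e / 2 / ((2 * L) ^ ?n * 2 ^ ?n / ?\<omega> + 1)"
  have den: "(2 * L) ^ ?n * 2 ^ ?n / ?\<omega> \<ge> 0" using L \<omega> by simp
  then have eB: "eB > 0" using e by (simp add: eB_def add_nonneg_pos)
  have eB2: "(2 * L) ^ ?n * (2 ^ ?n / ?\<omega> * eB) \<le> e / 2"
  proof -
    have "K * (e / 2 / (K + 1)) \<le> e / 2" if "K \<ge> 0" for K :: real
    proof -
      have "K * (e / 2) \<le> e / 2 * (K + 1)" using e by (simp add: algebra_simps)
      then have "K * (e / 2) / (K + 1) \<le> e / 2" using that by (subst pos_divide_le_eq) auto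
      then show ?thesis by simp
    qed
    from this[OF den] show ?thesis by (simp only: eB_def times_divide_eq_left times_divide_eq_right mult.assoc)
  qed
  obtain k0 where k0: "\<forall>k\<ge>k0. \<exists>B. B \<in> sets borel \<and>
    emeasure lborel B \<le> ennreal eB \<and> (\<forall>x. norm x \<le> \<rho> + 1 \<longrightarrow> x \<notin> B \<longrightarrow> covered C N k x)"
    using good N eB by blast
  have LC: "2 * L + 2 * C \<ge> 0" using L C by simp
  obtain k1 where k1: "\<And>k. k \<ge> k1 \<Longrightarrow> (2 * L + 2 * C) * (1 / 2 ^ k) \<le> \<delta>"
    using small_dyadic[OF \<delta> LC] by blast
  define k where "k = max k0 k1"
  define r :: real where "r = 1 / 2 ^ k"
  have r: "r > 0" "r \<le> 1" by (simp_all add: r_def)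
  have rd: "2 * L * r \<le> \<delta>" "2 * (C * (r / real N)) \<le> \<delta>"
  proof -
    have *: "2 * L * r + 2 * C * r \<le> \<delta>"
      using k1[of k] by (simp add: k_def r_def algebra_simps)
    moreover have "2 * C * r \<ge> 0" "2 * L * r \<ge> 0" using C L r by simp_all
    moreover have "C * (r / real N) \<le> C * (r / 1)"
      using C r N by (intro mult_left_mono divide_left_mono) auto
    ultimately show "2 * L * r \<le> \<delta>" "2 * (C * (r / real N)) \<le> \<delta>" by simp_all
  qed
  have "k \<ge> k0" by (simp add: k_def)
  with k0 obtain B where B: "B \<in> sets borel" "emeasure lborel B \<le> ennreal eB"
    and Bg: "\<forall>x. norm x \<le> \<rho> + 1 \<longrightarrow> x \<notin> B \<longrightarrow> covered C N k x"
    by blast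
  obtain T where T: "finite T" "T \<subseteq> cball (0::'a) \<rho>"
    "\<And>x y. x \<in> T \<Longrightarrow> y \<in> T \<Longrightarrow> x \<noteq> y \<Longrightarrow> r \<le> dist x y"
    "cball (0::'a) \<rho> \<subseteq> (\<Union>c\<in>T. cball c r)"
    "real (card T) * r ^ ?n \<le> (2 * (\<rho> + 1)) ^ ?n"
    using separated_net_exists[OF r \<rho>] by metis
  define Tb where "Tb = {c \<in> T. ball c (r / 2) \<subseteq> B}"
  define Tg where "Tg = T - Tb"
  have fin: "finite Tb" "finite Tg" using T(1) by (simp_all add: Tb_def Tg_def)
  have cardb: "real (card Tb) * r ^ ?n \<le> 2 ^ ?n / ?\<omega> * eB"
    using T(3) by (intro packing_bound[OF fin(1) r(1) _ _ B(1,2) less_imp_le[OF eB]]) (auto simp: Tb_def)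
  have cardg: "real (card Tg) * r ^ ?n \<le> (2 * (\<rho> + 1)) ^ ?n"
  proof -
    have "card Tg \<le> card T" using T(1) by (intro card_mono) (auto simp: Tg_def)
    then have "real (card Tg) * r ^ ?n \<le> real (card T) * r ^ ?n" using r by (intro mult_right_mono) auto
    then show ?thesis using T(5) by linarith
  qed
  have "\<exists>P. finite P \<and> card P \<le> (8 * N + 1) ^ (?n - 1) \<and> f ` cball c r \<subseteq> (\<Union>q\<in>P. cball q (C * (r / real N)))"
    if c: "c \<in> Tg" for c
  proof -
    have "\<not> ball c (r / 2) \<subseteq> B" using c by (simp add: Tg_def Tb_def)
    then obtain x where x: "x \<in> ball c (r / 2)" "x \<notin> B" by blast
    have "norm c \<le> \<rho>" using c T(2) by (auto simp: Tg_def)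
    then have "norm x \<le> \<rho> + 1" using x(1) r(2) norm_triangle_ineq2[of x c] by (simp add: dist_norm norm_minus_commute)
    with Bg x(2) have "covered C N k x" by blast
    moreover have "cball c r \<subseteq> cball x (2 * r)"
    proof
      fix y assume "y \<in> cball c r"
      then show "y \<in> cball x (2 * r)" using x(1) r(1) dist_triangle[of x y c] by (simp add: dist_commute)
    qed
    ultimately show ?thesis unfolding covered_def r_def[symmetric] by (meson image_mono order_trans)
  qed
  then obtain P where P: "\<And>c. c \<in> Tg \<Longrightarrow> finite (P c)" "\<And>c. c \<in> Tg \<Longrightarrow> card (P c) \<le> (8 * N + 1) ^ (?n - 1)"
    "\<And>c. c \<in> Tg \<Longrightarrow> f ` cball c r \<subseteq> (\<Union>q\<in>P c. cball q (C * (r / real N)))"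
    by metis
  define s where "s = C * (r / real N)"
  have s: "s \<ge> 0" using C r by (simp add: s_def)
  define F1 where "F1 = (\<lambda>c. f ` cball c r) ` Tb"
  define F2 where "F2 = (\<lambda>(c, q). cball q s) ` (SIGMA c:Tg. P c)"
  note im = image_cball_lipschitz[OF lip L less_imp_le[OF r(1)]]
  have dq: "diameter (cball q s) \<le> 2 * s" for q :: 'b
  proof (rule diameter_leI)
    show "dist x y \<le> 2 * s" if "x \<in> cball q s" "y \<in> cball q s" for x y
      using that dist_triangle[of x y q] by (simp add: dist_commute)
  qed (use s in simp)
  have finS: "finite (SIGMA c:Tg. P c)" using fin P(1) by (intro finite_SigmaI) auto
  have sum1: "(\<Sum>V\<in>F1. diameter V ^ ?n) \<le> e / 2"
  proof -
    have "(\<Sum>V\<in>F1. diameter V ^ ?n) \<le> (\<Sum>c\<in>Tb. diameter (f ` cball c r) ^ ?n)"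
      unfolding F1_def by (rule sum_image_le[where g = "\<lambda>V. diameter V ^ ?n", unfolded comp_def])
         (use fin(1) diameter_ge_0[OF im(1)] in simp_all)
    also have "\<dots> \<le> (\<Sum>c\<in>Tb. (2 * L * r) ^ ?n)"
      using im by (intro sum_mono power_mono diameter_ge_0)
    also have "\<dots> = (2 * L) ^ ?n * (real (card Tb) * r ^ ?n)"
      by (simp add: power_mult_distrib)
    also have "\<dots> \<le> (2 * L) ^ ?n * (2 ^ ?n / ?\<omega> * eB)"
      using L cardb by (intro mult_left_mono) auto
    also have "\<dots> \<le> e / 2" by (rule eB2)
    finally show ?thesis .
  qed
  have sum2: "(\<Sum>V\<in>F2. diameter V ^ ?n) \<le> e / 2"
  proof -
    have "(\<Sum>V\<in>F2. diameter V ^ ?n) \<le> (\<Sum>cq\<in>(SIGMA c:Tg. P c). diameter ((\<lambda>(c, q). cball q s) cq) ^ ?n)"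
      unfolding F2_def by (rule sum_image_le[where g = "\<lambda>V. diameter V ^ ?n", unfolded comp_def])
         (use finS in \<open>auto intro!: zero_le_power diameter_ge_0\<close>)
    also have "\<dots> \<le> (\<Sum>cq\<in>(SIGMA c:Tg. P c). (2 * s) ^ ?n)"
      using dq by (intro sum_mono power_mono) (auto intro!: diameter_ge_0)
    also have "\<dots> = real (\<Sum>c\<in>Tg. card (P c)) * (2 * s) ^ ?n"
      using fin P(1) by simp
    also have "\<dots> \<le> (real (card Tg) * (9 * real N) ^ (?n - 1)) * (2 * s) ^ ?n"
    proof (intro mult_right_mono)
      have "(\<Sum>c\<in>Tg. card (P c)) \<le> card Tg * (8 * N + 1) ^ (?n - 1)"
        using P(2) by (intro sum_bounded_above[where 'a = nat, simplified]) auto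
      also have "\<dots> \<le> card Tg * (9 * N) ^ (?n - 1)"
        using N by (intro mult_left_mono power_mono) auto
      finally have "real (\<Sum>c\<in>Tg. card (P c)) \<le> real (card Tg * (9 * N) ^ (?n - 1))"
        by (simp only: of_nat_le_iff)
      then show "real (\<Sum>c\<in>Tg. card (P c)) \<le> real (card Tg) * (9 * real N) ^ (?n - 1)" by simp
    qed (use s in simp)
    also have "\<dots> = (real (card Tg) * r ^ ?n) * (9 ^ (?n - 1) * (2 * C) ^ ?n / real N)"
    proof -
      have "?n = Suc (?n - 1)" by simp
      then have "real N ^ ?n = real N ^ (?n - 1) * real N" by (metis power_Suc2)
      then have ratio: "real N ^ (?n - 1) / real N ^ ?n = 1 / real N" using N by simp
      have pow: "(2 * s) ^ ?n = (2 * C) ^ ?n * r ^ ?n / real N ^ ?n"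
        by (simp add: s_def power_mult_distrib power_divide)
      have regroup: "(\<kappa> * (q * A)) * (c * t / B) = (\<kappa> * t) * (q * c * (A / B))" for \<kappa> q A c t B :: real
        by simp
      show ?thesis
        unfolding power_mult_distrib[of 9] pow regroup ratio by simp
    qed
    also have "\<dots> \<le> (2 * (\<rho> + 1)) ^ ?n * (9 ^ (?n - 1) * (2 * C) ^ ?n / real N)"
      using cardg C by (intro mult_right_mono) auto
    also have "\<dots> = W / real N" by (simp add: W_def)
    also have "\<dots> \<le> e / 2" by (rule WN)
    finally show ?thesis .
  qed
  show "\<exists>F. finite F \<and> f ` cball 0 \<rho> \<subseteq> \<Union>F \<and> (\<forall>V\<in>F. bounded V \<and> diameter V \<le> \<delta>) \<and>
    (\<Sum>V\<in>F. diameter V ^ ?n) \<le> e"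
  proof (intro exI[of _ "F1 \<union> F2"] conjI ballI)
    have finF: "finite F1" "finite F2" using fin finS by (simp_all add: F1_def F2_def)
    then show "finite (F1 \<union> F2)" by simp
    show "f ` cball 0 \<rho> \<subseteq> \<Union>(F1 \<union> F2)"
    proof (rule image_subsetI)
      fix x :: 'a assume "x \<in> cball 0 \<rho>"
      then obtain c where c: "c \<in> T" "x \<in> cball c r" using T(4) by blast
      show "f x \<in> \<Union>(F1 \<union> F2)"
      proof (cases "c \<in> Tb")
        case True
        then have "f ` cball c r \<in> F1" by (simp add: F1_def)
        then show ?thesis using c(2) by blast
      next
        case False
        then have "c \<in> Tg" using c(1) by (simp add: Tg_def)
        then obtain q where "q \<in> P c" "f x \<in> cball q s" using P(3) c(2) unfolding s_def by blast
        then show ?thesis using \<open>c \<in> Tg\<close> unfolding F2_def by force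
      qed
    qed
    have "bounded V \<and> diameter V \<le> \<delta>" if "V \<in> F1 \<union> F2" for V
      using that
    proof
      assume "V \<in> F1"
      then show ?thesis using im order_trans[OF im(2) rd(1)] by (auto simp: F1_def)
    next
      assume "V \<in> F2"
      then obtain q where "V = cball q s" by (auto simp: F2_def)
      then show ?thesis using order_trans[OF dq[of q]] rd(2) by (simp add: s_def)
    qed
    then show "V \<in> F1 \<union> F2 \<Longrightarrow> bounded V" "V \<in> F1 \<union> F2 \<Longrightarrow> diameter V \<le> \<delta>" for V by blast+
    have nn: "diameter V ^ ?n \<ge> 0" if "V \<in> F1 \<union> F2" for V
      using that im(1) by (auto simp: F1_def F2_def intro!: zero_le_power diameter_ge_0)
    have "(\<Sum>V\<in>F1 \<union> F2. diameter V ^ ?n) \<le> (\<Sum>V\<in>F1. diameter V ^ ?n) + (\<Sum>V\<in>F2. diameter V ^ ?n)"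
      using finF nn by (subst sum.union_inter[symmetric]) (auto intro!: sum_nonneg)
    then show "(\<Sum>V\<in>F1 \<union> F2. diameter V ^ ?n) \<le> e" using sum1 sum2 by linarith
  qed
qed simp


text \<open>The analysis needs a map on the whole space. Composition with the nearest point projection onto \<open>K\<close>
  keeps both the Lipschitz constant and the image.\<close>

lemma lipschitz_image_eq_cball_image:
  fixes f :: "'a::euclidean_space \<Rightarrow> 'b::metric_space"
  assumes L: "L-lipschitz_on K f" and K: "compact K" "convex K" "K \<noteq> {}"
  shows "\<exists>(g :: 'a \<Rightarrow> 'b) \<rho>. (\<forall>x y. dist (g x) (g y) \<le> L * norm (x - y)) \<and> range g = f ` K \<and> \<rho> \<ge> 0 \<and> g ` cball 0 \<rho> = f ` K"
proof -
  have clK: "closed K" using K(1) by (rule compact_imp_closed)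
  define g where "g x = f (closest_point K x)" for x
  have mem: "closest_point K x \<in> K" for x
    using closest_point_in_set[OF clK K(3)] .
  have self: "g x = f x" if "x \<in> K" for x
    using that by (simp add: g_def closest_point_self)
  have lip: "dist (g x) (g y) \<le> L * norm (x - y)" for x y
  proof -
    have "dist (g x) (g y) \<le> L * dist (closest_point K x) (closest_point K y)"
      unfolding g_def by (rule lipschitz_onD[OF L mem mem])
    also have "\<dots> \<le> L * dist x y"
      using closest_point_lipschitz[OF K(2) clK K(3), of x y] lipschitz_on_nonneg[OF L]
      by (intro mult_left_mono)
    finally show ?thesis by (simp add: dist_norm)
  qed
  obtain \<rho> where \<rho>: "\<rho> > 0" "\<And>x. x \<in> K \<Longrightarrow> norm x \<le> \<rho>"
    using compact_imp_bounded[OF K(1)] by (auto simp: bounded_pos)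
  have "range g = f ` K"
  proof
    show "range g \<subseteq> f ` K" using mem by (auto simp: g_def)
    show "f ` K \<subseteq> range g" using self by (metis image_subsetI rangeI)
  qed
  moreover have "g ` cball 0 \<rho> = f ` K"
  proof
    show "g ` cball 0 \<rho> \<subseteq> f ` K" using mem by (auto simp: g_def)
    show "f ` K \<subseteq> g ` cball 0 \<rho>"
    proof (rule image_subsetI)
      fix x assume "x \<in> K"
      then have "f x = g x" "x \<in> cball 0 \<rho>" using self \<rho>(2) by auto
      then show "f x \<in> g ` cball 0 \<rho>" by blast
    qed
  qed
  ultimately show ?thesis using lip \<rho>(1) by (intro exI[of _ g] exI[of _ \<rho>]) simp
qed

text \<open>An open set is a countable union of closed boxes, so it suffices to treat one box.\<close>

lemma hausdorff_null_lipschitz_image_openI: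
  fixes f :: "'a::euclidean_space \<Rightarrow> 'b::metric_space"
  assumes \<Omega>: "open \<Omega>" and L: "L-lipschitz_on \<Omega> f" and m: "m > 0"
    and null: "\<And>g \<rho>. \<forall>x y. dist (g x) (g y) \<le> L * norm (x - y) \<Longrightarrow> range g \<subseteq> f ` \<Omega> \<Longrightarrow> \<rho> \<ge> 0 \<Longrightarrow>
      hausdorff_measure m (g ` cball (0::'a) \<rho>) = 0"
  shows "hausdorff_measure m (f ` \<Omega>) = 0"
proof -
  obtain \<D> :: "'a set set" where D: "countable \<D>" "\<D> \<subseteq> Pow \<Omega>" "\<And>K. K \<in> \<D> \<Longrightarrow> \<exists>a b. K = cbox a b" "\<Union>\<D> = \<Omega>"
    using open_countable_Union_open_cbox[OF \<Omega>] by metis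
  have nullK: "hausdorff_measure m (f ` K) = 0" if K: "K \<in> \<D>" for K
  proof (cases "K = {}")
    case True
    have "hausdorff_measure m ({} :: 'b set) = 0"
      by (rule hausdorff_measure_null_if_finite_covers[OF m]) (intro exI[of _ "{}"], simp)
    then show ?thesis using True by simp
  next
    case False
    have sub: "K \<subseteq> \<Omega>" using D(2) K by blast
    have cK: "compact K" "convex K" using D(3)[OF K] by (auto simp: compact_cbox)
    have LK: "L-lipschitz_on K f" using L sub by (rule lipschitz_on_subset)
    from lipschitz_image_eq_cball_image[OF LK cK False]
    obtain g :: "'a \<Rightarrow> 'b" and \<rho> where g: "\<forall>x y. dist (g x) (g y) \<le> L * norm (x - y)" "range g = f ` K" "\<rho> \<ge> 0"
      "g ` cball 0 \<rho> = f ` K"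
      by (elim exE conjE) (rule that)
    have "range g \<subseteq> f ` \<Omega>" using g(2) sub by blast
    from null[OF g(1) this g(3)] show ?thesis by (simp add: g(4))
  qed
  show ?thesis
  proof (cases "\<D> = {}")
    case True
    then have "f ` \<Omega> = {}" using D(4) by auto
    then show ?thesis
      by (intro hausdorff_measure_null_if_finite_covers[OF m]) (intro exI[of _ "{}"], simp)
  next
    case False
    have "f ` \<Omega> = (\<Union>k. f ` from_nat_into \<D> k)"
    proof -
      have "\<Omega> = (\<Union>k. from_nat_into \<D> k)"
        using D(4) range_from_nat_into[OF False D(1)] by simp
      then show ?thesis by (metis image_UN)
    qed
    moreover have "hausdorff_measure m (\<Union>k. f ` from_nat_into \<D> k) = 0"
      using nullK from_nat_into[OF False] by (intro hausdorff_measure_null_UN) blast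
    ultimately show ?thesis by simp
  qed
qed

theorem theorem1p5:
  fixes \<Omega> :: "(real ^ 'n) set" and f :: "real ^ 'n \<Rightarrow> 'b::metric_space" and X :: "'b set"
  assumes "open \<Omega>"
    and "\<exists>L. L-lipschitz_on \<Omega> f"
    and "f ` \<Omega> = X"
  shows "small_ind_dim (top_of_set X) = ereal (real CARD('n)) \<longleftrightarrow> hausdorff_measure CARD('n) X > 0"
proof -
  let ?n = "CARD('n)"
  obtain L where L: "L-lipschitz_on \<Omega> f" using assms(2) by blast
  have L0: "L \<ge> 0" using L by (rule lipschitz_on_nonneg)
  have "hausdorff_measure (Suc ?n) X = 0"
  proof -
    have "hausdorff_measure (Suc ?n) (f ` \<Omega>) = 0"
    proof (rule hausdorff_null_lipschitz_image_openI[OF assms(1) L])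
      fix g :: "real ^ 'n \<Rightarrow> 'b" and \<rho> :: real
      assume g: "\<forall>x y. dist (g x) (g y) \<le> L * norm (x - y)" "\<rho> \<ge> 0"
      then have "dist (g x) (g y) \<le> L * norm (x - y)" for x y by blast
      from lipschitz_image_cball_null_Suc[of g, OF this L0 g(2)]
      show "hausdorff_measure (Suc ?n) (g ` cball 0 \<rho>) = 0" by simp
    qed simp
    then show ?thesis by (simp add: assms(3))
  qed
  from hausdorff_null_imp_ind_dim_le[OF this]
  have le: "ind_dim_le (top_of_set X) (int ?n)" by simp
  have "ind_dim_le (top_of_set X) (int ?n - 1) \<longleftrightarrow> hausdorff_measure ?n X = 0"
  proof
    assume dim: "ind_dim_le (top_of_set X) (int ?n - 1)"
    have "hausdorff_measure ?n (f ` \<Omega>) = 0"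
    proof (rule hausdorff_null_lipschitz_image_openI[OF assms(1) L])
      fix g :: "real ^ 'n \<Rightarrow> 'b" and \<rho> :: real
      assume g: "\<forall>x y. dist (g x) (g y) \<le> L * norm (x - y)" "range g \<subseteq> f ` \<Omega>" "\<rho> \<ge> 0"
      then have lip: "dist (g x) (g y) \<le> L * norm (x - y)" for x y by blast
      have "range g \<subseteq> X" using g(2) assms(3) by simp
      from lipschitz_image_cball_null[of g, OF lip L0 g(3) this] dim
      show "hausdorff_measure ?n (g ` cball 0 \<rho>) = 0" by simp
    qed simp
    then show "hausdorff_measure ?n X = 0" by (simp add: assms(3))
  next
    assume "hausdorff_measure ?n X = 0"
    then show "ind_dim_le (top_of_set X) (int ?n - 1)" by (rule hausdorff_null_imp_ind_dim_le)
  qed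
  then show ?thesis
    using small_ind_dim_eq_iff[of "top_of_set X" "int ?n"] le by (simp add: zero_less_iff_neq_zero)
qed

end
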